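(* Let $\omega$ be a radial weight. Then the following statements are equivalent: (i) there exists $C=C(\omega)>0$ such that for each $f\in\mathcal{B}$ there is $g\in L^\infty$ such that $P_\omega(g)=f$ and $\|g\|_{L^\infty}\le C\|f\|_{\mathcal{B}}$ (that is, $\mathcal{B}$ is continuously embedded into $P_\omega(L^\infty)$); (ii) there exists $C=C(\omega)>0$ such that $\left|\langle f,g\rangle_{A^2_\omega}\right|\le C\|g\|_{\mathcal{B}}\|f\|_{A^1_\omega}$ for all $f\in A^1_\omega$ and $g\in\mathcal{B}$ (that is, each $g\in\mathcal{B}$ induces an element of $(A^1_\omega)^\star$ via the $A^2_\omega$-pairing); (iii) there exists $C=C(\omega)>0$ such that $\left|\langle g,f\rangle_{A^2_\omega}\right|\le C\|g\|_{\mathcal{B}}\|f\|_{A^1_\omega}$ for all $f\in A^1_\omega$ and $g\in\mathcal{B}_0$ (that is, each $f\in A^1_\omega$ induces an element of $\mathcal{B}_0^\star$ via the $A^2_\omega$-pairing); (iv) $\omega\in\mathcal{M}$.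
   Context: $\mathbb{D}$ is the open unit disc of $\mathbb{C}$, $\mathcal{H}(\mathbb{D})$ the space of analytic functions in $\mathbb{D}$, and $dA(z)=\frac{dx\,dy}{\pi}$. A radial weight is a nonnegative function $\omega\in L^1([0,1))$ extended to $\mathbb{D}$ by $\omega(z)=\omega(|z|)$; it is assumed throughout that $\widehat{\omega}(z)=\int_{|z|}^1\omega(s)\,ds>0$ for all $z\in\mathbb{D}$. For $0<p<\infty$, $L^p_\omega$ is the space of measurable $f$ on $\mathbb{D}$ with $\|f\|_{L^p_\omega}^p=\int_{\mathbb{D}}|f(z)|^p\omega(z)\,dA(z)<\infty$, and $A^p_\omega=L^p_\omega\cap\mathcal{H}(\mathbb{D})$. Write $\omega_x=\int_0^1r^x\omega(r)\,dr$ for $x\ge0$. The reproducing kernel of $A^2_\omega$ is $B^\omega_z(\zeta)=\sum_{n=0}^\infty\frac{(\overline{z}\zeta)^n}{2\omega_{2n+1}}$, and the Bergman projection is $P_\omega(f)(z)=\int_{\mathbb{D}}f(\zeta)\overline{B^\omega_z(\zeta)}\,\omega(\zeta)\,dA(\zeta)$. $L^\infty$ is the space of (essentially) bounded measurable functions on $\mathbb{D}$. The Bloch space $\mathcal{B}$ consists of $f\in\mathcal{H}(\mathbb{D})$ with $\|f\|_{\mathcal{B}}=\sup_{z\in\mathbb{D}}|f'(z)|(1-|z|^2)+|f(0)|<\infty$; the little Bloch space $\mathcal{B}_0$ (with the norm of $\mathcal{B}$) consists of $f\in\mathcal{H}(\mathbb{D})$ with $f'(z)(1-|z|^2)\to0$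 as $|z|\to1^-$. $X^\star$ is the dual of $X$. The $A^2_\omega$-pairing is $\langle f,g\rangle_{A^2_\omega}=\lim_{r\to1^-}\int_{\mathbb{D}}f_r(z)\overline{g(z)}\,\omega(z)\,dA(z)$, where $f_r(z)=f(rz)$. $\omega\in\mathcal{M}$ means that there are constants $C=C(\omega)>1$ and $K=K(\omega)>1$ such that $\omega_x\ge C\omega_{Kx}$ for all $x\ge1$. *)

theory Defs
  imports "HOL-Complex_Analysis.Complex_Analysis" "HOL-Probability.Essential_Supremum"
begin

abbreviation unit_disc :: "complex set" where
  "unit_disc \<equiv> ball 0 1"

definition dA :: "complex measure" where
  "dA = density (lebesgue_on unit_disc) (\<lambda>_. ennreal (1 / pi))"

text \<open>A radial weight is given by its profile on \<open>[0,1)\<close>; its value at a point \<open>z\<close> of the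
  disc is \<open>\<omega> (norm z)\<close>.\<close>

definition radial_weight :: "(real \<Rightarrow> real) \<Rightarrow> bool" where
  "radial_weight \<omega> \<longleftrightarrow> (\<forall>r\<in>{0..<1}. 0 \<le> \<omega> r) \<and> set_integrable lebesgue {0..<1} \<omega>"

definition weight_tail :: "(real \<Rightarrow> real) \<Rightarrow> complex \<Rightarrow> real" where
  "weight_tail \<omega> z = (LINT s:{norm z..<1}|lebesgue. \<omega> s)"

definition moment :: "(real \<Rightarrow> real) \<Rightarrow> real \<Rightarrow> real" where
  "moment \<omega> x = (LINT r:{0..<1}|lebesgue. r powr x * \<omega> r)"

definition weight_class_M :: "(real \<Rightarrow> real) set" where
  "weight_class_M = {\<omega>. \<exists>C>1. \<exists>K>1. \<forall>x\<ge>1. moment \<omega> x \<ge> C * moment \<omega> (K * x)}"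

definition weighted_Lp :: "real \<Rightarrow> (real \<Rightarrow> real) \<Rightarrow> (complex \<Rightarrow> complex) set" where
  "weighted_Lp p \<omega> = {f \<in> borel_measurable dA. integrable dA (\<lambda>z. norm (f z) powr p * \<omega> (norm z))}"

definition weighted_Lp_norm :: "real \<Rightarrow> (real \<Rightarrow> real) \<Rightarrow> (complex \<Rightarrow> complex) \<Rightarrow> real" where
  "weighted_Lp_norm p \<omega> f = (\<integral>z. norm (f z) powr p * \<omega> (norm z) \<partial>dA) powr (1 / p)"

definition Bergman_space :: "real \<Rightarrow> (real \<Rightarrow> real) \<Rightarrow> (complex \<Rightarrow> complex) set" where
  "Bergman_space p \<omega> = weighted_Lp p \<omega> \<inter> {f. f holomorphic_on unit_disc}"

definition Bergman_kernel :: "(real \<Rightarrow> real) \<Rightarrow> complex \<Rightarrow> complex \<Rightarrow> complex" where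
  "Bergman_kernel \<omega> z \<zeta> =
     (\<Sum>n. (cnj z * \<zeta>) ^ n / complex_of_real (2 * moment \<omega> (2 * real n + 1)))"

definition Bergman_projection ::
    "(real \<Rightarrow> real) \<Rightarrow> (complex \<Rightarrow> complex) \<Rightarrow> complex \<Rightarrow> complex" where
  "Bergman_projection \<omega> f z =
     (\<integral>\<zeta>. f \<zeta> * cnj (Bergman_kernel \<omega> z \<zeta>) * complex_of_real (\<omega> (norm \<zeta>)) \<partial>dA)"

definition Linfty :: "(complex \<Rightarrow> complex) set" where
  "Linfty = {g \<in> borel_measurable dA. esssup dA (\<lambda>z. ereal (norm (g z))) < \<infinity>}"

definition Linfty_norm :: "(complex \<Rightarrow> complex) \<Rightarrow> real" where
  "Linfty_norm g = real_of_ereal (esssup dA (\<lambda>z. ereal (norm (g z))))"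

definition Bloch_space :: "(complex \<Rightarrow> complex) set" where
  "Bloch_space = {f. f holomorphic_on unit_disc \<and>
     bdd_above ((\<lambda>z. norm (deriv f z) * (1 - (norm z)\<^sup>2)) ` unit_disc)}"

definition Bloch_norm :: "(complex \<Rightarrow> complex) \<Rightarrow> real" where
  "Bloch_norm f = (SUP z\<in>unit_disc. norm (deriv f z) * (1 - (norm z)\<^sup>2)) + norm (f 0)"

text \<open>The filter \<open>filtercomap norm (at_left 1)\<close> expresses \<open>|z| \<rightarrow> 1\<close> from inside the disc,
  uniformly in the argument of \<open>z\<close>.\<close>

definition little_Bloch_space :: "(complex \<Rightarrow> complex) set" where
  "little_Bloch_space = {f. f holomorphic_on unit_disc \<and>
     ((\<lambda>z. deriv f z * complex_of_real (1 - (norm z)\<^sup>2)) \<longlongrightarrow> 0) (filtercomap norm (at_left 1))}"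

definition pairing_integrand ::
    "(real \<Rightarrow> real) \<Rightarrow> (complex \<Rightarrow> complex) \<Rightarrow> (complex \<Rightarrow> complex) \<Rightarrow> real \<Rightarrow> complex \<Rightarrow> complex" where
  "pairing_integrand \<omega> f g r z =
     f (complex_of_real r * z) * cnj (g z) * complex_of_real (\<omega> (norm z))"

definition A2_pairing ::
    "(real \<Rightarrow> real) \<Rightarrow> (complex \<Rightarrow> complex) \<Rightarrow> (complex \<Rightarrow> complex) \<Rightarrow> complex" where
  "A2_pairing \<omega> f g = Lim (at_left 1) (\<lambda>r. \<integral>z. pairing_integrand \<omega> f g r z \<partial>dA)"

text \<open>Both \<open>Lim\<close> and the Bochner integral are total, so \<open>A2_pairing\<close> carries meaning only if the
  integrals exist and converge. This is not automatic: a Bloch function need not be integrable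
  with respect to an arbitrary radial weight.\<close>

definition A2_pairing_exists ::
    "(real \<Rightarrow> real) \<Rightarrow> (complex \<Rightarrow> complex) \<Rightarrow> (complex \<Rightarrow> complex) \<Rightarrow> bool" where
  "A2_pairing_exists \<omega> f g \<longleftrightarrow>
     (\<forall>r\<in>{0<..<1}. integrable dA (pairing_integrand \<omega> f g r)) \<and>
     (\<exists>L. ((\<lambda>r. \<integral>z. pairing_integrand \<omega> f g r z \<partial>dA) \<longlongrightarrow> L) (at_left 1))"

end

theory Submission
  imports Defs "HOL-Probability.Distribution_Functions" "HOL-Real_Asymp.Real_Asymp"
begin

text \<open>Write \<open>W\<close> for the measure \<open>\<omega> dA\<close> and \<open>mass n\<close> for the integral of \<open>|z|\<^sup>2\<^sup>n\<close> with respect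
  to \<open>W\<close>.

  If \<open>\<omega> \<in> \<M>\<close>, the Taylor coefficients of a Bloch function \<open>f\<close> are split by tents supported on
  \<open>[N, 4N]\<close>, \<open>N = 2\<^sup>k\<close>. Each block \<open>f\<^sub>k\<close> is at most a constant times the Bloch norm on the unit
  circle, by the reproducing formula for \<open>f' (1 - |z|\<^sup>2)\<close>. By iteration, \<open>\<omega> \<in> \<M>\<close> implies that
  the mass of \<open>W\<close> outside the disc of radius \<open>R = exp (- d / N)\<close> is at most the integral of
  \<open>|z|\<^sup>8\<^sup>N\<close> inside it, so that \<open>f\<^sub>k\<close> can be replaced by a function supported in \<open>|z| \<le> R\<close> with
  the same moments against \<open>cnj z\<^sup>n\<close>, of size \<open>O(|z|\<^sup>N)\<close>. Because of the cutoff these functions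
  add up to a bounded function \<open>g\<close> with \<open>P g = f\<close>. Pairing the blocks with \<open>A\<^sup>1\<close> functions and
  letting the dilation parameter tend to \<open>1\<close> gives the two duality estimates.

  Conversely, each of the three statements is tested on \<open>p\<close>, the sum of \<open>z\<^sup>m\<close> over \<open>m = 2\<^sup>j N\<close>
  with \<open>j < J\<close>. Its Bloch norm is at most \<open>4\<close>, its \<open>A\<^sup>1\<close> norm is at most \<open>sqrt J\<close> times the moment
  \<open>2 \<omega>\<^sub>x\<close> for \<open>x = N + 1\<close>, while \<open>p\<close> pairs with itself to at least \<open>J mass (2\<^sup>J N)\<close>; a large \<open>J\<close>
  then yields \<open>\<M>\<close>.\<close>

text \<open>The class \<open>weight_class_M\<close> compares moments in one direction only and gives
  no doubling of the tails, so pointwise estimates of the Bergman kernel are not at hand. The proof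
  avoids them: the projection and the dilated pairings see a function only through its moments
  against \<open>cnj z ^ n\<close>, so a Bloch function may be traded for any function with the same
  moments. Blocks of size |z|^N with N = 2^k are not enough, since the sum of these powers over k
  grows like log (1 / (1 - |z|)). The cutoff removes this loss: at radius r only blocks with r \<le>
  exp (- d / 2^k) survive, and these decay geometrically with a ratio depending on d alone. The
  exponent 8N is twice the largest index of a block, so every radial factor |z|^(2n) that occurs
  divides one common power |z|^(8N). The converse rests on the gap between J and sqrt J, which beats
  any fixed constant.\<close>

section \<open>Rotations and polar coordinates for area measure on the disc\<close>

lemma nn_integral_lborel_translate:
  fixes f :: "'a::euclidean_space \<Rightarrow> ennreal"
  assumes "f \<in> borel_measurable borel"
  shows "(\<integral>\<^sup>+x. f (c + x) \<partial>lborel) = (\<integral>\<^sup>+x. f x \<partial>lborel)"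
proof -
  have "(\<integral>\<^sup>+x. f x \<partial>lborel) = (\<integral>\<^sup>+x. f x \<partial>distr lborel borel ((+) c))"
    by (simp add: lborel_distr_plus)
  also have "\<dots> = (\<integral>\<^sup>+x. f (c + x) \<partial>lborel)"
    using assms by (subst nn_integral_distr) auto
  finally show ?thesis by simp
qed

text \<open>Integrating \<open>1\<^sub>A (x + u y) 1\<^sub>B (u y)\<close> over \<open>x, y\<close> in both orders, where \<open>B\<close> is
  the unit ball, compares the measure of \<open>A\<close> with that of its rotation.\<close>

lemma lborel_rotation:
  fixes u :: complex
  assumes u: "norm u = 1"
  shows "distr lborel borel (\<lambda>z. u * z) = lborel"
proof (rule measure_eqI)
  show "sets (distr lborel borel (\<lambda>z. u * z)) = sets lborel" by simp
next
  fix A assume "A \<in> sets (distr lborel borel (\<lambda>z. u * z))"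
  then have A[measurable]: "A \<in> sets borel" by simp
  \<comment> \<open>\<open>B\<close> is rotation invariant and has positive finite measure, so its
    measure can be cancelled at the end.\<close>
  define B :: "complex set" where "B = ball 0 1"
  have B[measurable]: "B \<in> sets borel" by (simp add: B_def)
  have T[measurable]: "(\<lambda>z. u * z) \<in> borel_measurable borel" by measurable
  have u0: "u \<noteq> 0" using u by auto
  have X: "(\<integral>\<^sup>+y. \<integral>\<^sup>+x. indicator A (u*y + x) * indicator B (u*y) \<partial>lborel \<partial>lborel)
     = emeasure lborel A * emeasure lborel B"
  proof -
    have "(\<integral>\<^sup>+x. indicator A (u*y + x) * indicator B (u*y) \<partial>lborel)
        = emeasure lborel A * indicator B y" for y
    proof -
      have "(\<integral>\<^sup>+x. indicator A (u*y + x) * indicator B (u*y) \<partial>lborel) =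
         (\<integral>\<^sup>+x. indicator A (u*y + x) \<partial>lborel) * indicator B (u*y)"
        by (rule nn_integral_multc) measurable
      also have "(\<integral>\<^sup>+x. indicator A (u*y + x) \<partial>lborel) = (\<integral>\<^sup>+x. indicator A x \<partial>lborel)"
        by (rule nn_integral_lborel_translate) measurable
      also have "\<dots> = emeasure lborel A"
        by simp
      moreover have "indicator B (u*y) = (indicator B y :: ennreal)"
        using u by (auto simp: B_def indicator_def norm_mult)
      ultimately show ?thesis by simp
    qed
    then show ?thesis by (simp add: nn_integral_cmult)
  qed
  have "(\<integral>\<^sup>+y. \<integral>\<^sup>+x. indicator A (u*y + x) * indicator B (u*y) \<partial>lborel \<partial>lborel)
     = (\<integral>\<^sup>+x. \<integral>\<^sup>+y. indicator A (u*y + x) * indicator B (u*y) \<partial>lborel \<partial>lborel)"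
    by (rule lborel_pair.Fubini') measurable
  also have "\<dots> = (\<integral>\<^sup>+x. \<integral>\<^sup>+y. indicator A (u*y) * indicator B (u*y - x) \<partial>lborel \<partial>lborel)"
  proof (rule nn_integral_cong)
    fix x :: complex
    have "(\<integral>\<^sup>+y. indicator A (u*y) * indicator B (u*y - x) \<partial>lborel)
      = (\<integral>\<^sup>+y. indicator A (u*(x/u+y)) * indicator B (u*(x/u+y) - x) \<partial>lborel)"
      by (rule nn_integral_lborel_translate[symmetric]) measurable
    also have "\<dots> = (\<integral>\<^sup>+y. indicator A (u*y + x) * indicator B (u*y) \<partial>lborel)"
      using u0 by (simp add: algebra_simps)
    finally show "(\<integral>\<^sup>+y. indicator A (u*y + x) * indicator B (u*y) \<partial>lborel) =
      (\<integral>\<^sup>+y. indicator A (u*y) * indicator B (u*y - x) \<partial>lborel)" by simp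
  qed
  also have "\<dots> = (\<integral>\<^sup>+y. \<integral>\<^sup>+x. indicator A (u*y) * indicator B (u*y - x) \<partial>lborel \<partial>lborel)"
    by (rule lborel_pair.Fubini') measurable
  also have "\<dots> = (\<integral>\<^sup>+y. indicator A (u*y) * emeasure lborel B \<partial>lborel)"
  proof (rule nn_integral_cong)
    fix y :: complex
    have "(\<integral>\<^sup>+x. indicator A (u*y) * indicator B (u*y - x) \<partial>lborel)
      = indicator A (u*y) * (\<integral>\<^sup>+x. indicator B (u*y - x) \<partial>lborel)"
      by (rule nn_integral_cmult) measurable
    moreover have "(\<lambda>x. indicator B (u*y - x)) = (\<lambda>x. indicator (ball (u*y) 1) x :: ennreal)"
      by (auto simp: B_def indicator_def fun_eq_iff dist_norm norm_minus_commute)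
    moreover have "emeasure lborel (ball (u*y) 1) = emeasure lborel B"
      by (simp add: B_def emeasure_ball)
    ultimately show "(\<integral>\<^sup>+x. indicator A (u*y) * indicator B (u*y - x) \<partial>lborel) =
      indicator A (u*y) * emeasure lborel B" by simp
  qed
  also have "\<dots> = (\<integral>\<^sup>+y. indicator A (u*y) \<partial>lborel) * emeasure lborel B"
    by (rule nn_integral_multc) measurable
  also have "(\<integral>\<^sup>+y. indicator A (u*y) \<partial>lborel) = emeasure (distr lborel borel (\<lambda>z. u * z)) A"
    by (simp add: nn_integral_distr flip: nn_integral_indicator)
  finally have eq: "emeasure lborel A * emeasure lborel B
     = emeasure (distr lborel borel (\<lambda>z. u * z)) A * emeasure lborel B" using X by simp
  have "emeasure lborel B = ennreal pi"
    by (simp add: B_def emeasure_ball unit_ball_vol_2)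
  then have fin: "emeasure lborel B \<noteq> 0" "emeasure lborel B \<noteq> top"
    by auto
  have "emeasure lborel A * emeasure lborel B / emeasure lborel B
    = emeasure (distr lborel borel (\<lambda>z. u * z)) A * emeasure lborel B / emeasure lborel B"
    using eq by simp
  then show "emeasure (distr lborel borel (\<lambda>z. u * z)) A = emeasure lborel A"
    using fin by (simp add: ennreal_mult_divide_eq)
qed

text \<open>Polar coordinates without a change of variables: for \<open>a\<close> in [0,1] both
  measures give \<open>{..a}\<close> the mass a^2, and a finite Borel measure on the line is
  determined by its distribution function.\<close>

lemma distr_norm_disc:
  "distr (density lborel (\<lambda>z::complex. ennreal (indicator unit_disc z / pi))) borel norm
   = density lborel (\<lambda>r. ennreal (indicator {0..<1} r * (2 * r)))" (is "?M = ?N")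
proof (rule cdf_unique')
  have emM: "emeasure ?M {..a} = (if a < 0 then 0 else if a < 1 then ennreal (a^2) else 1)" for a
  proof -
    have "emeasure ?M {..a} = emeasure (density lborel (\<lambda>z::complex. ennreal (indicator unit_disc z / pi))) (norm -` {..a})"
      by (subst emeasure_distr) auto
    also have "\<dots> = (\<integral>\<^sup>+z. ennreal (indicator unit_disc z / pi) * indicator (norm -` {..a}) (z::complex) \<partial>lborel)"
    proof (rule emeasure_density)
      show "(\<lambda>z::complex. ennreal (indicator unit_disc z / pi)) \<in> borel_measurable lborel"
        by (intro measurable_compose[OF _ measurable_ennreal] borel_measurable_divide
            borel_measurable_indicator) auto
      have "norm -` {..a} = (cball 0 a :: complex set)" by auto
      then show "norm -` {..a} \<in> sets (lborel :: complex measure)" by simp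
    qed
    also have "\<dots> = (\<integral>\<^sup>+z. ennreal (1/pi) * indicator (unit_disc \<inter> cball 0 a) (z::complex) \<partial>lborel)"
      by (rule nn_integral_cong) (auto simp: indicator_def)
    also have "\<dots> = ennreal (1/pi) * emeasure lborel (unit_disc \<inter> cball 0 a)"
      by (rule nn_integral_cmult_indicator) auto
    also have "emeasure lborel (unit_disc \<inter> cball 0 a) =
        (if a < 0 then 0 else if a < 1 then ennreal (pi * a^2) else ennreal pi)"
    proof -
      have "unit_disc \<inter> cball 0 a = (if a < 0 then {} else if a < 1 then cball 0 a else unit_disc)"
        by auto
      then show ?thesis by (simp add: emeasure_ball emeasure_cball unit_ball_vol_2)
    qed
    finally show ?thesis by (auto simp: ennreal_mult'[symmetric])
  qed
  have emN: "emeasure ?N {..a} = (if a < 0 then 0 else if a < 1 then ennreal (a^2) else 1)" for a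
  proof -
    have *: "(\<integral>\<^sup>+r. ennreal (2*r) * indicator {0..b} r \<partial>lborel) = ennreal (b^2)" if "0 \<le> b" for b
    proof -
      have "(\<integral>\<^sup>+r. ennreal (2*r) * indicator {0..b} r \<partial>lborel) = ennreal (b^2 - 0^2)"
        using that by (intro nn_integral_FTC_Icc) (auto intro!: derivative_eq_intros)
      then show ?thesis by simp
    qed
    have ae: "AE x in lborel. (x::real) \<noteq> 1" by (rule AE_lborel_singleton)
    have "emeasure ?N {..a} = (\<integral>\<^sup>+r. ennreal (indicator {0..<1} r * (2 * r)) * indicator {..a} r \<partial>lborel)"
      by (rule emeasure_density) auto
    also have "\<dots> = (\<integral>\<^sup>+r. ennreal (2*r) * indicator {0..min a 1} r \<partial>lborel)"
      by (rule nn_integral_cong_AE) (use ae in eventually_elim, auto simp: indicator_def)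
    also have "\<dots> = (if a < 0 then 0 else if a < 1 then ennreal (a^2) else 1)"
      using *[of "min a 1"] by (auto simp: min_def)
    finally show ?thesis .
  qed
  have fin: "finite_borel_measure L"
    if L: "sets L = sets borel" "\<And>a. emeasure L {..a} \<le> 1" for L :: "real measure"
  proof -
    have "space L = (\<Union>n::nat. {..real n})"
      using sets_eq_imp_space_eq[OF L(1)] real_arch_simple by auto
    moreover have "(SUP n. emeasure L {..real n}) = emeasure L (\<Union>n::nat. {..real n})"
      by (rule SUP_emeasure_incseq) (auto simp: L(1) incseq_def)
    moreover have "(SUP n. emeasure L {..real n}) \<le> 1"
      using L(2) by (auto intro: SUP_least)
    ultimately have "emeasure L (space L) \<le> 1" by simp
    then have "emeasure L (space L) \<noteq> \<infinity>"
      using ennreal_one_less_top by (metis infinity_ennreal_def leD)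
    then show ?thesis
      using L(1) by (intro finite_borel_measure.intro finite_measureI finite_borel_measure_axioms.intro)
  qed
  show "finite_borel_measure ?M" "finite_borel_measure ?N"
    by (rule fin; simp add: emM emN power_le_one)+
  show "cdf ?M = cdf ?N"
    by (rule ext) (simp add: cdf_def measure_def emM emN)
qed

lemma space_dA [simp]: "space dA = unit_disc"
  by (simp add: dA_def)

lemma borel_measurable_dA: "f \<in> borel_measurable borel \<Longrightarrow> f \<in> borel_measurable dA"
proof -
  assume f: "f \<in> borel_measurable borel"
  then have "f \<in> borel_measurable lebesgue" by (intro measurable_completion) simp
  then have "f \<in> borel_measurable (lebesgue_on unit_disc)" by (rule measurable_restrict_space1)
  then show ?thesis by (simp add: dA_def)
qed

lemma nn_integral_dA:
  assumes "f \<in> borel_measurable dA"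
  shows "(\<integral>\<^sup>+z. f z \<partial>dA) = (\<integral>\<^sup>+z. ennreal (indicator unit_disc z / pi) * f z \<partial>lborel)"
proof -
  have "(\<integral>\<^sup>+z. f z \<partial>dA) = (\<integral>\<^sup>+z. ennreal (1/pi) * f z \<partial>lebesgue_on unit_disc)"
    using assms unfolding dA_def by (subst nn_integral_density) auto
  also have "\<dots> = (\<integral>\<^sup>+z. ennreal (1/pi) * f z * indicator unit_disc z \<partial>lebesgue)"
    by (rule nn_integral_restrict_space) auto
  also have "\<dots> = (\<integral>\<^sup>+z. ennreal (1/pi) * f z * indicator unit_disc z \<partial>lborel)"
    by (rule nn_integral_completion)
  also have "\<dots> = (\<integral>\<^sup>+z. ennreal (indicator unit_disc z / pi) * f z \<partial>lborel)"
    by (rule nn_integral_cong) (auto simp: indicator_def)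
  finally show ?thesis .
qed

lemma indicator_disc_measurable:
  "(\<lambda>z::complex. ennreal (indicator unit_disc z / pi)) \<in> borel_measurable lborel"
  by (intro measurable_compose[OF _ measurable_ennreal] borel_measurable_divide
      borel_measurable_indicator) auto

lemma nn_integral_dA_radial:
  assumes v: "v \<in> borel_measurable borel"
  shows "(\<integral>\<^sup>+z. v (norm z) \<partial>dA) = (\<integral>\<^sup>+r. ennreal (indicator {0..<1} r * (2 * r)) * v r \<partial>lborel)"
proof -
  have m: "(\<lambda>z::complex. v (norm z)) \<in> borel_measurable borel"
    using v by measurable
  have "(\<integral>\<^sup>+z. v (norm z) \<partial>dA) = (\<integral>\<^sup>+z. ennreal (indicator unit_disc z / pi) * v (norm z) \<partial>lborel)"
    by (rule nn_integral_dA[OF borel_measurable_dA[OF m]])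
  also have "\<dots> = (\<integral>\<^sup>+z. v (norm z) \<partial>density lborel (\<lambda>z::complex. ennreal (indicator unit_disc z / pi)))"
    using m by (subst nn_integral_density[OF indicator_disc_measurable]) auto
  also have "\<dots> = (\<integral>\<^sup>+r. v r \<partial>distr (density lborel (\<lambda>z::complex. ennreal (indicator unit_disc z / pi))) borel norm)"
    using v by (subst nn_integral_distr) auto
  also have "\<dots> = (\<integral>\<^sup>+r. ennreal (indicator {0..<1} r * (2 * r)) * v r \<partial>lborel)"
    unfolding distr_norm_disc using v by (subst nn_integral_density) auto
  finally show ?thesis .
qed

text \<open>A null set of radii pulls back to a null set of the disc. This allows the weight to be
  changed on a null set of radii.\<close>

lemma AE_dA_norm:
  assumes "AE r in lborel. P (r::real)"
  shows "AE z in dA. P (norm z)"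
proof -
  obtain N where N: "N \<in> null_sets lborel" "\<And>r. r \<notin> N \<Longrightarrow> P r"
    using assms by (auto elim!: AE_E3)
  have [measurable]: "N \<in> sets borel" using N(1) by auto
  have "(\<integral>\<^sup>+z. indicator N (norm z) \<partial>dA) = (\<integral>\<^sup>+r. ennreal (indicator {0..<1} r * (2 * r)) * indicator N r \<partial>lborel)"
    by (rule nn_integral_dA_radial) measurable
  also have "\<dots> = 0"
    using N(1) by (subst nn_integral_0_iff_AE) (auto elim!: AE_mp[OF AE_not_in])
  finally have "AE z in dA. (indicator N (norm z) :: ennreal) = 0"
    by (subst (asm) nn_integral_0_iff_AE) (auto intro!: borel_measurable_dA)
  then show ?thesis
    by eventually_elim (use N(2) in \<open>auto simp: indicator_def split: if_splits\<close>)
qed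

section \<open>The weighted measure: measurability, rotation invariance, radial integrals\<close>

definition weighted_dA :: "(real \<Rightarrow> real) \<Rightarrow> complex measure" where
  "weighted_dA \<omega> = density dA (\<lambda>z. ennreal (\<omega> (norm z)))"

locale weighted_disc =
  fixes \<omega> :: "real \<Rightarrow> real"
  assumes weight: "radial_weight \<omega>"
    and tail: "\<forall>z\<in>unit_disc. weight_tail \<omega> z > 0"
begin

abbreviation W :: "complex measure" where "W \<equiv> weighted_dA \<omega>"

lemma weight_nonneg: "0 \<le> r \<Longrightarrow> r < 1 \<Longrightarrow> 0 \<le> \<omega> r"
  using weight by (auto simp: radial_weight_def)

lemma weight_integrable: "set_integrable lebesgue {0..<1} \<omega>"
  using weight by (auto simp: radial_weight_def)

text \<open>The profile is only Lebesgue measurable on [0,1) and arbitrary elsewhere, so its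
  composition with \<open>norm\<close> is not measurable for free. A nonnegative Borel function that
  agrees with it almost everywhere is used instead.\<close>

lemma Borel_representative:
  obtains w where "w \<in> borel_measurable borel" "\<And>r. 0 \<le> w r"
    "AE r in lborel. 0 \<le> r \<and> r < 1 \<longrightarrow> w r = \<omega> r"
proof -
  have "(\<lambda>r. indicator {0..<1} r * \<omega> r) \<in> borel_measurable lebesgue"
    using weight_integrable by (auto simp: set_integrable_def)
  from completion_ex_borel_measurable_real[OF this]
  obtain g where g: "g \<in> borel_measurable borel" "AE r in lborel. indicator {0..<1} r * \<omega> r = g r"
    by auto
  show ?thesis
  proof (rule that[of "\<lambda>r. max 0 (g r)"])
    show "AE r in lborel. 0 \<le> r \<and> r < 1 \<longrightarrow> max 0 (g r) = \<omega> r"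
      using g(2) by eventually_elim (use weight_nonneg in \<open>force simp: indicator_def max_def\<close>)
  qed (use g in auto)
qed

lemma weight_measurable: "(\<lambda>z. \<omega> (norm z)) \<in> borel_measurable dA"
proof -
  obtain w where w: "w \<in> borel_measurable borel" "\<And>r. 0 \<le> w r"
    "AE r in lborel. 0 \<le> r \<and> r < 1 \<longrightarrow> w r = \<omega> r" by (rule Borel_representative) blast
  have "AE z in dA. 0 \<le> norm z \<and> norm z < 1 \<longrightarrow> w (norm z) = \<omega> (norm z)"
    by (rule AE_dA_norm) (rule w(3))
  then have "AE z in lebesgue_on unit_disc. w (norm z) = \<omega> (norm z)"
    unfolding dA_def by (subst (asm) AE_density) (auto simp: AE_restrict_space_iff)
  then have "AE z in lebesgue. z \<in> unit_disc \<longrightarrow> w (norm z) = \<omega> (norm z)"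
    by (subst (asm) AE_restrict_space_iff) auto
  then have ae: "AE z in lebesgue. indicator unit_disc z * w (norm z) = indicator unit_disc z * \<omega> (norm z)"
    by eventually_elim (auto simp: indicator_def)
  have "(\<lambda>z::complex. indicator unit_disc z * w (norm z)) \<in> borel_measurable borel"
    using w(1) by (intro borel_measurable_times borel_measurable_indicator) auto
  then have "(\<lambda>z::complex. indicator unit_disc z * w (norm z)) \<in> borel_measurable lebesgue"
    by (intro measurable_completion) simp
  then have "(\<lambda>z::complex. indicator unit_disc z * \<omega> (norm z)) \<in> borel_measurable lebesgue"
    by (rule borel_measurable_AE[OF _ ae])
  then have "(\<lambda>z. \<omega> (norm z)) \<in> borel_measurable (lebesgue_on unit_disc)"
    by (subst borel_measurable_restrict_space_iff) (auto simp: mult.commute)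
  then show ?thesis by (simp add: dA_def)
qed

lemma weight_AE_nonneg: "AE z in dA. 0 \<le> \<omega> (norm z)"
  by (rule AE_I2) (auto simp: weight_nonneg)

lemma space_W [simp]: "space W = unit_disc"
  by (simp add: weighted_dA_def)

lemma sets_W: "sets W = sets dA"
  by (simp add: weighted_dA_def)

lemma measurable_W [simp]: "measurable W N = measurable dA N"
  by (rule measurable_cong_sets) (auto simp: sets_W)

lemma borel_measurable_W: "f \<in> borel_measurable borel \<Longrightarrow> f \<in> borel_measurable W"
  by (simp add: borel_measurable_dA)

lemma integral_W:
  fixes f :: "complex \<Rightarrow> complex"
  assumes "f \<in> borel_measurable dA"
  shows "(\<integral>z. f z \<partial>W) = (\<integral>z. f z * complex_of_real (\<omega> (norm z)) \<partial>dA)"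
  unfolding weighted_dA_def using assms weight_measurable weight_AE_nonneg
  by (subst integral_density) (auto simp: scaleR_conv_of_real mult.commute)

lemma integrable_W:
  fixes f :: "complex \<Rightarrow> complex"
  assumes "f \<in> borel_measurable dA"
  shows "integrable W f \<longleftrightarrow> integrable dA (\<lambda>z. f z * complex_of_real (\<omega> (norm z)))"
  unfolding weighted_dA_def using assms weight_measurable weight_AE_nonneg
  by (subst integrable_density) (auto simp: scaleR_conv_of_real mult.commute)

lemma integral_W_real:
  fixes f :: "complex \<Rightarrow> real"
  assumes "f \<in> borel_measurable dA"
  shows "(\<integral>z. f z \<partial>W) = (\<integral>z. f z * \<omega> (norm z) \<partial>dA)"
  unfolding weighted_dA_def using assms weight_measurable weight_AE_nonneg
  by (subst integral_density) (auto simp: mult.commute)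

lemma integrable_W_real:
  fixes f :: "complex \<Rightarrow> real"
  assumes "f \<in> borel_measurable dA"
  shows "integrable W f \<longleftrightarrow> integrable dA (\<lambda>z. f z * \<omega> (norm z))"
  unfolding weighted_dA_def using assms weight_measurable weight_AE_nonneg
  by (subst integrable_density) (auto simp: mult.commute)

lemma nn_integral_W:
  assumes w: "w \<in> borel_measurable borel" "AE r in lborel. 0 \<le> r \<and> r < 1 \<longrightarrow> w r = \<omega> r"
    and f: "f \<in> borel_measurable borel"
  shows "(\<integral>\<^sup>+z. f z \<partial>W) = (\<integral>\<^sup>+z. ennreal (w (norm z)) * f z \<partial>dA)"
proof -
  have "(\<integral>\<^sup>+z. f z \<partial>W) = (\<integral>\<^sup>+z. ennreal (\<omega> (norm z)) * f z \<partial>dA)"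
    unfolding weighted_dA_def using weight_measurable borel_measurable_dA[OF f]
    by (subst nn_integral_density) auto
  also have "\<dots> = (\<integral>\<^sup>+z. ennreal (w (norm z)) * f z \<partial>dA)"
    by (rule nn_integral_cong_AE) (use AE_dA_norm[OF w(2)] AE_space in eventually_elim, auto)
  finally show ?thesis .
qed

lemma nn_integral_W_rotate:
  assumes f: "f \<in> borel_measurable borel" and u: "norm u = 1"
  shows "(\<integral>\<^sup>+z. f (u * z) \<partial>W) = (\<integral>\<^sup>+z. f z \<partial>W)"
proof -
  obtain w where w: "w \<in> borel_measurable borel" "\<And>r. 0 \<le> w r"
    "AE r in lborel. 0 \<le> r \<and> r < 1 \<longrightarrow> w r = \<omega> r" by (rule Borel_representative) blast
  define h where "h z = ennreal (indicator unit_disc z / pi) * (ennreal (w (norm z)) * f z)" for z :: complex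
  have h: "h \<in> borel_measurable borel"
    unfolding h_def using indicator_disc_measurable w(1) f by (intro borel_measurable_times_ennreal) auto
  have eq: "(\<integral>\<^sup>+z. g z \<partial>W) = (\<integral>\<^sup>+z. ennreal (indicator unit_disc z / pi) * (ennreal (w (norm z)) * g z) \<partial>lborel)"
    if "g \<in> borel_measurable borel" for g
    unfolding nn_integral_W[OF w(1) w(3) that]
    by (rule nn_integral_dA) (use that w(1) in \<open>auto intro!: borel_measurable_dA\<close>)
  have "(\<integral>\<^sup>+z. f (u * z) \<partial>W) = (\<integral>\<^sup>+z. h (u * z) \<partial>lborel)"
    using u f by (subst eq) (auto simp: h_def norm_mult indicator_def)
  also have "\<dots> = (\<integral>\<^sup>+z. h z \<partial>distr lborel borel (\<lambda>z. u * z))"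
    using h by (subst nn_integral_distr) auto
  also have "\<dots> = (\<integral>\<^sup>+z. h z \<partial>lborel)" by (simp add: lborel_rotation[OF u])
  also have "\<dots> = (\<integral>\<^sup>+z. f z \<partial>W)" by (simp add: eq[OF f] h_def)
  finally show ?thesis .
qed

lemma integral_W_rotate:
  fixes f :: "complex \<Rightarrow> complex"
  assumes f: "f \<in> borel_measurable borel" and u: "norm u = 1"
  shows "(\<integral>z. f (u * z) \<partial>W) = (\<integral>z. f z \<partial>W)"
proof -
  have m: "g \<in> measurable W borel" if "g \<in> borel_measurable borel" for g :: "complex \<Rightarrow> complex"
    using that by (rule borel_measurable_W)
  \<comment> \<open>The sets of \<open>W\<close> are Lebesgue sets. Pushing forward by the identity
    restricts \<open>W\<close> to Borel sets, where \<open>nn_integral_W_rotate\<close>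
    applies.\<close>
  have "distr W borel (\<lambda>z. u * z) = distr W borel (\<lambda>z. z)"
  proof (rule measure_eqI)
    fix A assume "A \<in> sets (distr W borel (\<lambda>z. u * z))"
    then have A: "A \<in> sets borel" by simp
    have "emeasure (distr W borel (\<lambda>z. u * z)) A = (\<integral>\<^sup>+z. indicator A (u * z) \<partial>W)"
      using A by (subst nn_integral_indicator[symmetric], simp)
        (subst nn_integral_distr, auto intro!: m borel_measurable_dA)
    also have "\<dots> = (\<integral>\<^sup>+z. indicator A z \<partial>W)"
      using A by (intro nn_integral_W_rotate u) auto
    also have "\<dots> = emeasure (distr W borel (\<lambda>z. z)) A"
      using A by (subst nn_integral_indicator[symmetric], simp)
        (subst nn_integral_distr, auto intro!: m borel_measurable_dA)
    finally show "emeasure (distr W borel (\<lambda>z. u * z)) A = emeasure (distr W borel (\<lambda>z. z)) A" .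
  qed simp
  moreover have "(\<integral>z. f (u * z) \<partial>W) = (\<integral>z. f z \<partial>distr W borel (\<lambda>z. u * z))"
    using f by (subst integral_distr) (auto intro!: m borel_measurable_dA)
  moreover have "(\<integral>z. f z \<partial>W) = (\<integral>z. f z \<partial>distr W borel (\<lambda>z. z))"
    using f by (subst integral_distr) (auto intro!: m borel_measurable_dA)
  ultimately show ?thesis by simp
qed

lemma nn_integral_W_radial:
  assumes v: "v \<in> borel_measurable borel"
  shows "(\<integral>\<^sup>+z. v (norm z) \<partial>W) = (\<integral>\<^sup>+r. ennreal (indicator {0..<1} r * (2 * r * \<omega> r)) * v r \<partial>lborel)"
proof -
  obtain w where w: "w \<in> borel_measurable borel" "\<And>r. 0 \<le> w r"
    "AE r in lborel. 0 \<le> r \<and> r < 1 \<longrightarrow> w r = \<omega> r" by (rule Borel_representative) blast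
  have "(\<integral>\<^sup>+z. v (norm z) \<partial>W) = (\<integral>\<^sup>+z. ennreal (w (norm z)) * v (norm z) \<partial>dA)"
    using v by (intro nn_integral_W w) auto
  also have "\<dots> = (\<integral>\<^sup>+r. ennreal (indicator {0..<1} r * (2 * r)) * (ennreal (w r) * v r) \<partial>lborel)"
    using v w(1) by (intro nn_integral_dA_radial) auto
  also have "\<dots> = (\<integral>\<^sup>+r. ennreal (indicator {0..<1} r * (2 * r * \<omega> r)) * v r \<partial>lborel)"
    by (rule nn_integral_cong_AE)
      (use w(3) in eventually_elim, auto simp: indicator_def ennreal_mult' mult.assoc split: if_splits)
  finally show ?thesis .
qed

lemma integral_W_radial:
  fixes v :: "real \<Rightarrow> real"
  assumes v: "v \<in> borel_measurable borel"
  shows "(\<integral>z. v (norm z) \<partial>W) = (LINT r:{0..<1}|lebesgue. 2 * r * \<omega> r * v r)"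
proof -
  obtain w where w: "w \<in> borel_measurable borel" "\<And>r. 0 \<le> w r"
    "AE r in lborel. 0 \<le> r \<and> r < 1 \<longrightarrow> w r = \<omega> r" by (rule Borel_representative) blast
  have g: "(\<lambda>r. indicator {0..<1} r * (2 * r * w r)) \<in> borel_measurable borel"
    using w(1) by measurable
  have m: "norm \<in> measurable W borel" by (simp add: borel_measurable_dA)
  have "distr W borel norm = density lborel (\<lambda>r. ennreal (indicator {0..<1} r * (2 * r * w r)))"
  proof (rule measure_eqI)
    fix A assume "A \<in> sets (distr W borel norm)"
    then have A: "A \<in> sets borel" by simp
    have "emeasure (distr W borel norm) A = (\<integral>\<^sup>+z. indicator A (norm z) \<partial>W)"
      using A m by (subst nn_integral_indicator[symmetric], simp) (subst nn_integral_distr, auto)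
    also have "\<dots> = (\<integral>\<^sup>+r. ennreal (indicator {0..<1} r * (2 * r * \<omega> r)) * indicator A r \<partial>lborel)"
      using A by (intro nn_integral_W_radial) auto
    also have "\<dots> = (\<integral>\<^sup>+r. ennreal (indicator {0..<1} r * (2 * r * w r)) * indicator A r \<partial>lborel)"
      by (rule nn_integral_cong_AE) (use w(3) in eventually_elim, auto simp: indicator_def)
    also have "\<dots> = emeasure (density lborel (\<lambda>r. ennreal (indicator {0..<1} r * (2 * r * w r)))) A"
      using A g by (subst emeasure_density) auto
    finally show "emeasure (distr W borel norm) A =
      emeasure (density lborel (\<lambda>r. ennreal (indicator {0..<1} r * (2 * r * w r)))) A" .
  qed simp
  moreover have "(\<integral>z. v (norm z) \<partial>W) = (\<integral>r. v r \<partial>distr W borel norm)"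
    using v m by (subst integral_distr) auto
  ultimately have "(\<integral>z. v (norm z) \<partial>W) = (\<integral>r. v r \<partial>density lborel (\<lambda>r. ennreal (indicator {0..<1} r * (2 * r * w r))))"
    by simp
  also have "\<dots> = (\<integral>r. indicator {0..<1} r * (2 * r * w r) * v r \<partial>lborel)"
    using g v w(2) by (subst integral_density) (auto simp: indicator_def)
  also have "\<dots> = (\<integral>r. indicator {0..<1} r * (2 * r * w r) * v r \<partial>lebesgue)"
    using g v by (intro integral_completion[symmetric]) auto
  also have "\<dots> = (\<integral>r. indicator {0..<1} r * (2 * r * \<omega> r * v r) \<partial>lebesgue)"
  proof (rule integral_cong_AE)
    show ae: "AE r in lebesgue. indicator {0..<1} r * (2 * r * w r) * v r = indicator {0..<1} r * (2 * r * \<omega> r * v r)"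
      using AE_completion[OF w(3)] by eventually_elim (auto simp: indicator_def)
    show a: "(\<lambda>r. indicator {0..<1} r * (2 * r * w r) * v r) \<in> borel_measurable lebesgue"
      using w(1) v by (intro borel_measurable_times measurable_completion) auto
    show "(\<lambda>r. indicator {0..<1} r * (2 * r * \<omega> r * v r)) \<in> borel_measurable lebesgue"
      by (rule borel_measurable_AE[OF a ae])
  qed
  finally show ?thesis by (simp add: set_lebesgue_integral_def)
qed

lemma finite_measure_W: "finite_measure W"
proof
  have "emeasure W (space W) = (\<integral>\<^sup>+z. 1 \<partial>W)" by simp
  also have "\<dots> = (\<integral>\<^sup>+r. ennreal (indicator {0..<1} r * (2 * r * \<omega> r)) * 1 \<partial>lborel)"
    using nn_integral_W_radial[of "\<lambda>_. 1"] by simp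
  also have "\<dots> \<le> (\<integral>\<^sup>+r. ennreal 2 * ennreal (norm (indicator {0..<1} r *\<^sub>R \<omega> r)) \<partial>lborel)"
  proof (rule nn_integral_mono)
    fix r :: real
    have "ennreal (indicator {0..<1} r * (2 * r * \<omega> r)) \<le> ennreal (2 * norm (indicator {0..<1} r *\<^sub>R \<omega> r))"
      by (rule ennreal_leI) (auto simp: indicator_def weight_nonneg mult_left_le_one_le)
    then show "ennreal (indicator {0..<1} r * (2 * r * \<omega> r)) * 1 \<le> ennreal 2 * ennreal (norm (indicator {0..<1} r *\<^sub>R \<omega> r))"
      by (simp add: ennreal_mult' del: ennreal_numeral)
  qed
  also have "\<dots> = (\<integral>\<^sup>+r. ennreal 2 * ennreal (norm (indicator {0..<1} r *\<^sub>R \<omega> r)) \<partial>lebesgue)"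
    by (rule nn_integral_completion[symmetric])
  also have "\<dots> = ennreal 2 * (\<integral>\<^sup>+r. ennreal (norm (indicator {0..<1} r *\<^sub>R \<omega> r)) \<partial>lebesgue)"
    using weight_integrable by (intro nn_integral_cmult) (auto simp: set_integrable_def)
  also have "\<dots> < \<infinity>"
    using weight_integrable by (auto simp: set_integrable_def integrable_iff_bounded ennreal_mult_less_top)
  finally show "emeasure W (space W) \<noteq> \<infinity>" by simp
qed

text \<open>The factor 2 and the shift of the index by 1 are the Jacobian 2r of polar
  coordinates.\<close>

lemma integral_norm_power: "(\<integral>z. norm z ^ n \<partial>W) = 2 * moment \<omega> (real n + 1)"
proof -
  have "(\<integral>z. norm z ^ n \<partial>W) = (LINT r:{0..<1}|lebesgue. 2 * r * \<omega> r * r ^ n)"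
    by (rule integral_W_radial) measurable
  also have "\<dots> = (LINT r:{0..<1}|lebesgue. 2 * (r powr (real n + 1) * \<omega> r))"
    by (rule set_lebesgue_integral_cong) (auto simp: powr_add powr_realpow le_less)
  finally show ?thesis by (simp add: moment_def)
qed

end

lemma cnj_borel_measurable [measurable]: "cnj \<in> borel_measurable borel"
  by (intro borel_measurable_continuous_onI continuous_intros)

section \<open>Moments of the weight and convergence of the kernel series\<close>

context weighted_disc
begin

lemma moment_integrable:
  assumes "0 \<le> x"
  shows "set_integrable lebesgue {0..<1} (\<lambda>r. r powr x * \<omega> r)"
  unfolding set_integrable_def
proof (rule Bochner_Integration.integrable_bound)
  show "integrable lebesgue (\<lambda>r. indicator {0..<1} r *\<^sub>R \<omega> r)"
    using weight_integrable by (simp add: set_integrable_def)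
  have "(\<lambda>r::real. r powr x) \<in> borel_measurable lebesgue"
    by (intro measurable_completion) measurable
  moreover have "(\<lambda>r. indicator {0..<1} r *\<^sub>R \<omega> r) \<in> borel_measurable lebesgue"
    using weight_integrable by (auto simp: set_integrable_def)
  ultimately have "(\<lambda>r. r powr x * (indicator {0..<1} r *\<^sub>R \<omega> r)) \<in> borel_measurable lebesgue"
    by (rule borel_measurable_times)
  then show "(\<lambda>r. indicator {0..<1} r *\<^sub>R (r powr x * \<omega> r)) \<in> borel_measurable lebesgue"
    by (simp add: ac_simps)
  show "AE r in lebesgue. norm (indicator {0..<1} r *\<^sub>R (r powr x * \<omega> r)) \<le> norm (indicator {0..<1} r *\<^sub>R \<omega> r)"
    using assms by (auto simp: indicator_def abs_mult powr_le1 mult_left_le_one_le)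
qed

lemma moment_mono:
  assumes "0 \<le> x" "x \<le> y"
  shows "moment \<omega> y \<le> moment \<omega> x"
  unfolding moment_def
proof (rule set_integral_mono)
  show "set_integrable lebesgue {0..<1} (\<lambda>r. r powr y * \<omega> r)"
    "set_integrable lebesgue {0..<1} (\<lambda>r. r powr x * \<omega> r)"
    using assms by (auto intro!: moment_integrable)
  fix r :: real assume r: "r \<in> {0..<1}"
  have "r powr y \<le> r powr x"
    using r assms by (cases "r = 0") (auto intro: powr_mono')
  then show "r powr y * \<omega> r \<le> r powr x * \<omega> r"
    using r by (intro mult_right_mono weight_nonneg) auto
qed

text \<open>On \<open>{s..<1}\<close> the factor \<open>r powr x\<close> is at least
  \<open>s powr x\<close>. Through this bound the positivity of the tails makes all moments positive
  and keeps them from decaying geometrically.\<close>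

lemma moment_ge_tail:
  assumes "0 \<le> x" "0 < s" "s < 1"
  shows "s powr x * weight_tail \<omega> (of_real s) \<le> moment \<omega> x"
proof -
  have sub: "{s..<1} \<subseteq> {0..<1}" using assms by auto
  have "s powr x * weight_tail \<omega> (of_real s) = (LINT r:{s..<1}|lebesgue. s powr x * \<omega> r)"
    using assms by (simp add: weight_tail_def)
  also have "\<dots> \<le> (LINT r:{s..<1}|lebesgue. r powr x * \<omega> r)"
  proof (rule set_integral_mono)
    show "set_integrable lebesgue {s..<1} (\<lambda>r. s powr x * \<omega> r)"
      using set_integrable_subset[OF weight_integrable _ sub] by simp
    show "set_integrable lebesgue {s..<1} (\<lambda>r. r powr x * \<omega> r)"
      using assms(1) by (intro set_integrable_subset[OF moment_integrable _ sub]) auto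
    fix r assume "r \<in> {s..<1}"
    then show "s powr x * \<omega> r \<le> r powr x * \<omega> r"
      using assms by (intro mult_right_mono powr_mono2 weight_nonneg) auto
  qed
  also have "\<dots> \<le> moment \<omega> x"
    unfolding moment_def set_lebesgue_integral_def
  proof (rule integral_mono)
    show "integrable lebesgue (\<lambda>r. indicator {s..<1} r *\<^sub>R (r powr x * \<omega> r))"
      using set_integrable_subset[OF moment_integrable[OF assms(1)] _ sub] by (simp add: set_integrable_def)
    show "integrable lebesgue (\<lambda>r. indicator {0..<1} r *\<^sub>R (r powr x * \<omega> r))"
      using moment_integrable[OF assms(1)] by (simp add: set_integrable_def)
  qed (use assms in \<open>auto simp: indicator_def weight_nonneg\<close>)
  finally show ?thesis .
qed

lemma moment_pos:
  assumes "0 \<le> x"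
  shows "0 < moment \<omega> x"
proof -
  have "0 < (1/2) powr x * weight_tail \<omega> (of_real (1/2))"
    using tail by (intro mult_pos_pos) (auto simp: norm_divide)
  then show ?thesis using moment_ge_tail[OF assms, of "1/2"] by simp
qed

lemma summable_kernel:
  assumes "0 \<le> q" "q < 1"
  shows "summable (\<lambda>n. q ^ n / moment \<omega> (2 * real n + 1))"
proof -
  \<comment> \<open>The square of \<open>s\<close> is the midpoint of \<open>q\<close> and 1, so the
    comparison series has ratio q / s^2 < 1.\<close>
  define s where "s = sqrt ((q + 1) / 2)"
  have s2: "s ^ 2 = (q + 1) / 2" using assms by (simp add: s_def)
  have s: "0 < s" "s < 1" "q / s^2 < 1" "0 \<le> q / s^2"
    using assms by (auto simp: s2 field_simps) (auto simp: s_def)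
  define T where "T = weight_tail \<omega> (of_real s)"
  have T: "T > 0" using tail s by (auto simp: T_def)
  have "summable (\<lambda>n. (q / s^2) ^ n * (1 / (s * T)))"
    using s(3) abs_of_nonneg[OF s(4)] by (intro summable_mult2 summable_geometric) (simp only: real_norm_def)
  then show ?thesis
  proof (rule summable_comparison_test'[where N=0])
    fix n :: nat
    have "s powr (2 * real n + 1) = s ^ (2 * n + 1)"
      using powr_realpow[of s "2 * n + 1"] s(1) by (simp add: add.commute)
    then have "s ^ (2 * n + 1) * T \<le> moment \<omega> (2 * real n + 1)"
      using moment_ge_tail[of "2 * real n + 1" s] s(1,2) by (simp only: T_def)
    then have "q ^ n / moment \<omega> (2 * real n + 1) \<le> q ^ n / (s ^ (2 * n + 1) * T)"
      using s T assms by (intro divide_left_mono mult_pos_pos moment_pos) auto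
    also have "\<dots> = (q / s^2) ^ n * (1 / (s * T))"
      by (simp add: power_mult power_divide)
    finally show "norm (q ^ n / moment \<omega> (2 * real n + 1)) \<le> (q / s^2) ^ n * (1 / (s * T))"
      using assms moment_pos[of "2 * real n + 1"] by simp
  qed
qed

section \<open>Termwise integration of power series, orthogonality, Parseval\<close>

lemma integrable_W_bounded:
  fixes f :: "complex \<Rightarrow> 'a::{banach, second_countable_topology}"
  assumes "f \<in> borel_measurable dA" "\<And>z. norm z < 1 \<Longrightarrow> norm (f z) \<le> B"
  shows "integrable W f"
  using assms by (intro finite_measure.integrable_const_bound[OF finite_measure_W, of f B] AE_I2) auto

lemma integrable_W_mult_bounded:
  fixes f g :: "complex \<Rightarrow> complex"
  assumes f: "integrable W f" and g: "g \<in> borel_measurable dA" "\<And>z. norm z < 1 \<Longrightarrow> norm (g z) \<le> B"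
  shows "integrable W (\<lambda>z. f z * g z)"
proof (rule Bochner_Integration.integrable_bound)
  show "integrable W (\<lambda>z. B * norm (f z))" using f by auto
  show "(\<lambda>z. f z * g z) \<in> borel_measurable W"
    using borel_measurable_integrable[OF f] g(1) by simp
  show "AE z in W. norm (f z * g z) \<le> norm (B * norm (f z))"
  proof (rule AE_I2)
    fix z assume "z \<in> space W"
    then have "norm (g z) \<le> B" using g(2) by simp
    then have "norm (f z) * norm (g z) \<le> norm (f z) * \<bar>B\<bar>" by (intro mult_left_mono) auto
    then show "norm (f z * g z) \<le> norm (B * norm (f z))"
      by (simp add: norm_mult abs_mult mult.commute)
  qed
qed

text \<open>The support of \<open>g\<close> yields the majorant
  \<open>norm (c m) * t ^ m * norm (g z)\<close>. With t < 1 this covers series that converge only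
  in the open disc, with t = 1 those with absolutely summable coefficients.\<close>

lemma
  fixes g :: "complex \<Rightarrow> complex" and c :: "nat \<Rightarrow> complex"
  assumes c: "summable (\<lambda>m. norm (c m) * t ^ m)" and t: "0 \<le> t" "t \<le> 1"
    and g: "integrable W g" "\<And>z. norm z > t \<Longrightarrow> g z = 0"
  shows integrable_power_series_times: "integrable W (\<lambda>z. \<Sum>m. c m * z ^ m * g z)"
    and sums_integral_power_series_times:
      "(\<lambda>m. c m * (\<integral>z. z ^ m * g z \<partial>W)) sums (\<integral>z. (\<Sum>m. c m * z ^ m * g z) \<partial>W)"
proof -
  have bd: "norm (c m * z ^ m * g z) \<le> norm (c m) * t ^ m * norm (g z)" for m z
  proof (cases "norm z > t")
    case False
    then have "norm z ^ m \<le> t ^ m" by (intro power_mono) auto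
    then show ?thesis
      by (auto simp: norm_mult norm_power intro!: mult_right_mono mult_left_mono)
  qed (simp add: g(2))
  have gm: "g \<in> borel_measurable dA" using borel_measurable_integrable[OF g(1)] by simp
  have int: "integrable W (\<lambda>z. c m * z ^ m * g z)" for m
  proof (rule Bochner_Integration.integrable_bound)
    show "integrable W (\<lambda>z. norm (c m) * t ^ m * norm (g z))" using g(1) by auto
    show "(\<lambda>z. c m * z ^ m * g z) \<in> borel_measurable W"
    proof -
      have "(\<lambda>z. c m * z ^ m) \<in> borel_measurable dA" by (intro borel_measurable_dA) measurable
      then show ?thesis using gm by simp
    qed
  qed (use bd t in \<open>auto simp: abs_mult\<close>)
  have ae: "AE z in W. summable (\<lambda>m. norm (c m * z ^ m * g z))"
  proof (rule AE_I2)
    fix z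
    show "summable (\<lambda>m. norm (c m * z ^ m * g z))"
      using bd by (intro summable_comparison_test'[OF summable_mult2[OF c, of "norm (g z)"], of 0]) auto
  qed
  have sm: "summable (\<lambda>m. \<integral>z. norm (c m * z ^ m * g z) \<partial>W)"
  proof (rule summable_comparison_test'[OF summable_mult2[OF c, of "\<integral>z. norm (g z) \<partial>W"], of 0])
    fix m
    have "(\<integral>z. norm (c m * z ^ m * g z) \<partial>W) \<le> (\<integral>z. norm (c m) * t ^ m * norm (g z) \<partial>W)"
      using int g(1) bd by (intro integral_mono) auto
    then show "norm (\<integral>z. norm (c m * z ^ m * g z) \<partial>W) \<le> norm (c m) * t ^ m * (\<integral>z. norm (g z) \<partial>W)"
      by simp
  qed
  show "integrable W (\<lambda>z. \<Sum>m. c m * z ^ m * g z)"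
    by (rule integrable_suminf[OF int ae sm])
  have "(\<integral>z. c m * z ^ m * g z \<partial>W) = c m * (\<integral>z. z ^ m * g z \<partial>W)" for m
    by (simp add: mult.assoc)
  then show "(\<lambda>m. c m * (\<integral>z. z ^ m * g z \<partial>W)) sums (\<integral>z. (\<Sum>m. c m * z ^ m * g z) \<partial>W)"
    using sums_integral[OF int ae sm] by simp
qed

text \<open>Rotation by the angle pi / (m - n) preserves the measure and changes the sign of the
  integrand.\<close>

lemma integral_monomials_orthogonal:
  assumes v: "v \<in> borel_measurable borel" and "m \<noteq> n"
  shows "(\<integral>z. z ^ m * cnj z ^ n * complex_of_real (v (norm z)) \<partial>W) = 0"
proof -
  define t where "t = pi / (real m - real n)"
  define u where "u = cis t"
  have u: "norm u = 1" by (simp add: u_def)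
  have "u ^ m * cnj u ^ n = cis ((real m - real n) * t)"
  proof -
    have "u ^ m = cis (real m * t)" "cnj u ^ n = cis (real n * (- t))"
      unfolding u_def cis_cnj by (rule Complex.DeMoivre)+
    then show ?thesis by (simp add: cis_mult left_diff_distrib)
  qed
  also have "(real m - real n) * t = pi" using \<open>m \<noteq> n\<close> by (simp add: t_def)
  also have "cis pi = -1" by (rule cis_pi)
  finally have um: "u ^ m * cnj u ^ n = -1" .
  let ?f = "\<lambda>z. z ^ m * cnj z ^ n * complex_of_real (v (norm z))"
  have "?f (u * z) = - ?f z" for z
  proof -
    have "?f (u * z) = (u ^ m * cnj u ^ n) * ?f z"
      using u by (simp add: power_mult_distrib norm_mult)
    then show ?thesis using um by simp
  qed
  then have "(\<integral>z. ?f z \<partial>W) = (\<integral>z. - ?f z \<partial>W)"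
    using integral_W_rotate[of ?f u] u v by simp
  then show ?thesis by simp
qed

lemma integral_monomials:
  assumes v: "v \<in> borel_measurable borel"
  shows "(\<integral>z. z ^ m * cnj z ^ n * complex_of_real (v (norm z)) \<partial>W)
    = (if m = n then complex_of_real (\<integral>z. norm z ^ (2 * n) * v (norm z) \<partial>W) else 0)"
proof (cases "m = n")
  case True
  have "z ^ n * cnj z ^ n = complex_of_real (norm z ^ (2 * n))" for z
  proof -
    have "z ^ n * cnj z ^ n = complex_of_real ((norm z)\<^sup>2) ^ n"
      unfolding complex_norm_square by (rule power_mult_distrib[symmetric])
    then show ?thesis by (simp add: power_mult)
  qed
  then have "(\<integral>z. z ^ n * cnj z ^ n * complex_of_real (v (norm z)) \<partial>W)
      = (\<integral>z. complex_of_real (norm z ^ (2 * n) * v (norm z)) \<partial>W)"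
    by simp
  also have "\<dots> = complex_of_real (\<integral>z. norm z ^ (2 * n) * v (norm z) \<partial>W)"
    by (rule integral_complex_of_real)
  finally show ?thesis using True by simp
qed (simp add: integral_monomials_orthogonal[OF v])

text \<open>The coefficients may grow, and integrability is the only control near the circle, so the
  series is integrated termwise on the discs of radius s k = 1 - 1 / (k + 1) only; dominated
  convergence then gives the whole disc.\<close>

lemma integral_series_conj_monomial:
  fixes h :: "complex \<Rightarrow> complex" and a :: "nat \<Rightarrow> complex"
  assumes h: "\<And>z. norm z < 1 \<Longrightarrow> (\<lambda>m. a m * z ^ m) sums h z"
    and v: "v \<in> borel_measurable borel" "\<And>r. 0 \<le> r \<Longrightarrow> r < 1 \<Longrightarrow> \<bar>v r\<bar> \<le> B"
    and int: "integrable W (\<lambda>z. h z * complex_of_real (v (norm z)))"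
  shows "(\<integral>z. h z * complex_of_real (v (norm z)) * cnj z ^ n \<partial>W)
    = a n * complex_of_real (\<integral>z. norm z ^ (2 * n) * v (norm z) \<partial>W)"
proof -
  have vm: "(\<lambda>z::complex. complex_of_real (v (norm z))) \<in> borel_measurable borel"
    using v(1) by measurable
  have zv: "(\<lambda>z::complex. norm z ^ (2 * n) * v (norm z)) \<in> borel_measurable borel"
    using v(1) by measurable
  have pow: "norm z ^ k \<le> 1" if "norm z < 1" for z :: complex and k
    using that by (intro power_le_one) auto
  define s where "s k = 1 - 1 / real (Suc k)" for k
  have s: "0 \<le> s k" "s k < 1" for k by (auto simp: s_def)
  have s_lim: "s \<longlonglongrightarrow> 1" unfolding s_def by real_asymp
  have hint: "integrable W (\<lambda>z. h z * complex_of_real (v (norm z)) * cnj z ^ n)"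
    by (rule integrable_W_mult_bounded[OF int, of _ 1])
      (auto intro!: borel_measurable_dA borel_measurable_power simp: norm_power pow)
  have vint: "integrable W (\<lambda>z. norm z ^ (2 * n) * v (norm z))"
  proof (rule integrable_W_bounded[where B=B])
    fix z :: complex assume z: "norm z < 1"
    have "norm z ^ (2 * n) * \<bar>v (norm z)\<bar> \<le> 1 * B"
      using z v(2) by (intro mult_mono pow) auto
    then show "norm (norm z ^ (2 * n) * v (norm z)) \<le> B" by (simp add: abs_mult)
  qed (intro borel_measurable_dA zv)
  have lim: "(\<lambda>k. \<integral>z. indicator (cball 0 (s k)) z *\<^sub>R f z \<partial>W) \<longlonglongrightarrow> (\<integral>z. f z \<partial>W)"
    if "integrable W f" for f :: "complex \<Rightarrow> 'b::{banach,second_countable_topology}"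
  proof (rule integral_dominated_convergence[where w="\<lambda>z. norm (f z)"])
    show "integrable W (\<lambda>z. norm (f z))" using that by auto
    show m: "f \<in> borel_measurable W" by (rule borel_measurable_integrable[OF that])
    show "\<And>k. (\<lambda>z. indicator (cball 0 (s k)) z *\<^sub>R f z) \<in> borel_measurable W"
      by (intro borel_measurable_scaleR m borel_measurable_W borel_measurable_indicator) auto
    show "AE z in W. (\<lambda>k. indicator (cball 0 (s k)) z *\<^sub>R f z) \<longlonglongrightarrow> f z"
    proof (rule AE_I2)
      fix z assume "z \<in> space W"
      then have "\<forall>\<^sub>F k in sequentially. norm z < s k"
        using s_lim by (intro order_tendstoD) auto
      then show "(\<lambda>k. indicator (cball 0 (s k)) z *\<^sub>R f z) \<longlonglongrightarrow> f z"
        by (intro tendsto_eventually, elim eventually_mono) (simp add: indicator_def)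
    qed
  qed (auto simp: indicator_def)
  have eq: "(\<integral>z. indicator (cball 0 (s k)) z *\<^sub>R (h z * complex_of_real (v (norm z)) * cnj z ^ n) \<partial>W)
     = a n * complex_of_real (\<integral>z. indicator (cball 0 (s k)) z *\<^sub>R (norm z ^ (2 * n) * v (norm z)) \<partial>W)" for k
  proof -
    define vk where "vk r = (if r \<le> s k then v r else 0)" for r
    have vk [measurable]: "vk \<in> borel_measurable borel" unfolding vk_def using v(1) by measurable
    define g where "g z = cnj z ^ n * complex_of_real (vk (norm z))" for z
    have g: "integrable W g"
    proof (rule integrable_W_bounded[where B="\<bar>B\<bar>"])
      show "g \<in> borel_measurable dA" unfolding g_def by (intro borel_measurable_dA) measurable
      fix z :: complex assume z: "norm z < 1"
      have "norm z ^ n * \<bar>vk (norm z)\<bar> \<le> 1 * \<bar>B\<bar>"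
        using z v(2)[of "norm z"] by (intro mult_mono pow) (auto simp: vk_def)
      then show "norm (g z) \<le> \<bar>B\<bar>" by (simp add: g_def norm_mult norm_power)
    qed
    have sm: "summable (\<lambda>m. norm (a m) * s k ^ m)"
    proof -
      define p where "p = (s k + 1) / 2"
      have p: "0 \<le> p" "p < 1" "s k < p" using s[of k] by (auto simp: p_def)
      have "summable (\<lambda>m. a m * of_real p ^ m)"
        using h[of "of_real p"] p(1,2) by (auto intro: sums_summable)
      then have "summable (\<lambda>m. norm (a m * of_real (s k) ^ m))"
        by (rule powser_insidea) (use s(1)[of k] p in simp)
      then show ?thesis using s[of k] by (simp add: norm_mult norm_power)
    qed
    have g0: "g z = 0" if "norm z > s k" for z using that by (simp add: g_def vk_def)
    have "(\<lambda>m. a m * (\<integral>z. z ^ m * g z \<partial>W)) sums (\<integral>z. (\<Sum>m. a m * z ^ m * g z) \<partial>W)"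
      using s[of k] by (intro sums_integral_power_series_times[OF sm _ _ g g0]) auto
    moreover have "(\<integral>z. z ^ m * g z \<partial>W) = (if m = n then complex_of_real (\<integral>z. norm z ^ (2 * n) * vk (norm z) \<partial>W) else 0)" for m
      using integral_monomials[OF vk, of m n] by (simp add: g_def mult.assoc)
    ultimately have "(\<lambda>m. if m = n then a m * complex_of_real (\<integral>z. norm z ^ (2 * n) * vk (norm z) \<partial>W) else 0)
        sums (\<integral>z. (\<Sum>m. a m * z ^ m * g z) \<partial>W)"
      by (simp add: if_distrib cong: if_cong)
    then have "(\<integral>z. (\<Sum>m. a m * z ^ m * g z) \<partial>W) = a n * complex_of_real (\<integral>z. norm z ^ (2 * n) * vk (norm z) \<partial>W)"
      using sums_single[of n "\<lambda>m. a m * complex_of_real (\<integral>z. norm z ^ (2 * n) * vk (norm z) \<partial>W)"]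
      by (rule sums_unique2)
    moreover have "(\<integral>z. (\<Sum>m. a m * z ^ m * g z) \<partial>W) =
       (\<integral>z. indicator (cball 0 (s k)) z *\<^sub>R (h z * complex_of_real (v (norm z)) * cnj z ^ n) \<partial>W)"
    proof (rule Bochner_Integration.integral_cong[OF refl])
      fix z assume "z \<in> space W"
      then have "norm z < 1" by simp
      from sums_mult2[OF h[OF this], of "g z"]
      show "(\<Sum>m. a m * z ^ m * g z) = indicator (cball 0 (s k)) z *\<^sub>R (h z * complex_of_real (v (norm z)) * cnj z ^ n)"
        by (auto simp: sums_iff g_def vk_def indicator_def mult_ac)
    qed
    moreover have "(\<integral>z. norm z ^ (2 * n) * vk (norm z) \<partial>W) = (\<integral>z. indicator (cball 0 (s k)) z *\<^sub>R (norm z ^ (2 * n) * v (norm z)) \<partial>W)"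
      by (rule Bochner_Integration.integral_cong[OF refl]) (auto simp: vk_def indicator_def)
    ultimately show ?thesis by simp
  qed
  have lim2: "(\<lambda>k. a n * complex_of_real (\<integral>z. indicator (cball 0 (s k)) z *\<^sub>R (norm z ^ (2 * n) * v (norm z)) \<partial>W))
    \<longlonglongrightarrow> a n * complex_of_real (\<integral>z. norm z ^ (2 * n) * v (norm z) \<partial>W)"
    by (intro tendsto_intros lim vint)
  show ?thesis
    by (rule LIMSEQ_unique[OF lim[OF hint, unfolded eq] lim2])
qed

end

lemma series_borel_measurable_dA:
  assumes "\<And>z::complex. norm z < 1 \<Longrightarrow> (\<lambda>m. a m * z ^ m) sums h z"
  shows "h \<in> borel_measurable dA"
proof (rule borel_measurable_LIMSEQ_metric[where f="\<lambda>n z. \<Sum>j<n. a j * z ^ j"])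
  show "(\<lambda>z. \<Sum>j<n. a j * z ^ j) \<in> borel_measurable dA" for n
    by (intro borel_measurable_dA) measurable
  show "(\<lambda>n. \<Sum>j<n. a j * z ^ j) \<longlonglongrightarrow> h z" if "z \<in> space dA" for z
    using assms[of z] that by (simp add: sums_def)
qed

context weighted_disc
begin

text \<open>One factor of |h|^2 is expanded into its series and the other is kept as an integrable
  function, whose moments \<open>integral_series_conj_monomial\<close> computes.\<close>

lemma Parseval:
  fixes c :: "nat \<Rightarrow> complex"
  assumes c: "summable (\<lambda>j. norm (c j))"
    and v [measurable]: "v \<in> borel_measurable borel" and vB: "\<And>r. 0 \<le> r \<Longrightarrow> r < 1 \<Longrightarrow> \<bar>v r\<bar> \<le> B"
  shows "integrable W (\<lambda>z. (norm (\<Sum>j. c j * z ^ j))\<^sup>2 * v (norm z))" (is ?A)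
    and "(\<lambda>j. (norm (c j))\<^sup>2 * (\<integral>z. norm z ^ (2 * j) * v (norm z) \<partial>W))
      sums (\<integral>z. (norm (\<Sum>j. c j * z ^ j))\<^sup>2 * v (norm z) \<partial>W)" (is ?B)
proof -
  define h where "h z = (\<Sum>j. c j * z ^ j)" for z
  have sm: "summable (\<lambda>j. norm (c j * z ^ j))" if "norm z < 1" for z
    using that by (intro summable_comparison_test'[OF c, of 0])
      (auto simp: norm_mult norm_power intro!: mult_left_le power_le_one)
  have sums: "(\<lambda>j. c j * z ^ j) sums h z" if "norm z < 1" for z
    using summable_norm_cancel[OF sm[OF that]] by (simp add: h_def summable_sums)
  have hb: "norm (h z) \<le> (\<Sum>j. norm (c j))" if "norm z < 1" for z
  proof -
    have "norm (h z) \<le> (\<Sum>j. norm (c j * z ^ j))"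
      unfolding h_def by (rule summable_norm[OF sm[OF that]])
    also have "\<dots> \<le> (\<Sum>j. norm (c j))"
      using that by (intro suminf_le sm c) (auto simp: norm_mult norm_power intro!: mult_left_le power_le_one)
    finally show ?thesis .
  qed
  have hm: "h \<in> borel_measurable dA"
    by (rule series_borel_measurable_dA[OF sums])
  have vm: "(\<lambda>z::complex. complex_of_real (v (norm z))) \<in> borel_measurable dA"
    by (intro borel_measurable_dA) measurable
  have hv: "norm (h z * complex_of_real (v (norm z))) \<le> (\<Sum>j. norm (c j)) * B" if "norm z < 1" for z
    using hb[OF that] vB[of "norm z"] that by (auto simp: norm_mult intro!: mult_mono suminf_nonneg c)
  have hvi: "integrable W (\<lambda>z. h z * complex_of_real (v (norm z)))"
    using hm vm hv by (intro integrable_W_bounded borel_measurable_times) auto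
  have g: "integrable W (\<lambda>z. cnj (h z) * complex_of_real (v (norm z)))"
    using hvi integrable_cnj[of W "\<lambda>z. h z * complex_of_real (v (norm z))"] by simp
  \<comment> \<open>The termwise integration asks for vanishing at all z with norm above t = 1,
    including points outside the disc, where \<open>W\<close> sees nothing.\<close>
  define g' where "g' z = (if norm z > 1 then 0 else cnj (h z) * complex_of_real (v (norm z)))" for z
  have g': "integrable W g'"
    using g by (rule Bochner_Integration.integrable_cong[THEN iffD1, rotated -1]) (auto simp: g'_def)
  have c1: "summable (\<lambda>m. norm (c m) * 1 ^ m)" using c by simp
  have eq: "(\<Sum>m. c m * z ^ m * g' z) = complex_of_real ((norm (h z))\<^sup>2 * v (norm z))" if "z \<in> space W" for z
  proof -
    have "(\<lambda>m. c m * z ^ m * g' z) sums (h z * g' z)"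
      using that by (intro sums_mult2 sums) auto
    then show ?thesis using that complex_norm_square[of "h z"] by (simp add: sums_iff g'_def)
  qed
  have zg: "(\<integral>z. z ^ m * g' z \<partial>W) = cnj (c m) * complex_of_real (\<integral>z. norm z ^ (2 * m) * v (norm z) \<partial>W)" for m
  proof -
    have "(\<integral>z. z ^ m * g' z \<partial>W) = (\<integral>z. cnj (h z * complex_of_real (v (norm z)) * cnj z ^ m) \<partial>W)"
      by (rule Bochner_Integration.integral_cong[OF refl]) (auto simp: g'_def mult_ac)
    also have "\<dots> = cnj (\<integral>z. h z * complex_of_real (v (norm z)) * cnj z ^ m \<partial>W)"
      by (rule Bochner_Integration.integral_cnj)
    also have "(\<integral>z. h z * complex_of_real (v (norm z)) * cnj z ^ m \<partial>W) = c m * complex_of_real (\<integral>z. norm z ^ (2 * m) * v (norm z) \<partial>W)"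
      by (rule integral_series_conj_monomial[OF sums v vB hvi])
    finally show ?thesis by simp
  qed
  have "integrable W (\<lambda>z. \<Sum>m. c m * z ^ m * g' z)"
    by (rule integrable_power_series_times[OF c1 _ _ g']) (auto simp: g'_def)
  then have "integrable W (\<lambda>z. complex_of_real ((norm (h z))\<^sup>2 * v (norm z)))"
    by (rule Bochner_Integration.integrable_cong[THEN iffD1, rotated -1]) (auto simp: eq simp del: of_real_mult of_real_power)
  then show ?A
    unfolding h_def by (simp only: complex_of_real_integrable_eq)
  have "(\<lambda>m. c m * (\<integral>z. z ^ m * g' z \<partial>W)) sums (\<integral>z. (\<Sum>m. c m * z ^ m * g' z) \<partial>W)"
    by (rule sums_integral_power_series_times[OF c1 _ _ g']) (auto simp: g'_def)
  also have "(\<integral>z. (\<Sum>m. c m * z ^ m * g' z) \<partial>W) = (\<integral>z. complex_of_real ((norm (h z))\<^sup>2 * v (norm z)) \<partial>W)"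
    by (rule Bochner_Integration.integral_cong[OF refl eq])
  also have "\<dots> = complex_of_real (\<integral>z. (norm (h z))\<^sup>2 * v (norm z) \<partial>W)"
    by (rule integral_complex_of_real)
  also have "(\<lambda>m. c m * (\<integral>z. z ^ m * g' z \<partial>W)) = (\<lambda>m. complex_of_real ((norm (c m))\<^sup>2 * (\<integral>z. norm z ^ (2 * m) * v (norm z) \<partial>W)))"
    unfolding zg of_real_mult complex_norm_square by (simp add: mult.assoc)
  finally show ?B
    unfolding h_def by (simp only: sums_of_real_iff)
qed

end

section \<open>Area measure as an instance, for the reproducing formula of Bloch functions\<close>

lemma weighted_dA_1 [simp]: "weighted_dA (\<lambda>_. 1) = dA"
  by (simp add: weighted_dA_def density_1)

interpretation area: weighted_disc "\<lambda>_. 1"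
  rewrites "weighted_dA (\<lambda>_. 1) = dA"
proof -
  show "weighted_disc (\<lambda>_. 1)"
  proof
    show "radial_weight (\<lambda>_. 1)"
      unfolding radial_weight_def set_integrable_def
      by (auto intro!: integrable_real_indicator)
    show "\<forall>z\<in>unit_disc. 0 < weight_tail (\<lambda>_. 1) z"
      by (simp add: weight_tail_def set_lebesgue_integral_def)
  qed
qed simp

declare area.measurable_W [simp del] \<comment> \<open>the rewritten equation has identical sides and loops\<close>

lemma area_integral_norm_power: "(\<integral>z. norm z ^ n \<partial>dA) = 2 / (real n + 2)"
proof -
  have hi: "((\<lambda>r. r ^ (n + 1)) has_integral 1 / (real n + 2)) {0..1::real}"
  proof -
    have "((\<lambda>r. r ^ (n + 1)) has_integral (1 ^ (n + 2) / (real n + 2) - 0 ^ (n + 2) / (real n + 2))) {0..1::real}"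
      by (rule fundamental_theorem_of_calculus)
        (auto intro!: derivative_eq_intros simp: has_real_derivative_iff_has_vector_derivative[symmetric] add_ac simp del: power_Suc)
    then show ?thesis by simp
  qed
  have "moment (\<lambda>_. 1) (real n + 1) = (LINT r:{0..<1}|lebesgue. r ^ (n + 1))"
    unfolding moment_def
    by (rule set_lebesgue_integral_cong) (auto simp: powr_add powr_realpow le_less)
  also have "\<dots> = (LINT r:{0..1}|lebesgue. r ^ (n + 1))"
    unfolding set_lebesgue_integral_def
  proof (rule integral_cong_AE)
    show "(\<lambda>r::real. indicator {0..<1} r *\<^sub>R r ^ (n + 1)) \<in> borel_measurable lebesgue"
      "(\<lambda>r::real. indicator {0..1} r *\<^sub>R r ^ (n + 1)) \<in> borel_measurable lebesgue"
      by (intro measurable_completion; measurable)+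
    have "AE r in lebesgue. r \<noteq> (1::real)"
      by (intro AE_completion AE_lborel_singleton)
    then show "AE r in lebesgue. indicator {0..<1} r *\<^sub>R r ^ (n + 1) = indicator {0..1} r *\<^sub>R (r::real) ^ (n + 1)"
      by eventually_elim (auto simp: indicator_def)
  qed
  also have "\<dots> = integral {0..1} (\<lambda>r::real. r ^ (n + 1))"
  proof (rule set_lebesgue_integral_eq_integral)
    have "set_integrable lborel {0..1} (\<lambda>r::real. r ^ (n + 1))"
      by (rule borel_integrable_atLeastAtMost') (intro continuous_intros)
    then show "set_integrable lebesgue {0..1} (\<lambda>r::real. r ^ (n + 1))"
      unfolding set_integrable_def by (subst integrable_completion) auto
  qed
  also have "\<dots> = 1 / (real n + 2)" by (rule integral_unique[OF hi])
  finally show ?thesis using area.integral_norm_power[of n] by simp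
qed

section \<open>Tent-shaped blocks of Taylor coefficients and their sup norms\<close>

text \<open>The peak is at 2N. On [2N, 4N] the falling side of \<open>tent N\<close> and the rising
  side of \<open>tent (2 * N)\<close> add up to 1, so the dyadic tents form a partition of unity;
  slopes of order 1/N are what keeps the kernel of a block bounded in mean.\<close>

definition tent :: "nat \<Rightarrow> nat \<Rightarrow> real" where
  "tent N n = max 0 (min (real n / real N - 1) (2 - real n / (2 * real N)))"

lemma tent_nonneg: "0 \<le> tent N n"
  by (simp add: tent_def)

lemma tent_le_1: "0 < N \<Longrightarrow> tent N n \<le> 1"
  by (simp add: tent_def field_simps min_def)

lemma tent_eq_0: "0 < N \<Longrightarrow> n \<le> N \<or> 4 * N \<le> n \<Longrightarrow> tent N n = 0"
  by (auto simp: tent_def field_simps min_def max_def)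

lemma tent_Lipschitz: "0 < N \<Longrightarrow> \<bar>tent N (Suc n) - tent N n\<bar> \<le> 1 / real N"
proof -
  assume N: "0 < N"
  define a b e where "a = real n / real N - 1" and "b = 2 - real n / (2 * real N)" and "e = 1 / real N"
  have e: "0 < e" using N by (simp add: e_def)
  have "real (Suc n) / real N - 1 = a + e" "2 - real (Suc n) / (2 * real N) = b - e / 2"
    using N by (auto simp: a_def b_def e_def field_simps)
  then have "tent N (Suc n) = max 0 (min (a + e) (b - e / 2))" "tent N n = max 0 (min a b)"
    by (simp_all add: tent_def a_def b_def)
  then show ?thesis using e by (simp add: e_def[symmetric] max_def min_def abs_le_iff)
qed

text \<open>A Bloch function is represented by its Taylor coefficients \<open>b\<close>; the power series
  below is that of its derivative.\<close>

definition Bloch_coeffs :: "real \<Rightarrow> (nat \<Rightarrow> complex) \<Rightarrow> bool" where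
  "Bloch_coeffs \<beta> b \<longleftrightarrow> (\<exists>h. \<forall>z. norm z < 1 \<longrightarrow>
     (\<lambda>m. of_nat (Suc m) * b (Suc m) * z ^ m) sums h z \<and> norm (h z) * (1 - (norm z)\<^sup>2) \<le> \<beta>)"

text \<open>Multiplication by \<open>1 - \<rho> * x\<close> turns coefficients into damped
  differences. The boundary term disappears in the application because the tent vanishes at index 4N
  + 1.\<close>

lemma sum_summation_by_parts:
  fixes x :: "'a::comm_ring_1"
  assumes "d 0 = k 0" "\<And>j. d (Suc j) = k (Suc j) - \<rho> * k j"
  shows "(\<Sum>j<Suc L. d j * x ^ j) = (1 - \<rho> * x) * (\<Sum>j<L. k j * x ^ j) + k L * x ^ L"
  by (induction L) (simp_all add: assms algebra_simps)

lemma sum_lessThan_add: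
  fixes f :: "nat \<Rightarrow> 'a::comm_monoid_add"
  shows "(\<Sum>n<a + b. f n) = (\<Sum>n<a. f n) + (\<Sum>j<b. f (a + j))"
  by (induction b) (simp_all add: add.assoc)

definition tent_block :: "nat \<Rightarrow> (nat \<Rightarrow> complex) \<Rightarrow> complex \<Rightarrow> complex" where
  "tent_block N b z = (\<Sum>n<Suc (4 * N). complex_of_real (tent N n) * b n * z ^ n)"

text \<open>Dropping the vanishing indices n \<le> N exhibits a factor z^(N+1), which the maximum
  principle exploits later.\<close>

lemma tent_block_shift:
  assumes "0 < N"
  shows "tent_block N b z = (\<Sum>j<3 * N. complex_of_real (tent N (Suc N + j)) * b (Suc N + j) * z ^ (Suc N + j))"
proof -
  have "Suc (4 * N) = Suc N + 3 * N" by simp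
  then have "tent_block N b z = (\<Sum>n<Suc N. complex_of_real (tent N n) * b n * z ^ n) +
     (\<Sum>j<3 * N. complex_of_real (tent N (Suc N + j)) * b (Suc N + j) * z ^ (Suc N + j))"
    unfolding tent_block_def by (simp only: sum_lessThan_add)
  moreover have "(\<Sum>n<Suc N. complex_of_real (tent N n) * b n * z ^ n) = 0"
    using assms by (intro sum.neutral) (auto simp: tent_eq_0)
  ultimately show ?thesis by simp
qed

text \<open>The factor 1 - |z|^2 makes the integrand bounded by \<beta>. Its moment 1 / ((m + 1)(m +
  2)) cancels the factor m + 1 produced by differentiation.\<close>

lemma Bloch_coeffs_integral:
  assumes h: "\<And>z. norm z < 1 \<Longrightarrow> (\<lambda>m. of_nat (Suc m) * b (Suc m) * z ^ m) sums h z"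
    and \<beta>: "\<And>z. norm z < 1 \<Longrightarrow> norm (h z) * (1 - (norm z)\<^sup>2) \<le> \<beta>"
  shows "integrable dA (\<lambda>z. h z * complex_of_real (1 - (norm z)\<^sup>2))"
    and "(\<integral>z. h z * complex_of_real (1 - (norm z)\<^sup>2) * cnj z ^ m \<partial>dA) = b (Suc m) / of_nat (m + 2)"
proof -
  have n2: "(norm z)\<^sup>2 \<le> 1" if "norm z < 1" for z :: complex
    using that by (intro power_le_one) auto
  show int: "integrable dA (\<lambda>z. h z * complex_of_real (1 - (norm z)\<^sup>2))"
  proof (rule area.integrable_W_bounded[where B=\<beta>])
    have "h \<in> borel_measurable dA" by (rule series_borel_measurable_dA[OF h])
    moreover have "(\<lambda>z::complex. complex_of_real (1 - (norm z)\<^sup>2)) \<in> borel_measurable dA"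
      by (intro borel_measurable_dA) measurable
    ultimately show "(\<lambda>z. h z * complex_of_real (1 - (norm z)\<^sup>2)) \<in> borel_measurable dA"
      by (rule borel_measurable_times)
    show "norm (h z * complex_of_real (1 - (norm z)\<^sup>2)) \<le> \<beta>" if "norm z < 1" for z
    proof -
      have "norm (complex_of_real (1 - (norm z)\<^sup>2)) = 1 - (norm z)\<^sup>2"
        using n2[OF that] by (simp only: norm_of_real)
      then show ?thesis using \<beta>[OF that] by (simp only: norm_mult)
    qed
  qed
  have "(\<integral>z. h z * complex_of_real (1 - (norm z)\<^sup>2) * cnj z ^ m \<partial>dA)
    = of_nat (Suc m) * b (Suc m) * complex_of_real (\<integral>z. norm z ^ (2 * m) * (1 - (norm z)\<^sup>2) \<partial>dA)"
  proof (rule area.integral_series_conj_monomial[OF h _ _ int, where B=1])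
    show "\<bar>1 - r\<^sup>2\<bar> \<le> 1" if "0 \<le> r" "r < 1" for r :: real
      using that power_le_one[of r 2] by (auto simp: abs_le_iff)
  qed (simp_all)
  also have "(\<integral>z. norm z ^ (2 * m) * (1 - (norm z)\<^sup>2) \<partial>dA) = 1 / (real (Suc m) * real (m + 2))"
  proof -
    have pi: "integrable dA (\<lambda>z::complex. norm z ^ k)" for k
    proof (rule area.integrable_W_bounded[where B=1])
      show "(\<lambda>z::complex. norm z ^ k) \<in> borel_measurable dA"
        by (intro borel_measurable_dA) measurable
    qed (simp add: power_le_one)
    have "(\<integral>z. norm z ^ (2 * m) * (1 - (norm z)\<^sup>2) \<partial>dA) = (\<integral>z. norm z ^ (2 * m) - norm z ^ (2 * m + 2) \<partial>dA)"
      by (simp only: power_add right_diff_distrib mult_1_right)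
    also have "\<dots> = 2 / (real (2 * m) + 2) - 2 / (real (2 * m + 2) + 2)"
      by (simp only: Bochner_Integration.integral_diff[OF pi pi] area_integral_norm_power)
    also have "\<dots> = 1 / (real m + 1) - 1 / (real m + 2)"
    proof -
      have "2 / (real (2 * m) + 2) = 2 * 1 / (2 * (real m + 1))"
        "2 / (real (2 * m + 2) + 2) = 2 * 1 / (2 * (real m + 2))" by simp_all
      then show ?thesis by (simp only: mult_divide_mult_cancel_left[OF zero_neq_numeral[symmetric]])
    qed
    also have "\<dots> = 1 / (real (Suc m) * real (m + 2))"
      by (subst diff_frac_eq) (simp_all add: add.commute)
    finally show ?thesis .
  qed
  also have "of_nat (Suc m) * b (Suc m) * complex_of_real (1 / (real (Suc m) * real (m + 2))) = b (Suc m) / of_nat (m + 2)"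
    by (simp add: divide_simps del: of_nat_Suc of_nat_add)
  finally show "(\<integral>z. h z * complex_of_real (1 - (norm z)\<^sup>2) * cnj z ^ m \<partial>dA) = b (Suc m) / of_nat (m + 2)" .
qed

text \<open>The kernel \<open>Q\<close> reproducing a block is \<open>P / (1 - \<rho> x)\<close> with \<open>x = z cnj \<zeta>\<close> and
  \<open>P\<close> having bounded coefficients; both factors have bounded \<open>L\<^sup>2\<close>-norm for the
  weight \<open>|\<zeta>|\<^sup>N\<close> when \<open>\<rho> = 1 - 1/N\<close>, so that AM-GM bounds the \<open>L\<^sup>1\<close>-norm
  of \<open>|\<zeta>|\<^sup>N Q\<close> independently of \<open>N\<close>.\<close>

lemma block_kernel_bound:
  assumes N: "0 < N" and z: "norm z = 1"
  defines "k \<equiv> \<lambda>j. tent N (Suc N + j) * real (N + j + 2)"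
  shows "integrable dA (\<lambda>\<zeta>. norm \<zeta> ^ N * norm (\<Sum>j<3 * N. complex_of_real (k j) * (z * cnj \<zeta>) ^ j))"
    and "(\<integral>\<zeta>. norm \<zeta> ^ N * norm (\<Sum>j<3 * N. complex_of_real (k j) * (z * cnj \<zeta>) ^ j) \<partial>dA) \<le> 433"
proof -
  \<comment> \<open>With \<rho> at distance 1/N from 1, the sum of \<rho>^(2j) is at most N, which
    offsets the moments of size 2/N; the additional term (1 - \<rho>) k stays bounded because k is
    of order N.\<close>
  define \<rho> where "\<rho> = 1 - 1 / real N"
  have \<rho>: "0 \<le> \<rho>" "\<rho> < 1" "1 - \<rho> = 1 / real N" using N by (auto simp: \<rho>_def)
  define d where "d j = (case j of 0 \<Rightarrow> k 0 | Suc i \<Rightarrow> k (Suc i) - \<rho> * k i)" for j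
  define Q where "Q \<zeta> = (\<Sum>j<3 * N. complex_of_real (k j) * (z * cnj \<zeta>) ^ j)" for \<zeta>
  \<comment> \<open>\<open>Parseval\<close> concerns series in \<zeta>, while \<open>Q\<close> is a
    polynomial in \<open>cnj \<zeta>\<close>. Hence \<open>c\<close> and \<open>e\<close> are the
    coefficients of the complex conjugates of the two factors, which have the same moduli.\<close>
  define c where "c j = (if j < Suc (3 * N) then complex_of_real (d j) * cnj z ^ j else 0)" for j
  define e where "e j = complex_of_real (\<rho> ^ j) * cnj z ^ j" for j
  have k3N: "k (3 * N) = 0" using N by (simp add: k_def tent_eq_0)
  have d_bound: "\<bar>d j\<bar> \<le> 12" if "j < Suc (3 * N)" for j
  proof (cases j)
    case 0
    have "tent N (Suc N) \<le> 1 / real N"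
      using tent_Lipschitz[OF N, of N] tent_eq_0[OF N, of N] by simp
    then have "k 0 \<le> 1 / real N * real (N + 2)"
      unfolding k_def by (simp only: add_0_right) (intro mult_right_mono, auto)
    also have "\<dots> \<le> 12" using N by (simp add: field_simps)
    finally show ?thesis using 0 by (simp add: d_def k_def tent_nonneg)
  next
    case (Suc i)
    let ?t = "tent N (Suc N + i)" and ?t' = "tent N (Suc N + Suc i)"
    have "real (N + i + 2) \<le> real (5 * N)" using that Suc N by (subst of_nat_le_iff) simp
    then have i: "real (N + i + 2) \<le> 5 * real N" by simp
    have t: "0 \<le> ?t" "?t \<le> 1" "0 \<le> ?t'" "?t' \<le> 1" "\<bar>?t' - ?t\<bar> \<le> 1 / real N"
      using tent_nonneg tent_le_1[OF N] tent_Lipschitz[OF N, of "Suc N + i"] by auto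
    \<comment> \<open>A discrete product rule. The three terms contribute at most 5, 1 and
      5.\<close>
    have "d j = (?t' - ?t) * real (N + i + 2) + ?t' + (1 - \<rho>) * (?t * real (N + i + 2))"
      by (simp add: d_def Suc k_def algebra_simps)
    also have "\<bar>\<dots>\<bar> \<le> \<bar>?t' - ?t\<bar> * real (N + i + 2) + 1 + (1 - \<rho>) * (?t * real (N + i + 2))"
      using t \<rho> by (intro order_trans[OF abs_triangle_ineq] add_mono) (auto simp: abs_mult)
    also have "\<dots> \<le> 1 / real N * (5 * real N) + 1 + 1 / real N * (1 * (5 * real N))"
      unfolding \<rho>(3) using t i by (intro add_mono mult_mono) auto
    also have "\<dots> \<le> 12" using N by simp
    finally show ?thesis .
  qed
  have pm: "(\<lambda>r::real. r ^ N) \<in> borel_measurable borel" by measurable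
  have pb: "\<bar>r ^ N\<bar> \<le> 1" if "0 \<le> r" "r < 1" for r :: real
    using that by (simp add: power_le_one)
  have mom: "(\<integral>\<zeta>. norm \<zeta> ^ (2 * j) * norm \<zeta> ^ N \<partial>dA) = 2 / (real (2 * j + N) + 2)" for j
    by (simp only: power_add[symmetric] area_integral_norm_power)
  have mom_le: "2 / (real (2 * j + N) + 2) \<le> 2 / real N" for j
    using N by (intro divide_left_mono) auto
  have csum: "summable (\<lambda>j. norm (c j))"
    by (rule summable_finite[of "{..<Suc (3 * N)}"]) (auto simp: c_def)
  have en: "norm (e j) = \<rho> ^ j" for j
    using \<rho> z by (simp add: e_def norm_mult norm_power)
  have esum: "summable (\<lambda>j. norm (e j))"
    unfolding en using \<rho> by (intro summable_geometric) auto
  have Pc: "integrable dA (\<lambda>\<zeta>. (norm (\<Sum>j. c j * \<zeta> ^ j))\<^sup>2 * norm \<zeta> ^ N)"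
    "(\<lambda>j. (norm (c j))\<^sup>2 * (\<integral>\<zeta>. norm \<zeta> ^ (2 * j) * norm \<zeta> ^ N \<partial>dA))
      sums (\<integral>\<zeta>. (norm (\<Sum>j. c j * \<zeta> ^ j))\<^sup>2 * norm \<zeta> ^ N \<partial>dA)"
    by (rule area.Parseval[OF csum pm pb]; assumption)+
  have Pe: "integrable dA (\<lambda>\<zeta>. (norm (\<Sum>j. e j * \<zeta> ^ j))\<^sup>2 * norm \<zeta> ^ N)"
    "(\<lambda>j. (norm (e j))\<^sup>2 * (\<integral>\<zeta>. norm \<zeta> ^ (2 * j) * norm \<zeta> ^ N \<partial>dA))
      sums (\<integral>\<zeta>. (norm (\<Sum>j. e j * \<zeta> ^ j))\<^sup>2 * norm \<zeta> ^ N \<partial>dA)"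
    by (rule area.Parseval[OF esum pm pb]; assumption)+
  have Pc_le: "(\<integral>\<zeta>. (norm (\<Sum>j. c j * \<zeta> ^ j))\<^sup>2 * norm \<zeta> ^ N \<partial>dA) \<le> 864 + 288"
  proof -
    have "(\<integral>\<zeta>. (norm (\<Sum>j. c j * \<zeta> ^ j))\<^sup>2 * norm \<zeta> ^ N \<partial>dA)
       = (\<Sum>j<Suc (3 * N). (norm (c j))\<^sup>2 * (2 / (real (2 * j + N) + 2)))"
      using Pc(2) unfolding mom
      by (rule sums_unique2) (rule sums_finite, auto simp: c_def)
    also have "\<dots> \<le> (\<Sum>j<Suc (3 * N). 12\<^sup>2 * (2 / real N))"
    proof (rule sum_mono)
      fix j assume "j \<in> {..<Suc (3 * N)}"
      then have "norm (c j) \<le> 12" using d_bound[of j] z by (simp add: c_def norm_mult norm_power)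
      then show "(norm (c j))\<^sup>2 * (2 / (real (2 * j + N) + 2)) \<le> 12\<^sup>2 * (2 / real N)"
        by (intro mult_mono mom_le power_mono) auto
    qed
    also have "\<dots> = real (Suc (3 * N)) * (288 / real N)" by simp
    also have "\<dots> \<le> 864 + 288" using N by (simp add: field_simps)
    finally show ?thesis .
  qed
  have Pe_le: "(\<integral>\<zeta>. (norm (\<Sum>j. e j * \<zeta> ^ j))\<^sup>2 * norm \<zeta> ^ N \<partial>dA) \<le> 2"
  proof -
    have g: "(\<lambda>j. \<rho> ^ j * (2 / real N)) sums (1 / (1 - \<rho>) * (2 / real N))"
      using \<rho> by (intro sums_mult2 geometric_sums) auto
    have "(\<integral>\<zeta>. (norm (\<Sum>j. e j * \<zeta> ^ j))\<^sup>2 * norm \<zeta> ^ N \<partial>dA) \<le> 1 / (1 - \<rho>) * (2 / real N)"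
    proof (rule sums_le[OF _ Pe(2) g])
      fix j
      have "(\<rho> ^ j)\<^sup>2 \<le> \<rho> ^ j"
        unfolding power2_eq_square using \<rho> by (intro mult_left_le power_le_one) auto
      then show "(norm (e j))\<^sup>2 * (\<integral>\<zeta>. norm \<zeta> ^ (2 * j) * norm \<zeta> ^ N \<partial>dA) \<le> \<rho> ^ j * (2 / real N)"
        unfolding mom en using \<rho> by (intro mult_mono mom_le) auto
    qed
    also have "\<dots> = 2" using N by (simp add: \<rho>)
    finally show ?thesis .
  qed
  have pt: "norm \<zeta> ^ N * norm (Q \<zeta>) \<le> ((norm (\<Sum>j. c j * \<zeta> ^ j))\<^sup>2 * norm \<zeta> ^ N * (1/4)
      + (norm (\<Sum>j. e j * \<zeta> ^ j))\<^sup>2 * norm \<zeta> ^ N)" if \<zeta>: "norm \<zeta> < 1" for \<zeta>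
  proof -
    define x where "x = z * cnj \<zeta>"
    have x: "norm x < 1" using \<zeta> z by (simp add: x_def norm_mult)
    have rx: "norm (complex_of_real \<rho> * x) < 1"
      using x \<rho> mult_le_cancel_right2[of \<rho> "norm x"] by (simp add: norm_mult) 
    have x1: "1 - complex_of_real \<rho> * x \<noteq> 0" using rx by auto
    have "(\<Sum>j<Suc (3 * N). complex_of_real (d j) * x ^ j)
      = (1 - complex_of_real \<rho> * x) * (\<Sum>j<3 * N. complex_of_real (k j) * x ^ j) + complex_of_real (k (3 * N)) * x ^ (3 * N)"
      by (rule sum_summation_by_parts) (auto simp: d_def)
    then have PQ: "(\<Sum>j<Suc (3 * N). complex_of_real (d j) * x ^ j) = (1 - complex_of_real \<rho> * x) * Q \<zeta>"
      by (simp add: k3N Q_def x_def)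
    have "(\<Sum>j. c j * \<zeta> ^ j) = (\<Sum>j<Suc (3 * N). c j * \<zeta> ^ j)"
      by (rule suminf_finite) (auto simp: c_def)
    also have "\<dots> = cnj (\<Sum>j<Suc (3 * N). complex_of_real (d j) * x ^ j)"
      unfolding cnj_sum by (rule sum.cong) (auto simp: c_def x_def power_mult_distrib)
    finally have nP: "norm (\<Sum>j. c j * \<zeta> ^ j) = norm (1 - complex_of_real \<rho> * x) * norm (Q \<zeta>)"
      by (simp only: PQ complex_mod_cnj norm_mult)
    have "(\<lambda>j. e j * \<zeta> ^ j) = (\<lambda>j. cnj (complex_of_real \<rho> * x) ^ j)"
      by (auto simp: e_def x_def power_mult_distrib)
    then have "(\<Sum>j. e j * \<zeta> ^ j) = 1 / (1 - cnj (complex_of_real \<rho> * x))"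
      using rx by (simp only: suminf_geometric complex_mod_cnj)
    also have "\<dots> = cnj (1 / (1 - complex_of_real \<rho> * x))" by simp
    finally have nE: "norm (\<Sum>j. e j * \<zeta> ^ j) = 1 / norm (1 - complex_of_real \<rho> * x)"
      by (simp only: complex_mod_cnj norm_divide norm_one)
    define s where "s = norm (\<Sum>j. c j * \<zeta> ^ j)"
    define t where "t = norm (\<Sum>j. e j * \<zeta> ^ j)"
    have "norm (Q \<zeta>) = s * t" using x1 by (simp add: s_def t_def nP nE)
    moreover have "s * t \<le> s\<^sup>2 * (1/4) + t\<^sup>2"
      using zero_le_power2[of "s / 2 - t"] by (simp add: power2_eq_square algebra_simps)
    ultimately have "norm \<zeta> ^ N * norm (Q \<zeta>) \<le> norm \<zeta> ^ N * (s\<^sup>2 * (1/4) + t\<^sup>2)"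
      by (intro mult_left_mono) auto
    then show ?thesis by (simp add: s_def t_def algebra_simps)
  qed
  have dom: "integrable dA (\<lambda>\<zeta>. (norm (\<Sum>j. c j * \<zeta> ^ j))\<^sup>2 * norm \<zeta> ^ N * (1/4)
      + (norm (\<Sum>j. e j * \<zeta> ^ j))\<^sup>2 * norm \<zeta> ^ N)"
    by (intro Bochner_Integration.integrable_add Bochner_Integration.integrable_mult_left Pc(1) Pe(1))
  have int: "integrable dA (\<lambda>\<zeta>. norm \<zeta> ^ N * norm (Q \<zeta>))"
  proof (rule Bochner_Integration.integrable_bound[OF dom])
    show "(\<lambda>\<zeta>. norm \<zeta> ^ N * norm (Q \<zeta>)) \<in> borel_measurable dA"
      unfolding Q_def by (intro borel_measurable_dA) measurable
    show "AE \<zeta> in dA. norm (norm \<zeta> ^ N * norm (Q \<zeta>)) \<le> norm ((norm (\<Sum>j. c j * \<zeta> ^ j))\<^sup>2 * norm \<zeta> ^ N * (1/4)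
      + (norm (\<Sum>j. e j * \<zeta> ^ j))\<^sup>2 * norm \<zeta> ^ N)"
    proof (rule AE_I2)
      fix \<zeta> assume "\<zeta> \<in> space dA"
      then have "norm \<zeta> < 1" by simp
      from order_trans[OF pt[OF this] abs_ge_self]
      show "norm (norm \<zeta> ^ N * norm (Q \<zeta>)) \<le> norm ((norm (\<Sum>j. c j * \<zeta> ^ j))\<^sup>2 * norm \<zeta> ^ N * (1/4)
      + (norm (\<Sum>j. e j * \<zeta> ^ j))\<^sup>2 * norm \<zeta> ^ N)"
        by (simp only: real_norm_def abs_mult abs_norm_cancel power_abs)
    qed
  qed
  then show "integrable dA (\<lambda>\<zeta>. norm \<zeta> ^ N * norm (\<Sum>j<3 * N. complex_of_real (k j) * (z * cnj \<zeta>) ^ j))"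
    by (simp only: Q_def)
  have "(\<integral>\<zeta>. norm \<zeta> ^ N * norm (Q \<zeta>) \<partial>dA) \<le> (\<integral>\<zeta>. (norm (\<Sum>j. c j * \<zeta> ^ j))\<^sup>2 * norm \<zeta> ^ N * (1/4)
      + (norm (\<Sum>j. e j * \<zeta> ^ j))\<^sup>2 * norm \<zeta> ^ N \<partial>dA)"
    by (rule integral_mono[OF int dom pt]) simp
  also have "\<dots> = (\<integral>\<zeta>. (norm (\<Sum>j. c j * \<zeta> ^ j))\<^sup>2 * norm \<zeta> ^ N \<partial>dA) * (1/4)
      + (\<integral>\<zeta>. (norm (\<Sum>j. e j * \<zeta> ^ j))\<^sup>2 * norm \<zeta> ^ N \<partial>dA)"
    using Pc(1) Pe(1) by (subst Bochner_Integration.integral_add) auto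
  \<comment> \<open>The two estimates give 1152 / 4 + 2 = 290, so 433 is a generous bound.\<close>
  also have "\<dots> \<le> 433" using Pc_le Pe_le by simp
  finally show "(\<integral>\<zeta>. norm \<zeta> ^ N * norm (\<Sum>j<3 * N. complex_of_real (k j) * (z * cnj \<zeta>) ^ j) \<partial>dA) \<le> 433"
    by (simp only: Q_def)
qed

text \<open>On the circle the block is the integral of \<open>h (1 - |\<zeta>|^2)\<close>, bounded
  by \<beta>, against z^(N+1) \<open>cnj \<zeta> ^ N\<close> \<open>Q\<close>. The power of \<zeta>
  is exactly the weight in \<open>block_kernel_bound\<close>.\<close>

lemma tent_block_bound_sphere:
  assumes b: "Bloch_coeffs \<beta> b" and N: "0 < N" and z: "norm z = 1"
  shows "norm (tent_block N b z) \<le> 433 * \<beta>"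
proof -
  obtain h where h: "\<And>z. norm z < 1 \<Longrightarrow> (\<lambda>m. of_nat (Suc m) * b (Suc m) * z ^ m) sums h z"
    and \<beta>: "\<And>z. norm z < 1 \<Longrightarrow> norm (h z) * (1 - (norm z)\<^sup>2) \<le> \<beta>"
    using b unfolding Bloch_coeffs_def by auto
  define hv where "hv \<zeta> = h \<zeta> * complex_of_real (1 - (norm \<zeta>)\<^sup>2)" for \<zeta>
  note hi = Bloch_coeffs_integral[of b h, OF h \<beta>, folded hv_def]
  have hvb: "norm (hv \<zeta>) \<le> \<beta>" if "norm \<zeta> < 1" for \<zeta>
  proof -
    have "(norm \<zeta>)\<^sup>2 \<le> 1" using that by (intro power_le_one) auto
    then have "norm (complex_of_real (1 - (norm \<zeta>)\<^sup>2)) = 1 - (norm \<zeta>)\<^sup>2"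
      by (simp only: norm_of_real)
    then show ?thesis using \<beta>[OF that] by (simp only: hv_def norm_mult)
  qed
  have hint: "integrable dA hv" using hi(1) by assumption
  have \<beta>0: "0 \<le> \<beta>" using order_trans[OF norm_ge_zero hvb[of 0]] by simp
  \<comment> \<open>The factor N + j + 2 undoes the denominator m + 2 in the coefficient formula at
    m = N + j.\<close>
  define k where "k j = tent N (Suc N + j) * real (N + j + 2)" for j
  define Q where "Q \<zeta> = (\<Sum>j<3 * N. complex_of_real (k j) * (z * cnj \<zeta>) ^ j)" for \<zeta>
  note kb = block_kernel_bound[OF N z, folded k_def, folded Q_def]
  have ii: "integrable dA (\<lambda>\<zeta>. complex_of_real (k j) * z ^ (Suc N + j) * (hv \<zeta> * cnj \<zeta> ^ (N + j)))" for j
  proof (intro Bochner_Integration.integrable_mult_right area.integrable_W_mult_bounded[OF hint, where B=1])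
    show "(\<lambda>z. cnj z ^ (N + j)) \<in> borel_measurable dA" by (intro borel_measurable_dA) measurable
  qed (simp add: norm_power power_le_one)
  have "tent_block N b z = (\<Sum>j<3 * N. \<integral>\<zeta>. complex_of_real (k j) * z ^ (Suc N + j) * (hv \<zeta> * cnj \<zeta> ^ (N + j)) \<partial>dA)"
    unfolding tent_block_shift[OF N]
  proof (rule sum.cong[OF refl])
    fix j assume "j \<in> {..<3 * N}"
    have "(\<integral>\<zeta>. hv \<zeta> * cnj \<zeta> ^ (N + j) \<partial>dA) = b (Suc (N + j)) / of_nat (N + j + 2)"
      by (rule hi(2))
    then have "b (Suc N + j) = of_nat (N + j + 2) * (\<integral>\<zeta>. hv \<zeta> * cnj \<zeta> ^ (N + j) \<partial>dA)"
      by (simp add: field_simps del: of_nat_add of_nat_Suc)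
    moreover have "complex_of_real (k j) = complex_of_real (tent N (Suc N + j)) * of_nat (N + j + 2)"
      by (simp add: k_def)
    ultimately show "complex_of_real (tent N (Suc N + j)) * b (Suc N + j) * z ^ (Suc N + j)
      = (\<integral>\<zeta>. complex_of_real (k j) * z ^ (Suc N + j) * (hv \<zeta> * cnj \<zeta> ^ (N + j)) \<partial>dA)"
      by (simp only: Bochner_Integration.integral_mult_right_zero) (simp only: mult_ac)
  qed
  also have "\<dots> = (\<integral>\<zeta>. (\<Sum>j<3 * N. complex_of_real (k j) * z ^ (Suc N + j) * (hv \<zeta> * cnj \<zeta> ^ (N + j))) \<partial>dA)"
    by (rule Bochner_Integration.integral_sum[symmetric]) (rule ii)
  also have "norm \<dots> \<le> (\<integral>\<zeta>. \<beta> * (norm \<zeta> ^ N * norm (Q \<zeta>)) \<partial>dA)"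
  proof (rule Bochner_Integration.integral_norm_bound_integral)
    show "integrable dA (\<lambda>\<zeta>. \<Sum>j<3 * N. complex_of_real (k j) * z ^ (Suc N + j) * (hv \<zeta> * cnj \<zeta> ^ (N + j)))"
      by (intro Bochner_Integration.integrable_sum ii)
    show "integrable dA (\<lambda>\<zeta>. \<beta> * (norm \<zeta> ^ N * norm (Q \<zeta>)))"
      by (intro Bochner_Integration.integrable_mult_right kb(1))
    fix \<zeta> assume "\<zeta> \<in> space dA"
    then have \<zeta>: "norm \<zeta> < 1" by simp
    have "(\<Sum>j<3 * N. complex_of_real (k j) * z ^ (Suc N + j) * (hv \<zeta> * cnj \<zeta> ^ (N + j)))
      = hv \<zeta> * (z ^ Suc N * cnj \<zeta> ^ N * Q \<zeta>)"
      unfolding Q_def sum_distrib_left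
      by (rule sum.cong[OF refl]) (simp only: power_add power_mult_distrib mult_ac)
    also have "norm \<dots> = norm (hv \<zeta>) * (norm \<zeta> ^ N * norm (Q \<zeta>))"
      using z by (simp add: norm_mult norm_power)
    also have "\<dots> \<le> \<beta> * (norm \<zeta> ^ N * norm (Q \<zeta>))"
      by (intro mult_right_mono hvb \<zeta>) auto
    finally show "norm (\<Sum>j<3 * N. complex_of_real (k j) * z ^ (Suc N + j) * (hv \<zeta> * cnj \<zeta> ^ (N + j)))
      \<le> \<beta> * (norm \<zeta> ^ N * norm (Q \<zeta>))" .
  qed
  also have "\<dots> = \<beta> * (\<integral>\<zeta>. norm \<zeta> ^ N * norm (Q \<zeta>) \<partial>dA)"
    by simp
  also have "\<dots> \<le> \<beta> * 433" using \<beta>0 kb(2) by (intro mult_left_mono)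
  finally show ?thesis by (simp add: mult.commute)
qed

lemma polynomial_bound_disc:
  fixes q :: "nat \<Rightarrow> complex"
  assumes "\<And>z. norm z = 1 \<Longrightarrow> norm (\<Sum>j<n. q j * z ^ j) \<le> B" "norm w \<le> 1"
  shows "norm (\<Sum>j<n. q j * w ^ j) \<le> B"
proof (rule maximum_modulus_frontier[of "\<lambda>w. \<Sum>j<n. q j * w ^ j" "cball 0 1"])
  show "(\<lambda>w. \<Sum>j<n. q j * w ^ j) holomorphic_on interior (cball 0 1)"
    by (intro holomorphic_intros)
  show "continuous_on (closure (cball 0 1)) (\<lambda>w. \<Sum>j<n. q j * w ^ j)"
    by (intro continuous_intros)
qed (use assms in auto)

lemma Bloch_coeffs_nonneg: "Bloch_coeffs \<beta> b \<Longrightarrow> 0 \<le> \<beta>"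
proof -
  assume "Bloch_coeffs \<beta> b"
  then obtain h where h: "\<forall>z. norm z < 1 \<longrightarrow> (\<lambda>m. of_nat (Suc m) * b (Suc m) * z ^ m) sums h z
      \<and> norm (h z) * (1 - (norm z)\<^sup>2) \<le> \<beta>"
    unfolding Bloch_coeffs_def by blast
  have "norm (h 0) \<le> \<beta>" using h[rule_format, of 0] by simp
  then show "0 \<le> \<beta>" by (rule order_trans[OF norm_ge_zero])
qed

text \<open>The maximum principle is applied to the block divided by z^(N+1) inside the disc, and to
  the reversed polynomial in 1/z outside. The exterior bound matters because
  \<open>bounded_block_bound\<close> evaluates the block at points |\<zeta>|^2 /
  \<open>cnj z\<close>, whose modulus may exceed 1.\<close>

lemma tent_block_bound:
  assumes b: "Bloch_coeffs \<beta> b" and N: "0 < N"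
  shows "norm (tent_block N b w) \<le> 433 * \<beta> * max (norm w ^ N) (norm w ^ (4 * N))"
proof (cases "norm w \<le> 1")
  case True
  define q where "q j = complex_of_real (tent N (Suc N + j)) * b (Suc N + j)" for j
  have eq: "tent_block N b z = z ^ Suc N * (\<Sum>j<3 * N. q j * z ^ j)" for z
    unfolding tent_block_shift[OF N] q_def sum_distrib_left
    by (rule sum.cong[OF refl]) (simp only: power_add mult_ac)
  have "norm (\<Sum>j<3 * N. q j * w ^ j) \<le> 433 * \<beta>"
  proof (rule polynomial_bound_disc[OF _ True])
    fix z :: complex assume z: "norm z = 1"
    show "norm (\<Sum>j<3 * N. q j * z ^ j) \<le> 433 * \<beta>"
      using tent_block_bound_sphere[OF b N z] z by (simp add: eq norm_mult norm_power)
  qed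
  moreover have "norm w ^ Suc N \<le> norm w ^ N" using True by (intro power_decreasing) auto
  ultimately have "norm w ^ Suc N * norm (\<Sum>j<3 * N. q j * w ^ j) \<le> norm w ^ N * (433 * \<beta>)"
    by (intro mult_mono) auto
  also have "\<dots> \<le> max (norm w ^ N) (norm w ^ (4 * N)) * (433 * \<beta>)"
    using Bloch_coeffs_nonneg[OF b] by (intro mult_right_mono) auto
  finally show ?thesis by (simp only: eq norm_mult norm_power mult.commute)
next
  case False
  then have w0: "w \<noteq> 0" by auto
  define q where "q j = complex_of_real (tent N (4 * N - j)) * b (4 * N - j)" for j
  have eq: "tent_block N b z = z ^ (4 * N) * (\<Sum>j<Suc (4 * N). q j * inverse z ^ j)" if "z \<noteq> 0" for z
  proof -
    have "tent_block N b z = (\<Sum>j<Suc (4 * N). complex_of_real (tent N (4 * N - j)) * b (4 * N - j) * z ^ (4 * N - j))"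
      unfolding tent_block_def
      by (subst sum.nat_diff_reindex[symmetric]) simp
    also have "\<dots> = z ^ (4 * N) * (\<Sum>j<Suc (4 * N). q j * inverse z ^ j)"
      unfolding sum_distrib_left q_def
    proof (rule sum.cong[OF refl])
      fix j assume "j \<in> {..<Suc (4 * N)}"
      then have "z ^ (4 * N) = z ^ (4 * N - j) * z ^ j" by (simp flip: power_add)
      then have "z ^ (4 * N - j) = z ^ (4 * N) * inverse z ^ j"
        using that by (simp add: power_inverse)
      then show "complex_of_real (tent N (4 * N - j)) * b (4 * N - j) * z ^ (4 * N - j) =
         z ^ (4 * N) * (complex_of_real (tent N (4 * N - j)) * b (4 * N - j) * inverse z ^ j)"
        by (simp only: mult_ac)
    qed
    finally show ?thesis .
  qed
  have "norm (\<Sum>j<Suc (4 * N). q j * inverse w ^ j) \<le> 433 * \<beta>"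
  proof (rule polynomial_bound_disc)
    fix z :: complex assume z: "norm z = 1"
    then have "z \<noteq> 0" by auto
    then show "norm (\<Sum>j<Suc (4 * N). q j * z ^ j) \<le> 433 * \<beta>"
      using tent_block_bound_sphere[OF b N, of "inverse z"] eq[of "inverse z"] z
      by (simp add: norm_mult norm_power norm_inverse del: sum.lessThan_Suc)
  next
    show "norm (inverse w) \<le> 1" using False by (simp add: norm_inverse inverse_le_1_iff)
  qed
  then have "norm w ^ (4 * N) * norm (\<Sum>j<Suc (4 * N). q j * inverse w ^ j) \<le> norm w ^ (4 * N) * (433 * \<beta>)"
    by (intro mult_left_mono) auto
  also have "\<dots> \<le> max (norm w ^ N) (norm w ^ (4 * N)) * (433 * \<beta>)"
    using Bloch_coeffs_nonneg[OF b] by (intro mult_right_mono) auto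
  finally show ?thesis by (simp only: eq[OF w0] norm_mult norm_power mult.commute)
qed

section \<open>From comparison of moments to comparison of inner and outer mass\<close>

lemma (in weighted_disc) integrable_radial:
  fixes v :: "real \<Rightarrow> real"
  assumes [measurable]: "v \<in> borel_measurable borel" and "\<And>r. 0 \<le> r \<Longrightarrow> r < 1 \<Longrightarrow> \<bar>v r\<bar> \<le> B"
  shows "integrable W (\<lambda>z. v (norm z))"
proof (rule integrable_W_bounded[where B=B])
  show "(\<lambda>z::complex. v (norm z)) \<in> borel_measurable dA"
    by (intro borel_measurable_dA) measurable
qed (use assms in auto)

locale split_weight = weighted_disc +
  fixes d :: real
  assumes d_pos: "0 < d"
    and split: "\<And>N. 0 < N \<Longrightarrow> (\<integral>z. indicator {exp (- d / real N)<..} (norm z) \<partial>W)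
      \<le> (\<integral>z. norm z ^ (8 * N) * indicator {..exp (- d / real N)} (norm z) \<partial>W)"

text \<open>Put R = exp (- d / N) and let a be the mass beyond R. If 3 |z|^Y \<ge> 1 there, then a
  is at most three times the integral of |z|^Y, which for Y large compared with N is at most half
  the integral of |z|^(8N). Splitting that integral at R gives 2a \<le> D + a, hence a \<le>
  D.\<close>

lemma (in weighted_disc) weight_class_M_split:
  assumes "\<omega> \<in> weight_class_M"
  shows "\<exists>d. split_weight \<omega> d"
proof -
  obtain C K where C: "C > 1" and K: "K > 1" and CK: "\<And>x. x \<ge> 1 \<Longrightarrow> moment \<omega> x \<ge> C * moment \<omega> (K * x)"
    using assms unfolding weight_class_M_def by auto
  have iter: "C ^ j * moment \<omega> (K ^ j * x) \<le> moment \<omega> x" if "x \<ge> 1" for j x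
  proof (induction j)
    case (Suc j)
    have "1 * 1 \<le> K ^ j * x" using K that by (intro mult_mono one_le_power) auto
    then have "C * moment \<omega> (K * (K ^ j * x)) \<le> moment \<omega> (K ^ j * x)" by (intro CK) simp
    then have "C ^ j * (C * moment \<omega> (K * (K ^ j * x))) \<le> C ^ j * moment \<omega> (K ^ j * x)"
      using C by (intro mult_left_mono) auto
    also note Suc
    finally show ?case by (simp add: mult_ac)
  qed simp
  \<comment> \<open>The 6 is the product of the 3 in 3 |z|^Y and the 2 in
    \<open>integral_norm_power\<close>.\<close>
  obtain j where j: "6 < C ^ j" using real_arch_pow[OF C] by blast
  define P where "P = nat \<lceil>K ^ j\<rceil>"
  have P: "K ^ j \<le> real P" unfolding P_def by (rule real_nat_ceiling_ge)
  have "1 \<le> K ^ j" using K by (intro one_le_power) simp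
  then have P1: "1 \<le> P" using P by linarith
  \<comment> \<open>Since Y \<le> 9 P N, this choice gives Y d / N \<le> 1 and so R^Y \<ge> exp (-1)
    \<ge> 1/3.\<close>
  define d where "d = 1 / (9 * real P)"
  have d: "0 < d" using P1 by (simp add: d_def)
  have "(\<integral>z. indicator {exp (- d / real N)<..} (norm z) \<partial>W)
      \<le> (\<integral>z. norm z ^ (8 * N) * indicator {..exp (- d / real N)} (norm z) \<partial>W)" if N: "0 < N" for N
  proof -
    define R where "R = exp (- d / real N)"
    \<comment> \<open>The integral of |z|^Y is governed by the moment at Y + 1, which has to be P
      times the moment index 8N + 1.\<close>
    define Y where "Y = P * (8 * N + 1) - 1"
    have Y: "real Y + 1 = real P * (real (8 * N) + 1)"
    proof -
      have "Y + 1 = P * (8 * N + 1)" using P1 by (simp add: Y_def)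
      then have "real (Y + 1) = real (P * (8 * N + 1))" by (simp only:)
      then show ?thesis by (simp add: algebra_simps)
    qed
    have "Y \<le> P * (9 * N)"
      unfolding Y_def by (rule order_trans[OF diff_le_self]) (use N in \<open>intro mult_left_mono; simp\<close>)
    then have "real Y \<le> real (P * (9 * N))" by (simp only: of_nat_le_iff)
    then have "real Y * (d / real N) \<le> 1"
      using N P1 by (simp add: d_def field_simps)
    then have "exp (-1) \<le> exp (real Y * (- d / real N))" by simp
    also have "\<dots> = R ^ Y" by (simp only: R_def exp_of_nat_mult)
    finally have "exp (-1) \<le> R ^ Y" .
    moreover have "1 / 3 \<le> exp (-1 :: real)"
      using exp_le by (simp add: exp_minus field_simps)
    ultimately have RY: "1 / 3 \<le> R ^ Y" by simp
    have R0: "0 < R" by (simp add: R_def)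
    have ia: "integrable W (\<lambda>z. indicator {R<..} (norm z) :: real)"
      by (rule integrable_radial[where B=1]) (auto simp: indicator_def)
    have ip: "integrable W (\<lambda>z. norm z ^ n)" for n
      by (rule integrable_radial[where B=1]) (auto simp: power_le_one)
    have iD: "integrable W (\<lambda>z. norm z ^ n * indicator {..R} (norm z))"
      "integrable W (\<lambda>z. norm z ^ n * indicator {R<..} (norm z))" for n
      by (rule integrable_radial[where B=1]; auto simp: indicator_def power_le_one)+
    define a :: real where "a = (\<integral>z. indicator {R<..} (norm z) \<partial>W)"
    define D where "D = (\<integral>z. norm z ^ (8 * N) * indicator {..R} (norm z) \<partial>W)"
    have "a \<le> (\<integral>z. 3 * norm z ^ Y \<partial>W)"
      unfolding a_def
    proof (rule integral_mono)
      fix z :: complex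
      have "1 \<le> 3 * norm z ^ Y" if "R < norm z"
        using power_mono[of R "norm z" Y] R0 RY that by simp
      then show "indicator {R<..} (norm z) \<le> 3 * norm z ^ Y" by (auto simp: indicator_def)
    qed (auto intro!: ia ip)
    also have "\<dots> = 6 * moment \<omega> (real P * (real (8 * N) + 1))"
      by (simp add: integral_norm_power Y)
    also have "\<dots> \<le> 6 * moment \<omega> (K ^ j * (real (8 * N) + 1))"
      using P K by (intro mult_left_mono moment_mono mult_right_mono) auto
    also have "\<dots> \<le> C ^ j * moment \<omega> (K ^ j * (real (8 * N) + 1))"
      using j K by (intro mult_right_mono less_imp_le[OF moment_pos]) auto
    also have "\<dots> \<le> moment \<omega> (real (8 * N) + 1)"
      by (rule iter) simp
    finally have 1: "2 * a \<le> (\<integral>z. norm z ^ (8 * N) \<partial>W)"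
      by (simp only: integral_norm_power)
    also have "\<dots> = (\<integral>z. norm z ^ (8 * N) * indicator {..R} (norm z) + norm z ^ (8 * N) * indicator {R<..} (norm z) \<partial>W)"
      by (rule Bochner_Integration.integral_cong[OF refl]) (auto simp: indicator_def)
    also have "\<dots> = D + (\<integral>z. norm z ^ (8 * N) * indicator {R<..} (norm z) \<partial>W)"
      unfolding D_def by (rule Bochner_Integration.integral_add[OF iD])
    also have "(\<integral>z. norm z ^ (8 * N) * indicator {R<..} (norm z) \<partial>W) \<le> a"
      unfolding a_def by (rule integral_mono[OF iD(2) ia]) (auto simp: indicator_def power_le_one)
    finally show ?thesis by (simp add: a_def D_def R_def)
  qed
  then have "split_weight \<omega> d" using d by unfold_locales auto
  then show ?thesis ..
qed

section \<open>Bounded replacements of the blocks with the same moments\<close>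

context split_weight
begin

definition radius :: "nat \<Rightarrow> real" where "radius N = exp (- d / real N)"

definition outer :: "nat \<Rightarrow> nat \<Rightarrow> real" where
  "outer N m = (\<integral>z. norm z ^ m * indicator {radius N<..} (norm z) \<partial>W)"

definition inner :: "nat \<Rightarrow> nat \<Rightarrow> real" where
  "inner N m = (\<integral>z. norm z ^ m * indicator {..radius N} (norm z) \<partial>W)"

lemma radius: "0 < N \<Longrightarrow> 0 < radius N" "0 < N \<Longrightarrow> radius N < 1"
  using d_pos by (auto simp: radius_def)

lemma integrable_inner: "integrable W (\<lambda>z. norm z ^ m * indicator {..r} (norm z))"
  and integrable_outer: "integrable W (\<lambda>z. norm z ^ m * indicator {r<..} (norm z))"
  by (rule integrable_radial[where B=1]; auto simp: indicator_def power_le_one)+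

lemma inner_nonneg: "0 \<le> inner N m" and outer_nonneg: "0 \<le> outer N m"
  by (auto simp: inner_def outer_def intro!: Bochner_Integration.integral_nonneg)

lemma inner_outer: "inner N m + outer N m = (\<integral>z. norm z ^ m \<partial>W)"
  unfolding inner_def outer_def
  by (subst Bochner_Integration.integral_add[OF integrable_inner integrable_outer, symmetric])
    (rule Bochner_Integration.integral_cong[OF refl], auto simp: indicator_def)

lemma outer_antimono: "outer N m \<le> outer N 0"
  unfolding outer_def
  by (rule integral_mono[OF integrable_outer integrable_outer]) (auto simp: indicator_def power_le_one)

lemma outer_le_inner: "0 < N \<Longrightarrow> outer N 0 \<le> inner N (8 * N)"
  using split[of N] by (simp add: outer_def inner_def radius_def)

text \<open>The mass of \<open>|\<zeta>|\<^sup>2\<^sup>n\<close> beyond the radius is moved inside as a multiple of \<open>|z|\<^sup>8\<^sup>N\<close>.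
  If \<open>inner N (8 * N)\<close> vanishes, then so does \<open>outer N m\<close>, and the quotient is \<open>0\<close>.\<close>

definition profile :: "nat \<Rightarrow> nat \<Rightarrow> real \<Rightarrow> real" where
  "profile N n r = indicator {..radius N} r * (1 + r ^ (8 * N - 2 * n) * (outer N (2 * n) / inner N (8 * N)))"

text \<open>Each monomial is multiplied by its own radial factor, so orthogonality is preserved and
  the n-th moment is affected by the n-th profile alone.\<close>

definition bounded_block :: "nat \<Rightarrow> (nat \<Rightarrow> complex) \<Rightarrow> complex \<Rightarrow> complex" where
  "bounded_block N b z = (\<Sum>n<Suc (4 * N). complex_of_real (tent N n) * b n * z ^ n * complex_of_real (profile N n (norm z)))"

lemma profile_measurable [measurable]: "profile N n \<in> borel_measurable borel"
  unfolding profile_def by measurable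

lemma bounded_block_measurable: "bounded_block N b \<in> borel_measurable dA"
  unfolding bounded_block_def by (intro borel_measurable_dA) measurable

lemma quotient_le_1: "0 < N \<Longrightarrow> outer N m / inner N (8 * N) \<le> 1"
  using outer_antimono[of N m] outer_le_inner[of N] inner_nonneg[of N "8 * N"]
  by (cases "inner N (8 * N) = 0") (auto simp: divide_le_eq)

lemma profile_bound: "0 < N \<Longrightarrow> 0 \<le> r \<Longrightarrow> r < 1 \<Longrightarrow> \<bar>profile N n r\<bar> \<le> 2"
proof -
  assume N: "0 < N" and r: "0 \<le> r" "r < 1"
  have "0 \<le> outer N (2 * n) / inner N (8 * N)"
    using inner_nonneg outer_nonneg by (intro divide_nonneg_nonneg)
  then have "0 \<le> r ^ (8 * N - 2 * n) * (outer N (2 * n) / inner N (8 * N))"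
    "r ^ (8 * N - 2 * n) * (outer N (2 * n) / inner N (8 * N)) \<le> 1"
    using r quotient_le_1[OF N] by (auto intro!: mult_le_one power_le_one simp del: times_divide_eq_right)
  then show ?thesis unfolding profile_def by (auto simp: indicator_def abs_le_iff)
qed

text \<open>The correction multiplies |z|^(2n) up to |z|^(8N), whose inner integral cancels the
  denominator and leaves exactly the missing outer part. The bound n \<le> 4N keeps the natural
  subtraction from truncating.\<close>

lemma integral_profile:
  assumes N: "0 < N" and n: "n \<le> 4 * N"
  shows "(\<integral>z. norm z ^ (2 * n) * profile N n (norm z) \<partial>W) = (\<integral>z. norm z ^ (2 * n) \<partial>W)"
proof -
  let ?q = "outer N (2 * n) / inner N (8 * N)"
  have e: "x ^ (2 * n) * x ^ (8 * N - 2 * n) = x ^ (8 * N)" for x :: real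
    using n by (simp flip: power_add)
  have "(\<integral>z. norm z ^ (2 * n) * profile N n (norm z) \<partial>W)
     = (\<integral>z. norm z ^ (2 * n) * indicator {..radius N} (norm z) + norm z ^ (8 * N) * indicator {..radius N} (norm z) * ?q \<partial>W)"
    unfolding profile_def e[symmetric]
    by (rule Bochner_Integration.integral_cong[OF refl]) (simp add: algebra_simps)
  also have "\<dots> = inner N (2 * n) + inner N (8 * N) * ?q"
    unfolding inner_def
    by (subst Bochner_Integration.integral_add) (auto intro!: integrable_inner)
  also have "inner N (8 * N) * ?q = outer N (2 * n)"
    using outer_antimono[of N "2 * n"] outer_le_inner[OF N] outer_nonneg[of N "2 * n"]
    by (cases "inner N (8 * N) = 0") auto
  finally show ?thesis by (simp only: inner_outer)
qed

text \<open>Coefficientwise estimates would lose the cancellation within the block. Instead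
  \<open>outer N (2 * n)\<close> is written as an integral over \<zeta>: with w = |\<zeta>|^2 /
  \<open>cnj z\<close>, the identity z^n |z|^(8N-2n) |\<zeta>|^(2n) = |z|^(8N) w^n turns the
  correction into an integral of the whole block evaluated at w.\<close>

lemma bounded_block_bound:
  assumes b: "Bloch_coeffs \<beta> b" and N: "0 < N" and z: "norm z < 1"
  shows "norm (bounded_block N b z) \<le> 866 * \<beta> * (norm z ^ N * indicator {..radius N} (norm z))"
\<comment> \<open>The point 0, where w is undefined, is treated apart; the block vanishes there
  because \<open>tent N 0 = 0\<close>.\<close>
proof (cases "norm z \<le> radius N \<and> z \<noteq> 0")
  case False
  then consider "norm z > radius N" | "z = 0" by fastforce
  then have "bounded_block N b z = 0"
  proof cases
    case 1
    then show ?thesis by (simp add: bounded_block_def profile_def)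
  next
    case 2
    then show ?thesis unfolding bounded_block_def
      by (intro sum.neutral) (auto simp: tent_eq_0[OF N] power_0_left)
  qed
  then show ?thesis using Bloch_coeffs_nonneg[OF b] by simp
next
  case True
  then have zR: "norm z \<le> radius N" and z0: "z \<noteq> 0" by auto
  have \<beta>: "0 \<le> \<beta>" by (rule Bloch_coeffs_nonneg[OF b])
  define g where "g \<zeta> = complex_of_real (norm z ^ (8 * N)) *
    tent_block N b (complex_of_real ((norm \<zeta>)\<^sup>2) / cnj z) * complex_of_real (indicator {radius N<..} (norm \<zeta>))" for \<zeta> :: complex
  have g_eq: "g \<zeta> = (\<Sum>n<Suc (4 * N). complex_of_real (tent N n) * b n * z ^ n * complex_of_real (norm z ^ (8 * N - 2 * n))
     * complex_of_real (norm \<zeta> ^ (2 * n) * indicator {radius N<..} (norm \<zeta>)))" for \<zeta>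
    unfolding g_def tent_block_def sum_distrib_left sum_distrib_right
  proof (rule sum.cong[OF refl])
    fix n assume "n \<in> {..<Suc (4 * N)}"
    then have "complex_of_real (norm z) ^ (8 * N) = complex_of_real (norm z) ^ (2 * n) * complex_of_real (norm z) ^ (8 * N - 2 * n)"
      by (simp flip: power_add)
    also have "complex_of_real (norm z) ^ (2 * n) = z ^ n * cnj z ^ n"
    proof -
      have "z ^ n * cnj z ^ n = complex_of_real ((norm z)\<^sup>2) ^ n"
        unfolding complex_norm_square by (rule power_mult_distrib[symmetric])
      then show ?thesis by (simp add: power_mult)
    qed
    finally have e: "complex_of_real (norm z) ^ (8 * N) = z ^ n * cnj z ^ n * complex_of_real (norm z) ^ (8 * N - 2 * n)" .
    have f: "(complex_of_real ((norm \<zeta>)\<^sup>2) / cnj z) ^ n = complex_of_real (norm \<zeta>) ^ (2 * n) / cnj z ^ n"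
      by (simp add: power_divide power_mult)
    show "complex_of_real (norm z ^ (8 * N)) * (complex_of_real (tent N n) * b n * (complex_of_real ((norm \<zeta>)\<^sup>2) / cnj z) ^ n)
        * complex_of_real (indicator {radius N<..} (norm \<zeta>)) =
      complex_of_real (tent N n) * b n * z ^ n * complex_of_real (norm z ^ (8 * N - 2 * n))
     * complex_of_real (norm \<zeta> ^ (2 * n) * indicator {radius N<..} (norm \<zeta>))"
      unfolding f unfolding of_real_power of_real_mult e using z0 by (simp add: field_simps)
  qed
  have iz: "integrable W (\<lambda>\<zeta>. complex_of_real (tent N n) * b n * z ^ n * complex_of_real (norm z ^ (8 * N - 2 * n))
     * complex_of_real (norm \<zeta> ^ (2 * n) * indicator {radius N<..} (norm \<zeta>)))" for n
    by (intro Bochner_Integration.integrable_mult_right integrable_of_real integrable_outer)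
  have gi: "integrable W g"
    unfolding g_eq[abs_def] by (intro Bochner_Integration.integrable_sum iz)
  have gint: "(\<integral>\<zeta>. g \<zeta> \<partial>W) = (\<Sum>n<Suc (4 * N). complex_of_real (tent N n) * b n * z ^ n * complex_of_real (norm z ^ (8 * N - 2 * n))
     * complex_of_real (outer N (2 * n)))"
    unfolding g_eq[abs_def] outer_def
    by (subst Bochner_Integration.integral_sum[OF iz])
      (simp only: Bochner_Integration.integral_mult_right_zero integral_complex_of_real)
  have "bounded_block N b z = tent_block N b z + (\<integral>\<zeta>. g \<zeta> \<partial>W) / complex_of_real (inner N (8 * N))"
    unfolding bounded_block_def tent_block_def gint sum_divide_distrib sum.distrib[symmetric]
    by (rule sum.cong[OF refl]) (use zR in \<open>simp add: profile_def algebra_simps\<close>)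
  \<comment> \<open>One 433 bounds the block itself. The other bounds the correction, because
    \<open>outer N 0 / inner N (8 * N)\<close> is at most 1.\<close>
  also have "norm \<dots> \<le> 433 * \<beta> * norm z ^ N + 433 * \<beta> * norm z ^ N"
  proof (rule order_trans[OF norm_triangle_ineq add_mono])
    have "norm z ^ (4 * N) \<le> norm z ^ N" using z by (intro power_decreasing) auto
    then show "norm (tent_block N b z) \<le> 433 * \<beta> * norm z ^ N"
      using tent_block_bound[OF b N, of z] by (simp add: max_def split: if_splits)
    have "norm (\<integral>\<zeta>. g \<zeta> \<partial>W) \<le> (\<integral>\<zeta>. 433 * \<beta> * norm z ^ N * (norm \<zeta> ^ 0 * indicator {radius N<..} (norm \<zeta>)) \<partial>W)"
    proof (rule Bochner_Integration.integral_norm_bound_integral[OF gi])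
      show "integrable W (\<lambda>\<zeta>. 433 * \<beta> * norm z ^ N * (norm \<zeta> ^ 0 * indicator {radius N<..} (norm \<zeta>)))"
        by (intro Bochner_Integration.integrable_mult_right integrable_outer)
      fix \<zeta> assume "\<zeta> \<in> space W"
      then have \<zeta>: "norm \<zeta> < 1" by simp
      define w where "w = complex_of_real ((norm \<zeta>)\<^sup>2) / cnj z"
      have nw: "norm z * norm w = (norm \<zeta>)\<^sup>2" using z0 by (simp add: w_def norm_divide norm_power)
      \<comment> \<open>Here |z| |w| = |\<zeta>|^2 < 1: up to degree 4N the factor |z|^(8N) absorbs
        the growth of |w|^m and still leaves at least |z|^(4N).\<close>
      have "norm z ^ (8 * N) * norm w ^ m \<le> norm z ^ N" if "m \<le> 4 * N" for m
      proof -
        have "norm z ^ (8 * N) = norm z ^ (8 * N - m) * norm z ^ m" using that by (simp flip: power_add)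
        then have "norm z ^ (8 * N) * norm w ^ m = norm z ^ (8 * N - m) * ((norm \<zeta>)\<^sup>2) ^ m"
          by (simp add: nw[symmetric] power_mult_distrib)
        also have "\<dots> \<le> norm z ^ N * 1"
          using that z \<zeta> by (intro mult_mono power_decreasing power_le_one) auto
        finally show ?thesis by simp
      qed
      from this[of N] this[of "4 * N"]
      have mx: "norm z ^ (8 * N) * max (norm w ^ N) (norm w ^ (4 * N)) \<le> norm z ^ N"
        by (simp add: max_def)
      have "norm z ^ (8 * N) * norm (tent_block N b w) \<le> norm z ^ (8 * N) * (433 * \<beta> * max (norm w ^ N) (norm w ^ (4 * N)))"
        by (intro mult_left_mono tent_block_bound[OF b N]) auto
      also have "\<dots> = 433 * \<beta> * (norm z ^ (8 * N) * max (norm w ^ N) (norm w ^ (4 * N)))"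
        by (simp only: mult_ac)
      also have "\<dots> \<le> 433 * \<beta> * norm z ^ N"
        using \<beta> by (intro mult_left_mono mx) auto
      finally show "norm (g \<zeta>) \<le> 433 * \<beta> * norm z ^ N * (norm \<zeta> ^ 0 * indicator {radius N<..} (norm \<zeta>))"
        by (auto simp: g_def norm_mult norm_power w_def indicator_def)
    qed
    also have "\<dots> = 433 * \<beta> * norm z ^ N * outer N 0"
      unfolding outer_def by (rule Bochner_Integration.integral_mult_right_zero)
    finally have "norm (\<integral>\<zeta>. g \<zeta> \<partial>W) / inner N (8 * N) \<le> 433 * \<beta> * norm z ^ N * outer N 0 / inner N (8 * N)"
      by (rule divide_right_mono) (rule inner_nonneg)
    also have "\<dots> = 433 * \<beta> * norm z ^ N * (outer N 0 / inner N (8 * N))" by simp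
    also have "\<dots> \<le> 433 * \<beta> * norm z ^ N * 1"
      using \<beta> by (intro mult_left_mono quotient_le_1 N) auto
    finally show "norm ((\<integral>\<zeta>. g \<zeta> \<partial>W) / complex_of_real (inner N (8 * N))) \<le> 433 * \<beta> * norm z ^ N"
      using inner_nonneg[of N "8 * N"] by (simp add: norm_divide)
  qed
  finally show ?thesis using zR by simp
qed

end

section \<open>The dyadic tents as a partition of unity\<close>

text \<open>Tannery's theorem in the special case where the majorant holds for all indices at
  once.\<close>

lemma tendsto_suminf_uniform:
  fixes a :: "nat \<Rightarrow> 'b \<Rightarrow> 'a :: {real_normed_algebra, banach}"
  assumes "\<And>k. ((\<lambda>n. a k n) \<longlongrightarrow> b k) F" "eventually (\<lambda>n. \<forall>k. norm (a k n) \<le> M k) F"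
    "summable M" "F \<noteq> bot"
  shows "((\<lambda>n. \<Sum>k. a k n) \<longlongrightarrow> (\<Sum>k. b k)) F"
proof -
  have "eventually (\<lambda>(k::nat, n). \<forall>k. norm (a k n) \<le> M k) (at_top \<times>\<^sub>F F)"
    using assms(2) by (subst eventually_prod2) auto
  then have "eventually (\<lambda>(k, n). norm (a k n) \<le> M k) (at_top \<times>\<^sub>F F)"
    by (rule eventually_mono) auto
  from tannerys_theorem[OF assms(1) this assms(3,4)] show ?thesis by blast
qed

text \<open>If 2^j \<le> n div 2 < 2^(j+1), then only the tents of index j and j + 1 can be nonzero
  at n, and the falling side of the first meets the rising side of the second.\<close>

lemma tent_partition:
  "(\<lambda>k. tent (2 ^ k) n) sums (if n < 2 then 0 else 1)"
proof (cases "n < 2")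
  case True
  have "n \<le> 2 ^ k" for k using True one_le_power[of "2::nat" k] by linarith
  then have "(\<lambda>k. tent (2 ^ k) n) = (\<lambda>_. 0)" by (auto simp: tent_eq_0)
  then show ?thesis using True by simp
next
  case False
  then have "1 \<le> n div 2" by linarith
  then obtain j where "2 ^ j \<le> n div 2" "n div 2 < 2 ^ (j + 1)"
    using ex_power_ivl1[of 2 "n div 2"] by auto
  then have j: "2 * 2 ^ j \<le> n" "n < 4 * 2 ^ j" by auto
  have "tent (2 ^ k) n = 0" if "k \<notin> {j, Suc j}" for k
  proof (cases "k < j")
    case True
    then have "(2::nat) ^ Suc k \<le> 2 ^ j" by (intro power_increasing) auto
    then show ?thesis using j by (intro tent_eq_0) auto
  next
    case False
    then have "Suc (Suc j) \<le> k" using that by auto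
    then have "(2::nat) ^ Suc (Suc j) \<le> 2 ^ k" by (intro power_increasing) auto
    then show ?thesis using j by (intro tent_eq_0) auto
  qed
  then have "(\<lambda>k. tent (2 ^ k) n) sums (\<Sum>k\<in>{j, Suc j}. tent (2 ^ k) n)"
    by (intro sums_finite) auto
  moreover have "(\<Sum>k\<in>{j, Suc j}. tent (2 ^ k) n) = 1"
  proof -
    define m :: real where "m = 2 ^ j"
    have m: "0 < m" "2 * m \<le> real n" "real n \<le> 4 * m"
      using j unfolding m_def by (simp_all flip: of_nat_le_iff[where 'a=real] of_nat_less_iff[where 'a=real])
    have "tent (2 ^ j) n = 2 - real n / (2 * m)" "tent (2 ^ Suc j) n = real n / (2 * m) - 1"
      using m by (auto simp: tent_def m_def[symmetric] min_def max_def field_simps)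
    then show ?thesis by simp
  qed
  ultimately show ?thesis using False by simp
qed

lemma sum_tent_le_1: "(\<Sum>k<K. tent (2 ^ k) n) \<le> 1"
proof -
  have "(\<Sum>k<K. tent (2 ^ k) n) \<le> (\<Sum>k. tent (2 ^ k) n)"
    using tent_partition[of n] by (intro sum_le_suminf) (auto simp: tent_nonneg sums_iff)
  also have "\<dots> \<le> 1" using tent_partition[of n] by (auto simp: sums_iff split: if_splits)
  finally show ?thesis .
qed

lemma tent_blocks_tendsto:
  assumes "summable (\<lambda>n. norm (a n))"
  shows "(\<lambda>K. \<Sum>k<K. \<Sum>n<Suc (4 * 2 ^ k). complex_of_real (tent (2 ^ k) n) * a n)
    \<longlonglongrightarrow> (\<Sum>n. if n < 2 then 0 else a n)"
proof -
  have fin: "(\<Sum>n<Suc (4 * 2 ^ k). complex_of_real (tent (2 ^ k) n) * a n) =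
    (\<Sum>n. complex_of_real (tent (2 ^ k) n) * a n)" for k
    by (rule suminf_finite[symmetric]) (auto simp: tent_eq_0)
  have sm: "summable (\<lambda>n. complex_of_real (tent (2 ^ k) n) * a n)" for k
    by (rule summable_finite[of "{..<Suc (4 * 2 ^ k)}"]) (auto simp: tent_eq_0)
  have "(\<Sum>k<K. \<Sum>n<Suc (4 * 2 ^ k). complex_of_real (tent (2 ^ k) n) * a n)
    = (\<Sum>n. complex_of_real (\<Sum>k<K. tent (2 ^ k) n) * a n)" for K
    unfolding fin by (subst suminf_sum[symmetric]) (auto simp: sm sum_distrib_right)
  moreover have "(\<lambda>K. \<Sum>n. complex_of_real (\<Sum>k<K. tent (2 ^ k) n) * a n) \<longlonglongrightarrow> (\<Sum>n. if n < 2 then 0 else a n)"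
  proof (rule tendsto_suminf_uniform[OF _ _ assms])
    fix n
    have "(\<lambda>K. complex_of_real (\<Sum>k<K. tent (2 ^ k) n) * a n) \<longlonglongrightarrow> complex_of_real (if n < 2 then 0 else 1) * a n"
      using tent_partition[of n] unfolding sums_def by (intro tendsto_intros)
    then show "(\<lambda>K. complex_of_real (\<Sum>k<K. tent (2 ^ k) n) * a n) \<longlonglongrightarrow> (if n < 2 then 0 else a n)"
      by (simp split: if_splits)
  next
    have "norm (complex_of_real (\<Sum>k<K. tent (2 ^ k) n) * a n) \<le> norm (a n)" for K n
    proof -
      have "norm (complex_of_real (\<Sum>k<K. tent (2 ^ k) n)) \<le> 1"
        using sum_tent_le_1[where K=K and n=n] by (simp only: norm_of_real) (simp add: sum_nonneg tent_nonneg)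
      then show ?thesis unfolding norm_mult by (intro mult_left_le_one_le) auto
    qed
    then show "\<forall>\<^sub>F K in sequentially. \<forall>n. norm (complex_of_real (\<Sum>k<K. tent (2 ^ k) n) * a n) \<le> norm (a n)"
      by simp
  qed simp
  ultimately show ?thesis by simp
qed

section \<open>Summation of the cutoffs\<close>

context split_weight
begin

text \<open>The majorant of the k-th bounded block, up to the factor
  \<open>866 * \<beta>\<close>.\<close>

definition cutoff :: "nat \<Rightarrow> real \<Rightarrow> real" where
  "cutoff k r = r ^ (2 ^ k) * indicator {..radius (2 ^ k)} r"

lemma cutoff_nonneg: "0 \<le> r \<Longrightarrow> 0 \<le> cutoff k r"
  by (simp add: cutoff_def)

lemma cutoff_le_1: "0 \<le> r \<Longrightarrow> r < 1 \<Longrightarrow> cutoff k r \<le> 1"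
  by (auto simp: cutoff_def indicator_def power_le_one)

lemma cutoff_measurable [measurable]: "cutoff k \<in> borel_measurable borel"
  unfolding cutoff_def by measurable

text \<open>Let k0 be the first index that survives at r. Then r^(2^k0) \<le> exp (- d), and the
  term of index k0 + i is at most the 2^i-th power of this, so the geometric series with ratio exp
  (- d) dominates uniformly in r.\<close>

lemma
  assumes r: "0 \<le> r" "r < 1"
  shows summable_cutoff: "summable (\<lambda>k. cutoff k r)"
    and suminf_cutoff: "(\<Sum>k. cutoff k r) \<le> 1 / (1 - exp (- d))"
proof -
  define q where "q = exp (- d)"
  have q: "0 < q" "q < 1" using d_pos by (auto simp: q_def)
  have "summable (\<lambda>k. cutoff k r) \<and> (\<Sum>k. cutoff k r) \<le> 1 / (1 - q)"
  proof (cases "\<exists>k. r \<le> radius (2 ^ k)")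
    case False
    then have "(\<lambda>k. cutoff k r) = (\<lambda>_. 0)" by (auto simp: cutoff_def)
    then show ?thesis using q by simp
  next
    case True
    define k0 where "k0 = (LEAST k. r \<le> radius (2 ^ k))"
    have k0: "r \<le> radius (2 ^ k0)" unfolding k0_def using True by (metis (mono_tags, lifting) LeastI_ex)
    have below: "cutoff k r = 0" if "k < k0" for k
      using not_less_Least[of k "\<lambda>k. r \<le> radius (2 ^ k)"] that by (auto simp: cutoff_def k0_def)
    have above: "cutoff (i + k0) r \<le> q ^ i" for i
    proof -
      have "r ^ (2 ^ k0) \<le> radius (2 ^ k0) ^ (2 ^ k0)" using k0 r by (intro power_mono)
      also have "\<dots> = exp (real (2 ^ k0) * (- d / real (2 ^ k0)))"
        by (simp only: radius_def exp_of_nat_mult)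
      also have "\<dots> = q" by (simp add: q_def)
      finally have "(r ^ (2 ^ k0)) ^ (2 ^ i) \<le> q ^ (2 ^ i)" using r by (intro power_mono) auto
      also have "\<dots> \<le> q ^ i" using q by (intro power_decreasing) (auto intro: less_imp_le[OF less_exp])
      finally have "r ^ (2 ^ (i + k0)) \<le> q ^ i" by (simp add: power_mult[symmetric] power_add mult.commute)
      then show ?thesis using q by (auto simp: cutoff_def indicator_def)
    qed
    have g: "summable (\<lambda>i. q ^ i)" "(\<Sum>i. q ^ i) = 1 / (1 - q)"
      using q by (auto simp: summable_geometric suminf_geometric)
    have s1: "summable (\<lambda>i. cutoff (i + k0) r)"
      by (rule summable_comparison_test'[OF g(1), of 0]) (use above r in \<open>auto simp: cutoff_nonneg\<close>)
    then have "(\<lambda>i. cutoff (i + k0) r) sums (\<Sum>i. cutoff (i + k0) r)" by (rule summable_sums)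
    then have "(\<lambda>k. cutoff k r) sums (\<Sum>i. cutoff (i + k0) r)"
      by (subst (asm) sums_zero_iff_shift) (rule below)
    moreover have "(\<Sum>i. cutoff (i + k0) r) \<le> 1 / (1 - q)"
      unfolding g(2)[symmetric] by (intro suminf_le above s1 g(1))
    ultimately show ?thesis by (simp add: sums_iff)
  qed
  then show "summable (\<lambda>k. cutoff k r)" "(\<Sum>k. cutoff k r) \<le> 1 / (1 - exp (- d))"
    by (auto simp: q_def)
qed

text \<open>The integrated form of \<open>suminf_cutoff\<close>. With f = |F| it bounds all block
  pairings together by the \<open>A\<^sup>1\<close> norm of F.\<close>

lemma
  fixes f :: "complex \<Rightarrow> real"
  assumes f: "integrable W f" "\<And>z. norm z < 1 \<Longrightarrow> 0 \<le> f z"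
  shows integrable_cutoff: "integrable W (\<lambda>z. f z * cutoff k (norm z))"
    and summable_integral_cutoff: "summable (\<lambda>k. \<integral>z. f z * cutoff k (norm z) \<partial>W)"
    and suminf_integral_cutoff: "(\<Sum>k. \<integral>z. f z * cutoff k (norm z) \<partial>W) \<le> (\<integral>z. f z \<partial>W) / (1 - exp (- d))"
proof -
  have fm: "f \<in> borel_measurable dA" using borel_measurable_integrable[OF f(1)] by simp
  have int: "integrable W (\<lambda>z. f z * cutoff k (norm z))" for k
  proof (rule Bochner_Integration.integrable_bound[OF f(1)])
    have "(\<lambda>z::complex. cutoff k (norm z)) \<in> borel_measurable dA"
      by (intro borel_measurable_dA) measurable
    with fm show "(\<lambda>z. f z * cutoff k (norm z)) \<in> borel_measurable W" by simp
    show "AE z in W. norm (f z * cutoff k (norm z)) \<le> norm (f z)"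
    proof (rule AE_I2)
      fix z assume "z \<in> space W"
      then have z: "norm z < 1" by simp
      then have "\<bar>cutoff k (norm z)\<bar> \<le> 1" using cutoff_nonneg cutoff_le_1 by simp
      then show "norm (f z * cutoff k (norm z)) \<le> norm (f z)"
        unfolding real_norm_def abs_mult by (intro mult_left_le) auto
    qed
  qed
  then show "integrable W (\<lambda>z. f z * cutoff k (norm z))" .
  have nn: "0 \<le> (\<integral>z. f z * cutoff k (norm z) \<partial>W)" for k
  proof (rule Bochner_Integration.integral_nonneg_AE[OF AE_I2])
    fix z assume "z \<in> space W"
    then have "0 \<le> f z" by (intro f(2)) simp
    then show "0 \<le> f z * cutoff k (norm z)" using cutoff_nonneg by simp
  qed
  have part: "(\<Sum>k<K. \<integral>z. f z * cutoff k (norm z) \<partial>W) \<le> (\<integral>z. f z \<partial>W) / (1 - exp (- d))" for K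
  proof -
    have "(\<Sum>k<K. \<integral>z. f z * cutoff k (norm z) \<partial>W) = (\<integral>z. (\<Sum>k<K. f z * cutoff k (norm z)) \<partial>W)"
      by (rule Bochner_Integration.integral_sum[symmetric]) (rule int)
    also have "\<dots> \<le> (\<integral>z. f z * (1 / (1 - exp (- d))) \<partial>W)"
    proof (rule integral_mono)
      fix z assume "z \<in> space W"
      then have z: "norm z < 1" by simp
      have "(\<Sum>k<K. cutoff k (norm z)) \<le> (\<Sum>k. cutoff k (norm z))"
        using z by (intro sum_le_suminf summable_cutoff) (auto simp: cutoff_nonneg)
      also have "\<dots> \<le> 1 / (1 - exp (- d))" using z by (intro suminf_cutoff) auto
      finally show "(\<Sum>k<K. f z * cutoff k (norm z)) \<le> f z * (1 / (1 - exp (- d)))"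
        unfolding sum_distrib_left[symmetric] using f(2)[OF z] by (intro mult_left_mono)
    qed (auto intro!: Bochner_Integration.integrable_sum int f(1))
    finally show ?thesis by simp
  qed
  show "summable (\<lambda>k. \<integral>z. f z * cutoff k (norm z) \<partial>W)"
    by (rule summableI_nonneg_bounded[OF nn part])
  then show "(\<Sum>k. \<integral>z. f z * cutoff k (norm z) \<partial>W) \<le> (\<integral>z. f z \<partial>W) / (1 - exp (- d))"
    by (rule suminf_le_const) (rule part)
qed

text \<open>Here the powers carry no cutoff. The split condition bounds the outer part of each
  integral by the inner part, so the cutoff costs only a factor 2.\<close>

lemma summable_norm_power_moments: "summable (\<lambda>k. \<integral>z. norm z ^ (2 ^ k) \<partial>W)"
proof (rule summable_comparison_test'[where N=0])
  have one: "integrable W (\<lambda>_. 1 :: real)"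
    by (rule integrable_W_bounded[where B=1]) (auto intro!: borel_measurable_dA)
  show "summable (\<lambda>k. 2 * (\<integral>z. 1 * cutoff k (norm z) \<partial>W))"
    by (intro summable_mult summable_integral_cutoff one) simp
  fix k
  let ?N = "2 ^ k :: nat"
  have "(\<integral>z. norm z ^ ?N \<partial>W) = inner ?N ?N + outer ?N ?N" by (simp only: inner_outer)
  also have "\<dots> \<le> inner ?N ?N + inner ?N (8 * ?N)"
    using outer_antimono[of ?N ?N] outer_le_inner[of ?N] by simp
  also have "inner ?N (8 * ?N) \<le> inner ?N ?N"
    unfolding inner_def
    by (rule integral_mono[OF integrable_inner integrable_inner]) (auto simp: indicator_def intro!: power_decreasing)
  finally have "(\<integral>z. norm z ^ ?N \<partial>W) \<le> 2 * inner ?N ?N" by simp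
  then show "norm (\<integral>z. norm z ^ ?N \<partial>W) \<le> 2 * (\<integral>z. 1 * cutoff k (norm z) \<partial>W)"
    by (simp add: inner_def cutoff_def)
qed

end

section \<open>Pairings of dilated functions as diagonal series\<close>

lemma (in weighted_disc)
  fixes g :: "complex \<Rightarrow> complex" and c :: "nat \<Rightarrow> complex"
  assumes c: "summable (\<lambda>m. norm (c m))" and g: "integrable W g"
    and F: "\<And>z. norm z < 1 \<Longrightarrow> (\<lambda>m. c m * z ^ m) sums F z"
  shows integrable_series_times: "integrable W (\<lambda>z. F z * g z)"
    and sums_integral_series_times: "(\<lambda>m. c m * (\<integral>z. z ^ m * g z \<partial>W)) sums (\<integral>z. F z * g z \<partial>W)"
proof -
  define h where "h z = (if norm z > 1 then 0 else g z)" for z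
  have h: "integrable W h"
    using g by (rule Bochner_Integration.integrable_cong[THEN iffD1, rotated -1]) (auto simp: h_def)
  have h0: "h z = 0" if "norm z > 1" for z using that by (simp add: h_def)
  have c1: "summable (\<lambda>m. norm (c m) * 1 ^ m)" using c by simp
  have eq: "(\<Sum>m. c m * z ^ m * h z) = F z * g z" if "z \<in> space W" for z
    using sums_mult2[OF F, of z "h z"] that by (simp add: sums_iff h_def)
  have "integrable W (\<lambda>z. \<Sum>m. c m * z ^ m * h z)"
    by (rule integrable_power_series_times[OF c1 _ _ h h0]) auto
  then show "integrable W (\<lambda>z. F z * g z)"
    by (rule Bochner_Integration.integrable_cong[THEN iffD1, rotated -1]) (auto simp: eq)
  have "(\<lambda>m. c m * (\<integral>z. z ^ m * h z \<partial>W)) sums (\<integral>z. (\<Sum>m. c m * z ^ m * h z) \<partial>W)"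
    by (rule sums_integral_power_series_times[OF c1 _ _ h h0]) auto
  also have "(\<integral>z. (\<Sum>m. c m * z ^ m * h z) \<partial>W) = (\<integral>z. F z * g z \<partial>W)"
    by (rule Bochner_Integration.integral_cong[OF refl eq])
  also have "(\<lambda>m. c m * (\<integral>z. z ^ m * h z \<partial>W)) = (\<lambda>m. c m * (\<integral>z. z ^ m * g z \<partial>W))"
  proof
    fix m
    have "(\<integral>z. z ^ m * h z \<partial>W) = (\<integral>z. z ^ m * g z \<partial>W)"
      by (rule Bochner_Integration.integral_cong[OF refl]) (auto simp: h_def)
    then show "c m * (\<integral>z. z ^ m * h z \<partial>W) = c m * (\<integral>z. z ^ m * g z \<partial>W)" by simp
  qed
  finally show "(\<lambda>m. c m * (\<integral>z. z ^ m * g z \<partial>W)) sums (\<integral>z. F z * g z \<partial>W)" .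
qed

lemma power_series_summable_norm:
  fixes A :: "nat \<Rightarrow> complex"
  assumes F: "\<And>z. norm z < 1 \<Longrightarrow> (\<lambda>m. A m * z ^ m) sums F z" and r: "0 \<le> r" "r < 1"
  shows "summable (\<lambda>m. norm (A m) * r ^ m)"
proof -
  define p where "p = (r + 1) / 2"
  have p: "0 \<le> p" "p < 1" "r < p" using r by (auto simp: p_def)
  have "summable (\<lambda>m. A m * complex_of_real p ^ m)"
    using F[of "complex_of_real p"] p by (auto intro: sums_summable)
  then have "summable (\<lambda>m. norm (A m * complex_of_real r ^ m))"
    by (rule powser_insidea) (use r p in simp)
  then show ?thesis using r by (simp add: norm_mult norm_power)
qed

context weighted_disc
begin

definition mass :: "nat \<Rightarrow> real" where "mass n = (\<integral>z. norm z ^ (2 * n) \<partial>W)"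

lemma mass_eq_moment: "mass n = 2 * moment \<omega> (2 * real n + 1)"
  by (simp add: mass_def integral_norm_power)

lemma integral_series_cnj_power:
  assumes F: "\<And>z. norm z < 1 \<Longrightarrow> (\<lambda>m. A m * z ^ m) sums F z" and int: "integrable W F"
  shows "(\<integral>z. F z * cnj z ^ n \<partial>W) = A n * complex_of_real (mass n)"
  using integral_series_conj_monomial[OF F, of "\<lambda>_. 1" 1 n] int by (simp add: mass_def)

text \<open>Dilation makes the Taylor coefficients of F absolutely summable. The resulting series
  contains h only through its moments, so functions with equal moments have equal dilated
  pairings.\<close>

lemma
  fixes A B :: "nat \<Rightarrow> complex"
  assumes F: "\<And>z. norm z < 1 \<Longrightarrow> (\<lambda>m. A m * z ^ m) sums F z"
    and h: "integrable W h" "\<And>n. (\<integral>z. h z * cnj z ^ n \<partial>W) = B n * complex_of_real (mass n)"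
    and r: "0 \<le> r" "r < 1"
  shows integrable_dilated_pairing: "integrable W (\<lambda>z. F (complex_of_real r * z) * cnj (h z))"
    and sums_dilated_pairing: "(\<lambda>n. A n * complex_of_real (r ^ n) * cnj (B n) * complex_of_real (mass n))
      sums (\<integral>z. F (complex_of_real r * z) * cnj (h z) \<partial>W)"
proof -
  have sm: "summable (\<lambda>m. norm (A m * complex_of_real (r ^ m)))"
    using power_series_summable_norm[OF F r] r by (simp add: norm_mult norm_power)
  have Fr: "(\<lambda>m. A m * complex_of_real (r ^ m) * z ^ m) sums F (complex_of_real r * z)" if "norm z < 1" for z
  proof -
    have "norm (complex_of_real r * z) < 1"
      using that r mult_left_le_one_le[of "norm z" r] by (simp add: norm_mult)
    from F[OF this] show ?thesis by (simp add: power_mult_distrib mult.assoc)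
  qed
  have ch: "integrable W (\<lambda>z. cnj (h z))" using h(1) by simp
  show "integrable W (\<lambda>z. F (complex_of_real r * z) * cnj (h z))"
    by (rule integrable_series_times[OF sm ch Fr])
  have "(\<integral>z. z ^ n * cnj (h z) \<partial>W) = cnj (B n) * complex_of_real (mass n)" for n
  proof -
    have "(\<integral>z. z ^ n * cnj (h z) \<partial>W) = (\<integral>z. cnj (h z * cnj z ^ n) \<partial>W)"
      by (simp add: mult.commute)
    also have "\<dots> = cnj (\<integral>z. h z * cnj z ^ n \<partial>W)" by (rule Bochner_Integration.integral_cnj)
    finally show ?thesis by (simp add: h(2))
  qed
  then show "(\<lambda>n. A n * complex_of_real (r ^ n) * cnj (B n) * complex_of_real (mass n))
      sums (\<integral>z. F (complex_of_real r * z) * cnj (h z) \<partial>W)"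
    using sums_integral_series_times[OF sm ch Fr] by (simp add: mult.assoc)
qed

end

text \<open>The dilated derivative is r h(rz), and 1 - |z|^2 \<le> 1 - |rz|^2. That \<beta> does not
  change with r is what makes the later majorants uniform in r.\<close>

lemma Bloch_coeffs_dilate:
  assumes b: "Bloch_coeffs \<beta> b" and r: "0 \<le> r" "r \<le> 1"
  shows "Bloch_coeffs \<beta> (\<lambda>n. b n * complex_of_real (r ^ n))"
proof -
  obtain h where h: "\<And>z. norm z < 1 \<Longrightarrow> (\<lambda>m. of_nat (Suc m) * b (Suc m) * z ^ m) sums h z"
    and \<beta>: "\<And>z. norm z < 1 \<Longrightarrow> norm (h z) * (1 - (norm z)\<^sup>2) \<le> \<beta>"
    using b unfolding Bloch_coeffs_def by auto
  have "(\<lambda>m. of_nat (Suc m) * (b (Suc m) * complex_of_real (r ^ Suc m)) * z ^ m) sums (complex_of_real r * h (complex_of_real r * z))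
    \<and> norm (complex_of_real r * h (complex_of_real r * z)) * (1 - (norm z)\<^sup>2) \<le> \<beta>" if z: "norm z < 1" for z
  proof
    have rz: "norm (complex_of_real r * z) \<le> norm z"
      using r by (simp add: norm_mult mult_left_le_one_le)
    then have rz1: "norm (complex_of_real r * z) < 1" using z by simp
    from sums_mult[OF h[OF rz1], of "complex_of_real r"]
    show "(\<lambda>m. of_nat (Suc m) * (b (Suc m) * complex_of_real (r ^ Suc m)) * z ^ m) sums (complex_of_real r * h (complex_of_real r * z))"
      by (simp add: power_mult_distrib mult_ac)
    have "(norm z)\<^sup>2 \<le> 1" using z by (intro power_le_one) auto
    have "norm (complex_of_real r * h (complex_of_real r * z)) * (1 - (norm z)\<^sup>2)
      \<le> norm (h (complex_of_real r * z)) * (1 - (norm (complex_of_real r * z))\<^sup>2)"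
    proof (intro mult_mono)
      show "norm (complex_of_real r * h (complex_of_real r * z)) \<le> norm (h (complex_of_real r * z))"
        using r by (simp add: norm_mult mult_left_le_one_le)
      show "1 - (norm z)\<^sup>2 \<le> 1 - (norm (complex_of_real r * z))\<^sup>2"
        using power_mono[OF rz norm_ge_zero, of 2] by simp
    qed (use \<open>(norm z)\<^sup>2 \<le> 1\<close> in auto)
    also have "\<dots> \<le> \<beta>" by (rule \<beta>[OF rz1])
    finally show "norm (complex_of_real r * h (complex_of_real r * z)) * (1 - (norm z)\<^sup>2) \<le> \<beta>" .
  qed
  then show ?thesis
    unfolding Bloch_coeffs_def
    by (intro exI[of _ "\<lambda>z. complex_of_real r * h (complex_of_real r * z)"] allI impI)
qed

section \<open>The bounded symbol of a Bloch function\<close>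

context split_weight
begin

text \<open>The coefficients enter only as products, so a dilation can be moved from one argument to
  the other.\<close>

definition block_pairing :: "nat \<Rightarrow> (nat \<Rightarrow> complex) \<Rightarrow> (nat \<Rightarrow> complex) \<Rightarrow> complex" where
  "block_pairing N A b = (\<Sum>n<Suc (4 * N). complex_of_real (tent N n) * (A n * cnj (b n) * complex_of_real (mass n)))"

lemma
  assumes F: "\<And>z. norm z < 1 \<Longrightarrow> (\<lambda>m. A m * z ^ m) sums F z" and int: "integrable W F" and N: "0 < N"
  shows integrable_cnj_bounded_block: "integrable W (\<lambda>z. F z * cnj (bounded_block N b z))"
    and integral_cnj_bounded_block: "(\<integral>z. F z * cnj (bounded_block N b z) \<partial>W) = block_pairing N A b"
proof -
  have eq: "F z * cnj (bounded_block N b z) = (\<Sum>n<Suc (4 * N). complex_of_real (tent N n) * cnj (b n) *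
      (F z * complex_of_real (profile N n (norm z)) * cnj z ^ n))" for z
    unfolding bounded_block_def cnj_sum sum_distrib_left
    by (rule sum.cong[OF refl]) (simp add: mult_ac)
  have i1: "integrable W (\<lambda>z. F z * complex_of_real (profile N n (norm z)))" for n
  proof (rule integrable_W_mult_bounded[OF int, where B=2])
    show "(\<lambda>z::complex. complex_of_real (profile N n (norm z))) \<in> borel_measurable dA"
      by (intro borel_measurable_dA) measurable
  qed (use profile_bound[OF N] in auto)
  have i2: "integrable W (\<lambda>z. F z * complex_of_real (profile N n (norm z)) * cnj z ^ n)" for n
  proof (rule integrable_W_mult_bounded[OF i1, where B=1])
    show "(\<lambda>z::complex. cnj z ^ n) \<in> borel_measurable dA"
      by (intro borel_measurable_dA) measurable
  qed (simp add: norm_power power_le_one)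
  have i3: "integrable W (\<lambda>z. complex_of_real (tent N n) * cnj (b n) * (F z * complex_of_real (profile N n (norm z)) * cnj z ^ n))" for n
    by (intro Bochner_Integration.integrable_mult_right i2)
  show "integrable W (\<lambda>z. F z * cnj (bounded_block N b z))"
    unfolding eq by (intro Bochner_Integration.integrable_sum i3)
  have "(\<integral>z. F z * cnj (bounded_block N b z) \<partial>W) = (\<Sum>n<Suc (4 * N). complex_of_real (tent N n) * cnj (b n) *
      (\<integral>z. F z * complex_of_real (profile N n (norm z)) * cnj z ^ n \<partial>W))"
    unfolding eq by (subst Bochner_Integration.integral_sum[OF i3])
      (simp only: Bochner_Integration.integral_mult_right_zero)
  also have "\<dots> = block_pairing N A b"
    unfolding block_pairing_def
  proof (rule sum.cong[OF refl])
    fix n assume n: "n \<in> {..<Suc (4 * N)}"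
    have "(\<integral>z. F z * complex_of_real (profile N n (norm z)) * cnj z ^ n \<partial>W)
      = A n * complex_of_real (\<integral>z. norm z ^ (2 * n) * profile N n (norm z) \<partial>W)"
      by (rule integral_series_conj_monomial[OF F profile_measurable profile_bound[OF N] i1])
    also have "\<dots> = A n * complex_of_real (mass n)"
      using integral_profile[OF N, of n] n by (simp add: mass_def)
    finally show "complex_of_real (tent N n) * cnj (b n) * (\<integral>z. F z * complex_of_real (profile N n (norm z)) * cnj z ^ n \<partial>W)
      = complex_of_real (tent N n) * (A n * cnj (b n) * complex_of_real (mass n))"
      by (simp add: mult_ac)
  qed
  finally show "(\<integral>z. F z * cnj (bounded_block N b z) \<partial>W) = block_pairing N A b" .
qed

lemma bounded_block_cutoff:
  assumes "Bloch_coeffs \<beta> b" "norm z < 1"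
  shows "norm (bounded_block (2 ^ k) b z) \<le> 866 * \<beta> * cutoff k (norm z)"
  using bounded_block_bound[OF assms(1) _ assms(2), of "2 ^ k"] by (simp add: cutoff_def)

lemma block_pairing_bound:
  assumes F: "\<And>z. norm z < 1 \<Longrightarrow> (\<lambda>m. A m * z ^ m) sums F z" and int: "integrable W F"
    and b: "Bloch_coeffs \<beta> b"
  shows "norm (block_pairing (2 ^ k) A b) \<le> 866 * \<beta> * (\<integral>z. norm (F z) * cutoff k (norm z) \<partial>W)"
proof -
  have "norm (\<integral>z. F z * cnj (bounded_block (2 ^ k) b z) \<partial>W) \<le> (\<integral>z. 866 * \<beta> * (norm (F z) * cutoff k (norm z)) \<partial>W)"
  proof (rule Bochner_Integration.integral_norm_bound_integral)
    show "integrable W (\<lambda>z. F z * cnj (bounded_block (2 ^ k) b z))"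
      by (rule integrable_cnj_bounded_block[OF F int]) auto
    show "integrable W (\<lambda>z. 866 * \<beta> * (norm (F z) * cutoff k (norm z)))"
      using int by (intro Bochner_Integration.integrable_mult_right integrable_cutoff) auto
    fix z assume "z \<in> space W"
    then have "norm (bounded_block (2 ^ k) b z) \<le> 866 * \<beta> * cutoff k (norm z)"
      by (intro bounded_block_cutoff b) simp
    then have "norm (F z) * norm (bounded_block (2 ^ k) b z) \<le> norm (F z) * (866 * \<beta> * cutoff k (norm z))"
      by (rule mult_left_mono) simp
    then show "norm (F z * cnj (bounded_block (2 ^ k) b z)) \<le> 866 * \<beta> * (norm (F z) * cutoff k (norm z))"
      by (simp add: norm_mult mult_ac)
  qed
  then show ?thesis
    using integral_cnj_bounded_block[OF F int, where N="2 ^ k" and b=b] by simp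
qed

text \<open>The indices 0 and 1 lie below every tent and are added by hand.\<close>

definition bounded_symbol :: "(nat \<Rightarrow> complex) \<Rightarrow> complex \<Rightarrow> complex" where
  "bounded_symbol b z = b 0 + b 1 * z + (\<Sum>k. bounded_block (2 ^ k) b z)"

lemma summable_bounded_blocks:
  assumes b: "Bloch_coeffs \<beta> b" and z: "norm z < 1"
  shows "summable (\<lambda>k. norm (bounded_block (2 ^ k) b z))"
  using bounded_block_cutoff[OF b z]
  by (intro summable_comparison_test'[OF summable_mult[OF summable_cutoff], where N=0]) (use z in auto)

lemma bounded_symbol_measurable: "bounded_symbol b \<in> borel_measurable dA"
proof -
  have "(\<lambda>z. \<Sum>k. bounded_block (2 ^ k) b z) \<in> borel_measurable dA"
    by (intro borel_measurable_suminf bounded_block_measurable)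
  moreover have "(\<lambda>z. b 0 + b 1 * z) \<in> borel_measurable dA"
    by (intro borel_measurable_dA) measurable
  ultimately show ?thesis
    unfolding bounded_symbol_def[abs_def] by (rule borel_measurable_add[rotated])
qed

lemma bounded_symbol_bound:
  assumes b: "Bloch_coeffs \<beta> b" and z: "norm z < 1"
  shows "norm (bounded_symbol b z) \<le> norm (b 0) + norm (b 1) + 866 * \<beta> / (1 - exp (- d))"
proof -
  have "norm (\<Sum>k. bounded_block (2 ^ k) b z) \<le> (\<Sum>k. norm (bounded_block (2 ^ k) b z))"
    by (rule summable_norm[OF summable_bounded_blocks[OF b z]])
  also have "\<dots> \<le> (\<Sum>k. 866 * \<beta> * cutoff k (norm z))"
    using z by (intro suminf_le bounded_block_cutoff b summable_bounded_blocks[OF b] summable_mult summable_cutoff) auto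
  also have "\<dots> = 866 * \<beta> * (\<Sum>k. cutoff k (norm z))"
    using z by (intro suminf_mult summable_cutoff) auto
  also have "\<dots> \<le> 866 * \<beta> * (1 / (1 - exp (- d)))"
    using Bloch_coeffs_nonneg[OF b] z by (intro mult_left_mono suminf_cutoff) auto
  finally have 1: "norm (\<Sum>k. bounded_block (2 ^ k) b z) \<le> 866 * \<beta> / (1 - exp (- d))" by simp
  have 2: "norm (b 1 * z) \<le> norm (b 1)" using z by (simp add: norm_mult mult_left_le)
  show ?thesis unfolding bounded_symbol_def
    by (intro order_trans[OF norm_triangle_ineq] add_mono order_refl 1 2)
qed

lemma integrable_bounded_symbol:
  assumes "Bloch_coeffs \<beta> b" shows "integrable W (bounded_symbol b)"
  by (rule integrable_W_bounded[OF bounded_symbol_measurable bounded_symbol_bound[OF assms]])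

text \<open>Integrability of F suffices for integrating block by block: the k-th integrand is at
  most \<open>866 * \<beta>\<close> times |F| times the k-th cutoff, and the integrals of these are
  summable.\<close>

lemma integral_cnj_bounded_symbol:
  assumes F: "\<And>z. norm z < 1 \<Longrightarrow> (\<lambda>m. A m * z ^ m) sums F z" and int: "integrable W F"
    and b: "Bloch_coeffs \<beta> b"
  shows "(\<lambda>k. block_pairing (2 ^ k) A b) sums ((\<integral>z. F z * cnj (bounded_symbol b z) \<partial>W)
    - (A 0 * cnj (b 0) * complex_of_real (mass 0) + A 1 * cnj (b 1) * complex_of_real (mass 1)))"
proof -
  let ?f = "\<lambda>k z. F z * cnj (bounded_block (2 ^ k) b z)"
  have bd: "norm (?f k z) \<le> 866 * \<beta> * (norm (F z) * cutoff k (norm z))" if "norm z < 1" for k z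
  proof -
    have "norm (F z) * norm (bounded_block (2 ^ k) b z) \<le> norm (F z) * (866 * \<beta> * cutoff k (norm z))"
      by (intro mult_left_mono bounded_block_cutoff b that) auto
    then show ?thesis by (simp add: norm_mult mult_ac)
  qed
  have int_k: "integrable W (?f k)" for k
    by (rule integrable_cnj_bounded_block[OF F int]) auto
  have sumn: "summable (\<lambda>k. norm (?f k z))" if "norm z < 1" for z
    using summable_mult[OF summable_bounded_blocks[OF b that], of "norm (F z)"] by (simp add: norm_mult)
  have ae: "AE z in W. summable (\<lambda>k. norm (?f k z))"
    by (rule AE_I2) (use sumn in simp)
  have nF: "integrable W (\<lambda>z. norm (F z))" using int by simp
  have sm: "summable (\<lambda>k. \<integral>z. norm (?f k z) \<partial>W)"
  proof (rule summable_comparison_test'[where N=0])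
    show "summable (\<lambda>k. 866 * \<beta> * (\<integral>z. norm (F z) * cutoff k (norm z) \<partial>W))"
      by (intro summable_mult summable_integral_cutoff nF) auto
    fix k
    have "(\<integral>z. norm (?f k z) \<partial>W) \<le> (\<integral>z. 866 * \<beta> * (norm (F z) * cutoff k (norm z)) \<partial>W)"
      by (intro integral_mono integrable_norm int_k Bochner_Integration.integrable_mult_right integrable_cutoff nF bd) auto
    then show "norm (\<integral>z. norm (?f k z) \<partial>W) \<le> 866 * \<beta> * (\<integral>z. norm (F z) * cutoff k (norm z) \<partial>W)"
      by simp
  qed
  have "(\<lambda>k. \<integral>z. ?f k z \<partial>W) sums (\<integral>z. (\<Sum>k. ?f k z) \<partial>W)"
    by (rule sums_integral[OF int_k ae sm])
  moreover have "(\<integral>z. ?f k z \<partial>W) = block_pairing (2 ^ k) A b" for k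
    by (rule integral_cnj_bounded_block[OF F int]) auto
  moreover have "(\<integral>z. (\<Sum>k. ?f k z) \<partial>W) = (\<integral>z. F z * cnj (bounded_symbol b z) \<partial>W)
    - (A 0 * cnj (b 0) * complex_of_real (mass 0) + A 1 * cnj (b 1) * complex_of_real (mass 1))"
  proof -
    have i1: "integrable W (\<lambda>z. F z * cnj (bounded_symbol b z))"
      using bounded_symbol_measurable[of b] bounded_symbol_bound[OF b]
      by (intro integrable_W_mult_bounded[OF int]) (auto intro: measurable_compose)
    have i2: "integrable W (\<lambda>z. F z * cnj z ^ n)" for n
    proof (rule integrable_W_mult_bounded[OF int, where B=1])
      show "(\<lambda>z::complex. cnj z ^ n) \<in> borel_measurable dA" by (intro borel_measurable_dA) measurable
    qed (simp add: norm_power power_le_one)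
    have "(\<integral>z. (\<Sum>k. ?f k z) \<partial>W) = (\<integral>z. F z * cnj (bounded_symbol b z) - (cnj (b 0) * (F z * cnj z ^ 0) + cnj (b 1) * (F z * cnj z ^ 1)) \<partial>W)"
    proof (rule Bochner_Integration.integral_cong[OF refl])
      fix z assume "z \<in> space W"
      then have "norm z < 1" by simp
      from summable_norm_cancel[OF summable_bounded_blocks[OF b this]]
      have "(\<lambda>k. bounded_block (2 ^ k) b z) sums (\<Sum>k. bounded_block (2 ^ k) b z)" by (rule summable_sums)
      then have "(\<lambda>k. ?f k z) sums (F z * cnj (\<Sum>k. bounded_block (2 ^ k) b z))"
        by (intro sums_mult) (simp only: sums_cnj)
      then show "(\<Sum>k. ?f k z) = F z * cnj (bounded_symbol b z) - (cnj (b 0) * (F z * cnj z ^ 0) + cnj (b 1) * (F z * cnj z ^ 1))"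
        by (simp add: sums_iff bounded_symbol_def algebra_simps)
    qed
    also have "\<dots> = (\<integral>z. F z * cnj (bounded_symbol b z) \<partial>W) - (cnj (b 0) * (\<integral>z. F z * cnj z ^ 0 \<partial>W) + cnj (b 1) * (\<integral>z. F z * cnj z ^ 1 \<partial>W))"
      by (subst Bochner_Integration.integral_diff[OF i1 Bochner_Integration.integrable_add[OF
            Bochner_Integration.integrable_mult_right[OF i2] Bochner_Integration.integrable_mult_right[OF i2]]],
          subst Bochner_Integration.integral_add[OF
            Bochner_Integration.integrable_mult_right[OF i2] Bochner_Integration.integrable_mult_right[OF i2]],
          simp only: Bochner_Integration.integral_mult_right_zero)
    moreover have c: "(\<integral>z. F z * cnj z ^ n \<partial>W) = A n * complex_of_real (mass n)" for n
      by (rule integral_series_cnj_power[OF F int])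
    ultimately show ?thesis by (simp only: c mult_ac)
  qed
  ultimately show ?thesis by simp
qed

end

section \<open>Moments of the symbol and the limit of the pairing\<close>

context split_weight
begin

text \<open>For F = z^n every block pairing is a tent value at n times one constant, so the
  partition of unity does the summation.\<close>

lemma bounded_symbol_moments:
  assumes b: "Bloch_coeffs \<beta> b"
  shows "(\<integral>z. bounded_symbol b z * cnj z ^ n \<partial>W) = b n * complex_of_real (mass n)"
proof -
  define A where "A m = (if m = n then 1 else 0 :: complex)" for m
  have A: "(\<lambda>m. A m * z ^ m) sums z ^ n" for z
  proof -
    have "(\<lambda>m. A m * z ^ m) = (\<lambda>m. if m = n then z ^ m else 0)" by (auto simp: A_def)
    then show ?thesis using sums_single[of n "\<lambda>m. z ^ m"] by simp
  qed
  have int: "integrable W (\<lambda>z. z ^ n)"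
    by (rule integrable_W_bounded[where B=1]) (auto intro!: borel_measurable_dA simp: norm_power power_le_one)
  define X where "X = cnj (b n) * complex_of_real (mass n)"
  have bp: "block_pairing (2 ^ k) A b = complex_of_real (tent (2 ^ k) n) * X" for k
  proof (cases "n < Suc (4 * 2 ^ k)")
    case True
    then have "block_pairing (2 ^ k) A b = (\<Sum>m\<in>{n}. complex_of_real (tent (2 ^ k) m) * (A m * cnj (b m) * complex_of_real (mass m)))"
      unfolding block_pairing_def by (intro sum.mono_neutral_right) (auto simp: A_def)
    then show ?thesis by (simp add: A_def X_def)
  next
    case False
    then have "block_pairing (2 ^ k) A b = 0"
      unfolding block_pairing_def by (intro sum.neutral) (auto simp: A_def)
    then show ?thesis using False by (simp add: tent_eq_0)
  qed
  have "(\<lambda>k. complex_of_real (tent (2 ^ k) n)) sums complex_of_real (if n < 2 then 0 else 1)"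
    using tent_partition[of n] by (simp only: sums_of_real_iff)
  then have 1: "(\<lambda>k. block_pairing (2 ^ k) A b) sums (complex_of_real (if n < 2 then 0 else 1) * X)"
    unfolding bp by (rule sums_mult2)
  have 2: "(\<lambda>k. block_pairing (2 ^ k) A b) sums ((\<integral>z. z ^ n * cnj (bounded_symbol b z) \<partial>W)
    - (A 0 * cnj (b 0) * complex_of_real (mass 0) + A 1 * cnj (b 1) * complex_of_real (mass 1)))"
    by (rule integral_cnj_bounded_symbol[OF A int b])
  have "(\<integral>z. z ^ n * cnj (bounded_symbol b z) \<partial>W) = complex_of_real (if n < 2 then 0 else 1) * X
      + (A 0 * cnj (b 0) * complex_of_real (mass 0) + A 1 * cnj (b 1) * complex_of_real (mass 1))"
    using sums_unique2[OF 1 2] by (simp add: algebra_simps)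
  also have "\<dots> = X"
  proof -
    consider "n = 0" | "n = 1" | "n \<ge> 2" by linarith
    then show ?thesis by cases (auto simp: A_def X_def)
  qed
  finally have e: "(\<integral>z. z ^ n * cnj (bounded_symbol b z) \<partial>W) = X" .
  have "(\<integral>z. bounded_symbol b z * cnj z ^ n \<partial>W) = (\<integral>z. cnj (z ^ n * cnj (bounded_symbol b z)) \<partial>W)"
    by (simp add: mult.commute)
  also have "\<dots> = cnj X" unfolding Bochner_Integration.integral_cnj e ..
  finally show ?thesis by (simp add: X_def)
qed

text \<open>The k-th block of g is at most \<open>433 * \<beta>\<close> times |z|^(2^k), so |g| is
  dominated by a constant plus a multiple of the sum of these powers. For a general weight such
  integrability may fail.\<close>

lemma integrable_Bloch:
  assumes b: "Bloch_coeffs \<beta> b" and g: "\<And>z. norm z < 1 \<Longrightarrow> (\<lambda>n. b n * z ^ n) sums g z"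
  shows "integrable W g"
proof -
  define \<psi> where "\<psi> z = (\<Sum>k. norm z ^ (2 ^ k))" for z :: complex
  have sm: "summable (\<lambda>k. norm z ^ (2 ^ k))" if "norm z < 1" for z :: complex
  proof (rule summable_comparison_test'[where N=0])
    show "summable (\<lambda>k. norm z ^ k)" using that by (intro summable_geometric) auto
    show "norm (norm z ^ (2 ^ k)) \<le> norm z ^ k" for k
      using that by (auto simp: norm_power intro!: power_decreasing less_imp_le[OF less_exp])
  qed
  have ip: "integrable W (\<lambda>z. norm z ^ n)" for n
    by (rule integrable_radial[where B=1]) (auto simp: power_le_one)
  have \<psi>: "integrable W \<psi>"
    unfolding \<psi>_def
  proof (rule integrable_suminf[OF ip])
    show "AE z in W. summable (\<lambda>k. norm (norm z ^ (2 ^ k)))"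
      by (rule AE_I2) (use sm in \<open>simp add: norm_power\<close>)
    show "summable (\<lambda>k. \<integral>z. norm (norm z ^ (2 ^ k)) \<partial>W)"
      using summable_norm_power_moments by (simp add: norm_power)
  qed
  have one: "integrable W (\<lambda>_. 1 :: real)"
    by (rule integrable_W_bounded[where B=1]) (auto intro!: borel_measurable_dA)
  have bound: "norm (g z) \<le> (norm (b 0) + norm (b 1)) * 1 + 433 * \<beta> * \<psi> z" if z: "norm z < 1" for z
  proof -
    have ab: "summable (\<lambda>n. norm (b n * z ^ n))"
      using power_series_summable_norm[OF g, of "norm z"] z by (simp add: norm_mult norm_power)
    have lim: "(\<lambda>K. \<Sum>k<K. tent_block (2 ^ k) b z) \<longlonglongrightarrow> (\<Sum>n. if n < 2 then 0 else b n * z ^ n)"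
      using tent_blocks_tendsto[OF ab] by (simp only: tent_block_def mult.assoc)
    have gz: "g z = b 0 + b 1 * z + (\<Sum>n. if n < 2 then 0 else b n * z ^ n)"
    proof -
      have "(\<lambda>n. if n \<in> {0, 1} then b n * z ^ n else 0) sums (\<Sum>n\<in>{0, 1}. b n * z ^ n)"
        by (rule sums_If_finite_set) simp
      from sums_diff[OF g[OF z] this]
      have "(\<lambda>n. b n * z ^ n - (if n \<in> {0, 1} then b n * z ^ n else 0)) sums (g z - (b 0 + b 1 * z))"
        by simp
      moreover have "b n * z ^ n - (if n \<in> {0, 1} then b n * z ^ n else 0) = (if n < 2 then 0 else b n * z ^ n)" for n
        by auto
      ultimately have "(\<lambda>n. if n < 2 then 0 else b n * z ^ n) sums (g z - (b 0 + b 1 * z))"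
        by (simp only:)
      then show ?thesis by (simp add: sums_iff)
    qed
    have "norm (\<Sum>n. if n < 2 then 0 else b n * z ^ n) \<le> 433 * \<beta> * \<psi> z"
    proof (rule LIMSEQ_le_const2[OF tendsto_norm[OF lim]], intro exI allI impI)
      fix K :: nat
      have "norm (\<Sum>k<K. tent_block (2 ^ k) b z) \<le> (\<Sum>k<K. 433 * \<beta> * norm z ^ (2 ^ k))"
      proof (rule sum_norm_le)
        fix k
        have "norm z ^ (4 * 2 ^ k) \<le> norm z ^ (2 ^ k)" using z by (intro power_decreasing) auto
        then show "norm (tent_block (2 ^ k) b z) \<le> 433 * \<beta> * norm z ^ (2 ^ k)"
          using tent_block_bound[OF b, of "2 ^ k" z] by (simp add: max_def split: if_splits)
      qed
      also have "\<dots> = 433 * \<beta> * (\<Sum>k<K. norm z ^ (2 ^ k))" by (rule sum_distrib_left[symmetric])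
      also have "\<dots> \<le> 433 * \<beta> * \<psi> z"
        unfolding \<psi>_def using Bloch_coeffs_nonneg[OF b] z
        by (intro mult_left_mono sum_le_suminf sm) auto
      finally show "norm (\<Sum>k<K. tent_block (2 ^ k) b z) \<le> 433 * \<beta> * \<psi> z" .
    qed
    moreover have "norm (b 1 * z) \<le> norm (b 1)" using z by (simp add: norm_mult mult_left_le)
    ultimately show ?thesis
      unfolding gz by (auto intro!: order_trans[OF norm_triangle_ineq] add_mono)
  qed
  show ?thesis
  proof (rule Bochner_Integration.integrable_bound)
    show "integrable W (\<lambda>z. (norm (b 0) + norm (b 1)) * 1 + 433 * \<beta> * \<psi> z)"
      by (intro Bochner_Integration.integrable_add Bochner_Integration.integrable_mult_right one \<psi>)
    show "g \<in> borel_measurable W" using series_borel_measurable_dA[OF g] by simp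
    show "AE z in W. norm (g z) \<le> norm ((norm (b 0) + norm (b 1)) * 1 + 433 * \<beta> * \<psi> z)"
    proof (rule AE_I2)
      fix z assume "z \<in> space W"
      then have "norm (g z) \<le> (norm (b 0) + norm (b 1)) * 1 + 433 * \<beta> * \<psi> z" by (intro bound) simp
      then show "norm (g z) \<le> norm ((norm (b 0) + norm (b 1)) * 1 + 433 * \<beta> * \<psi> z)"
        unfolding real_norm_def by (rule order_trans[OF _ abs_ge_self])
    qed
  qed
qed

text \<open>For r < 1 the function g may be replaced by its bounded symbol. This gives two terms
  from the indices 0 and 1 plus a series of block pairings, each a polynomial in r. Moving the
  dilation from F to the Bloch side bounds the k-th one by \<open>M k\<close> for all r, so the
  limit may be taken termwise and the bound is read off at r = 1.\<close>

lemma pairing_limit: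
  assumes F: "\<And>z. norm z < 1 \<Longrightarrow> (\<lambda>n. A n * z ^ n) sums F z" "integrable W F"
    and b: "Bloch_coeffs \<beta> b" and g: "\<And>z. norm z < 1 \<Longrightarrow> (\<lambda>n. b n * z ^ n) sums g z"
  obtains L where "((\<lambda>r. \<integral>z. F (complex_of_real r * z) * cnj (g z) \<partial>W) \<longlongrightarrow> L) (at_left 1)"
    "norm L \<le> (norm (b 0) + norm (b 1) + 866 * \<beta> / (1 - exp (- d))) * (\<integral>z. norm (F z) \<partial>W)"
proof -
  define L0 where "L0 r = A 0 * cnj (b 0) * complex_of_real (mass 0)
    + complex_of_real r * (A 1 * cnj (b 1) * complex_of_real (mass 1))" for r
  define s where "s k r = block_pairing (2 ^ k) (\<lambda>n. A n * complex_of_real (r ^ n)) b" for k r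
  define M where "M k = 866 * \<beta> * (\<integral>z. norm (F z) * cutoff k (norm z) \<partial>W)" for k
  have nF: "integrable W (\<lambda>z. norm (F z))" using F(2) by simp
  have M: "summable M" unfolding M_def by (intro summable_mult summable_integral_cutoff nF) auto
  have sM: "norm (s k r) \<le> M k" if "0 \<le> r" "r \<le> 1" for k r
  proof -
    have "s k r = block_pairing (2 ^ k) A (\<lambda>n. b n * complex_of_real (r ^ n))"
      unfolding s_def block_pairing_def by (rule sum.cong[OF refl]) (simp add: mult_ac)
    then show ?thesis
      using block_pairing_bound[OF F Bloch_coeffs_dilate[OF b that]] by (simp add: M_def)
  qed
  have I: "(\<integral>z. F (complex_of_real r * z) * cnj (g z) \<partial>W) = L0 r + (\<Sum>k. s k r)" if r: "0 < r" "r < 1" for r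
  proof -
    define Fr where "Fr z = F (complex_of_real r * z)" for z
    define Ar where "Ar n = A n * complex_of_real (r ^ n)" for n
    have Fr: "(\<lambda>n. Ar n * z ^ n) sums Fr z" if "norm z < 1" for z
    proof -
      have "norm (complex_of_real r * z) < 1"
        using that r mult_left_le_one_le[of "norm z" r] by (simp add: norm_mult)
      from F(1)[OF this] show ?thesis by (simp add: power_mult_distrib mult.assoc Fr_def Ar_def)
    qed
    have cg: "(\<integral>z. g z * cnj z ^ n \<partial>W) = b n * complex_of_real (mass n)" for n
      by (rule integral_series_cnj_power[OF g integrable_Bloch[OF b g]])
    have r0: "0 \<le> r" using r by simp
    have "(\<integral>z. Fr z * cnj (g z) \<partial>W) = (\<integral>z. Fr z * cnj (bounded_symbol b z) \<partial>W)"
      unfolding Fr_def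
      using sums_dilated_pairing[OF F(1) integrable_Bloch[OF b g] cg r0 r(2)]
        sums_dilated_pairing[OF F(1) integrable_bounded_symbol[OF b] bounded_symbol_moments[OF b] r0 r(2)]
      by (rule sums_unique2)
    also have "\<dots> = L0 r + (\<Sum>k. s k r)"
    proof -
      have "integrable W Fr"
      proof -
        have sm: "summable (\<lambda>m. norm (Ar m))"
          using power_series_summable_norm[OF F(1) r0 r(2)] r by (simp add: norm_mult norm_power Ar_def)
        have "integrable W (\<lambda>_. 1 :: complex)"
          by (rule integrable_W_bounded[where B=1]) (auto intro!: borel_measurable_dA)
        from integrable_series_times[OF sm this Fr] show ?thesis by simp
      qed
      from integral_cnj_bounded_symbol[OF Fr this b] show ?thesis
        by (simp add: sums_iff s_def L0_def Ar_def mult_ac)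
    qed
    finally show ?thesis by (simp add: Fr_def)
  qed
  have ev: "eventually (\<lambda>r::real. 0 < r \<and> r < 1) (at_left 1)"
    using eventually_at_left_real[of 0 1] by (auto elim: eventually_mono)
  have lim1: "((\<lambda>r. L0 r + (\<Sum>k. s k r)) \<longlongrightarrow> L0 1 + (\<Sum>k. s k 1)) (at_left 1)"
  proof (intro tendsto_add)
    show "(L0 \<longlongrightarrow> L0 1) (at_left 1)" unfolding L0_def by (intro tendsto_intros)
    show "((\<lambda>r. \<Sum>k. s k r) \<longlongrightarrow> (\<Sum>k. s k 1)) (at_left 1)"
    proof (rule tendsto_suminf_uniform[OF _ _ M])
      show "(s k \<longlongrightarrow> s k 1) (at_left 1)" for k
        unfolding s_def block_pairing_def by (intro tendsto_intros)
      show "\<forall>\<^sub>F r in at_left 1. \<forall>k. norm (s k r) \<le> M k"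
        using ev by eventually_elim (auto intro!: sM)
    qed simp
  qed
  have eveq: "\<forall>\<^sub>F r in at_left 1. (\<integral>z. F (complex_of_real r * z) * cnj (g z) \<partial>W) = L0 r + (\<Sum>k. s k r)"
    using ev by eventually_elim (auto intro!: I)
  have lim: "((\<lambda>r. \<integral>z. F (complex_of_real r * z) * cnj (g z) \<partial>W) \<longlongrightarrow> L0 1 + (\<Sum>k. s k 1)) (at_left 1)"
    by (rule tendsto_cong[OF eveq, THEN iffD2, OF lim1])
  have An: "norm (A n * complex_of_real (mass n)) \<le> (\<integral>z. norm (F z) \<partial>W)" for n
  proof -
    have "norm (\<integral>z. F z * cnj z ^ n \<partial>W) \<le> (\<integral>z. norm (F z) \<partial>W)"
    proof (rule Bochner_Integration.integral_norm_bound_integral[OF _ nF])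
      show "integrable W (\<lambda>z. F z * cnj z ^ n)"
      proof (rule integrable_W_mult_bounded[OF F(2), where B=1])
        show "(\<lambda>z::complex. cnj z ^ n) \<in> borel_measurable dA" by (intro borel_measurable_dA) measurable
      qed (simp add: norm_power power_le_one)
    qed (auto simp: norm_mult norm_power mult_left_le power_le_one)
    then show ?thesis using integral_series_cnj_power[OF F] by simp
  qed
  have An': "norm (A n * cnj (b n) * complex_of_real (mass n)) \<le> norm (b n) * (\<integral>z. norm (F z) \<partial>W)" for n
    using mult_left_mono[OF An[of n] norm_ge_zero[of "b n"]] by (simp add: norm_mult mult_ac)
  have "norm (\<Sum>k. s k 1) \<le> (\<Sum>k. M k)"
    using sM[of 1] by (intro norm_suminf_le M) auto
  also have "\<dots> = 866 * \<beta> * (\<Sum>k. \<integral>z. norm (F z) * cutoff k (norm z) \<partial>W)"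
    unfolding M_def by (intro suminf_mult summable_integral_cutoff nF) auto
  also have "\<dots> \<le> 866 * \<beta> * ((\<integral>z. norm (F z) \<partial>W) / (1 - exp (- d)))"
    using Bloch_coeffs_nonneg[OF b] by (intro mult_left_mono suminf_integral_cutoff nF) auto
  finally have S: "norm (\<Sum>k. s k 1) \<le> 866 * \<beta> / (1 - exp (- d)) * (\<integral>z. norm (F z) \<partial>W)" by simp
  have "norm (L0 1 + (\<Sum>k. s k 1)) \<le> norm (b 0) * (\<integral>z. norm (F z) \<partial>W) + norm (b 1) * (\<integral>z. norm (F z) \<partial>W)
      + 866 * \<beta> / (1 - exp (- d)) * (\<integral>z. norm (F z) \<partial>W)"
  proof (rule order_trans[OF norm_triangle_ineq add_mono[OF _ S]])
    show "norm (L0 1) \<le> norm (b 0) * (\<integral>z. norm (F z) \<partial>W) + norm (b 1) * (\<integral>z. norm (F z) \<partial>W)"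
      unfolding L0_def of_real_1 mult_1_left
      by (rule order_trans[OF norm_triangle_ineq add_mono[OF An' An']])
  qed
  then have "norm (L0 1 + (\<Sum>k. s k 1)) \<le> (norm (b 0) + norm (b 1) + 866 * \<beta> / (1 - exp (- d))) * (\<integral>z. norm (F z) \<partial>W)"
    by (simp only: distrib_right)
  with lim show thesis by (rule that)
qed

end

section \<open>Function spaces in terms of Taylor coefficients\<close>

definition taylor_coeff :: "(complex \<Rightarrow> complex) \<Rightarrow> nat \<Rightarrow> complex" where
  "taylor_coeff f n = (deriv ^^ n) f 0 / fact n"

lemma taylor_coeff_sums:
  assumes "f holomorphic_on unit_disc" "norm z < 1"
  shows "(\<lambda>n. taylor_coeff f n * z ^ n) sums f z"
  using holomorphic_power_series[OF assms(1), of z] assms(2) by (simp add: taylor_coeff_def)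

lemma taylor_coeff_deriv_sums:
  assumes "f holomorphic_on unit_disc" "norm z < 1"
  shows "(\<lambda>m. of_nat (Suc m) * taylor_coeff f (Suc m) * z ^ m) sums deriv f z"
proof -
  have "deriv f holomorphic_on unit_disc" using assms(1) by (intro holomorphic_deriv) auto
  from taylor_coeff_sums[OF this assms(2)]
  have "(\<lambda>m. taylor_coeff (deriv f) m * z ^ m) sums deriv f z" .
  moreover have "taylor_coeff (deriv f) m = of_nat (Suc m) * taylor_coeff f (Suc m)" for m
  proof -
    have "(deriv ^^ Suc m) f 0 = (deriv ^^ m) (deriv f) 0" by (simp only: funpow_Suc_right o_apply)
    then show ?thesis by (simp add: taylor_coeff_def del: funpow.simps of_nat_Suc)
  qed
  ultimately show ?thesis by simp
qed

lemma Bloch_deriv_le: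
  assumes "f \<in> Bloch_space" "norm z < 1"
  shows "norm (deriv f z) * (1 - (norm z)\<^sup>2) + norm (f 0) \<le> Bloch_norm f"
proof -
  have "norm (deriv f z) * (1 - (norm z)\<^sup>2) \<le> (SUP z\<in>unit_disc. norm (deriv f z) * (1 - (norm z)\<^sup>2))"
    using assms by (intro cSUP_upper) (auto simp: Bloch_space_def)
  then show ?thesis by (simp add: Bloch_norm_def)
qed

lemma Bloch_norm_le:
  assumes "\<And>z. norm z < 1 \<Longrightarrow> norm (deriv f z) * (1 - (norm z)\<^sup>2) \<le> B"
  shows "Bloch_norm f \<le> B + norm (f 0)"
  unfolding Bloch_norm_def by (intro add_right_mono cSUP_least) (use assms in auto)

lemma
  assumes f: "f \<in> Bloch_space"
  shows Bloch_space_coeffs: "Bloch_coeffs (Bloch_norm f) (taylor_coeff f)"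
    and Bloch_taylor_0: "norm (taylor_coeff f 0) \<le> Bloch_norm f"
    and Bloch_taylor_1: "norm (taylor_coeff f 1) \<le> Bloch_norm f"
proof -
  have h: "f holomorphic_on unit_disc" using f by (simp add: Bloch_space_def)
  show "Bloch_coeffs (Bloch_norm f) (taylor_coeff f)"
    unfolding Bloch_coeffs_def
  proof (intro exI[of _ "deriv f"] allI impI conjI)
    fix z :: complex assume z: "norm z < 1"
    show "(\<lambda>m. of_nat (Suc m) * taylor_coeff f (Suc m) * z ^ m) sums deriv f z"
      by (rule taylor_coeff_deriv_sums[OF h z])
    show "norm (deriv f z) * (1 - (norm z)\<^sup>2) \<le> Bloch_norm f"
      using Bloch_deriv_le[OF f z] norm_ge_zero[of "f 0"] by linarith
  qed
  have "norm (deriv f 0) + norm (f 0) \<le> Bloch_norm f"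
    using Bloch_deriv_le[OF f, of 0] by simp
  then have "norm (f 0) \<le> Bloch_norm f" "norm (deriv f 0) \<le> Bloch_norm f"
    using norm_ge_zero[of "f 0"] norm_ge_zero[of "deriv f 0"] by linarith+
  then show "norm (taylor_coeff f 0) \<le> Bloch_norm f" "norm (taylor_coeff f 1) \<le> Bloch_norm f"
    by (simp_all add: taylor_coeff_def)
qed

text \<open>The filter is uniform in the argument, so one radius s gives the bound 1 on the outer
  annulus; continuity of the derivative handles the compact disc \<open>cball 0 s\<close>.\<close>

lemma little_Bloch_subset: "little_Bloch_space \<subseteq> Bloch_space"
proof
  fix f assume "f \<in> little_Bloch_space"
  then have h: "f holomorphic_on unit_disc"
    and lim: "((\<lambda>z. deriv f z * complex_of_real (1 - (norm z)\<^sup>2)) \<longlongrightarrow> 0) (filtercomap norm (at_left 1))"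
    by (auto simp: little_Bloch_space_def)
  have "eventually (\<lambda>z. norm (deriv f z * complex_of_real (1 - (norm z)\<^sup>2)) < 1) (filtercomap norm (at_left 1))"
    using order_tendstoD(2)[OF tendsto_norm[OF lim], of 1] by simp
  then obtain P where P: "eventually P (at_left (1::real))"
    "\<And>z. P (norm z) \<Longrightarrow> norm (deriv f z * complex_of_real (1 - (norm z)\<^sup>2)) < 1"
    unfolding eventually_filtercomap by auto
  obtain s where s: "s < 1" "\<And>y. s < y \<Longrightarrow> y < 1 \<Longrightarrow> P y"
    using P(1) unfolding eventually_at_left_field by auto
  have "deriv f holomorphic_on unit_disc" using h by (intro holomorphic_deriv) auto
  then have "continuous_on (cball 0 s) (\<lambda>z. norm (deriv f z) * (1 - (norm z)\<^sup>2))"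
    using s(1) by (intro continuous_intros holomorphic_on_imp_continuous_on) (auto intro: holomorphic_on_subset)
  then have "compact ((\<lambda>z. norm (deriv f z) * (1 - (norm z)\<^sup>2)) ` cball 0 s)"
    by (intro compact_continuous_image) auto
  then have "bdd_above ((\<lambda>z. norm (deriv f z) * (1 - (norm z)\<^sup>2)) ` cball 0 s)"
    by (intro bounded_imp_bdd_above compact_imp_bounded)
  then obtain B where B: "\<forall>z\<in>cball 0 s. norm (deriv f z) * (1 - (norm z)\<^sup>2) \<le> B"
    unfolding bdd_above_def by auto
  have "norm (deriv f z) * (1 - (norm z)\<^sup>2) \<le> max 1 B" if z: "norm z < 1" for z
  proof (cases "norm z \<le> s")
    case False
    have "(norm z)\<^sup>2 \<le> 1" using z by (intro power_le_one) auto
    then have "norm (complex_of_real (1 - (norm z)\<^sup>2)) = 1 - (norm z)\<^sup>2" by (simp only: norm_of_real)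
    then have "norm (deriv f z) * (1 - (norm z)\<^sup>2) < 1"
      using P(2)[OF s(2)[of "norm z"]] False z by (simp only: norm_mult not_le)
    then show ?thesis by simp
  qed (use B in \<open>auto intro: max.coboundedI2\<close>)
  then have "bdd_above ((\<lambda>z. norm (deriv f z) * (1 - (norm z)\<^sup>2)) ` unit_disc)"
    by (intro bdd_aboveI[of _ "max 1 B"]) auto
  with h show "f \<in> Bloch_space" by (simp add: Bloch_space_def)
qed

section \<open>The projection and the pairing in terms of the weighted measure\<close>

context weighted_disc
begin

lemma mass_pos: "0 < mass n"
  by (simp add: mass_eq_moment moment_pos)

text \<open>Prescribing the projection of h amounts to prescribing the moments of h. This reduction
  is the point where the kernel is expanded.\<close>

lemma Bergman_projection_sums:
  assumes h: "integrable W h" and z: "norm z < 1"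
  shows "(\<lambda>n. (\<integral>\<zeta>. h \<zeta> * cnj \<zeta> ^ n \<partial>W) / complex_of_real (mass n) * z ^ n) sums Bergman_projection \<omega> h z"
proof -
  define c where "c n = cnj z ^ n / complex_of_real (mass n)" for n
  have nc: "norm (c n) = norm z ^ n / moment \<omega> (2 * real n + 1) * (1 / 2)" for n
    using moment_pos[of "2 * real n + 1"] by (simp add: c_def norm_divide norm_power mass_eq_moment norm_mult)
  have c: "summable (\<lambda>n. norm (c n))"
    unfolding nc using z by (intro summable_mult2 summable_kernel) auto
  have K: "Bergman_kernel \<omega> z \<zeta> = (\<Sum>n. c n * \<zeta> ^ n)" for \<zeta>
    unfolding Bergman_kernel_def c_def mass_eq_moment by (simp add: power_mult_distrib)
  have sK: "(\<lambda>n. c n * \<zeta> ^ n) sums Bergman_kernel \<omega> z \<zeta>" if "norm \<zeta> < 1" for \<zeta>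
  proof -
    have "summable (\<lambda>n. norm (c n * \<zeta> ^ n))"
      using that by (intro summable_comparison_test'[OF c, of 0])
        (auto simp: norm_mult norm_power intro!: mult_left_le power_le_one)
    then show ?thesis unfolding K by (rule summable_sums[OF summable_norm_cancel])
  qed
  have ch: "integrable W (\<lambda>\<zeta>. cnj (h \<zeta>))" using h by simp
  have "(\<lambda>n. cnj (c n * (\<integral>\<zeta>. \<zeta> ^ n * cnj (h \<zeta>) \<partial>W))) sums cnj (\<integral>\<zeta>. Bergman_kernel \<omega> z \<zeta> * cnj (h \<zeta>) \<partial>W)"
    using sums_integral_series_times[OF c ch sK] by (simp only: sums_cnj)
  moreover have "cnj (c n * (\<integral>\<zeta>. \<zeta> ^ n * cnj (h \<zeta>) \<partial>W)) = (\<integral>\<zeta>. h \<zeta> * cnj \<zeta> ^ n \<partial>W) / complex_of_real (mass n) * z ^ n" for n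
  proof -
    have "cnj (\<integral>\<zeta>. \<zeta> ^ n * cnj (h \<zeta>) \<partial>W) = (\<integral>\<zeta>. cnj (\<zeta> ^ n * cnj (h \<zeta>)) \<partial>W)"
      by (rule Bochner_Integration.integral_cnj[symmetric])
    also have "\<dots> = (\<integral>\<zeta>. h \<zeta> * cnj \<zeta> ^ n \<partial>W)" by (simp add: mult.commute)
    finally show ?thesis by (simp add: c_def)
  qed
  moreover have "cnj (\<integral>\<zeta>. Bergman_kernel \<omega> z \<zeta> * cnj (h \<zeta>) \<partial>W) = Bergman_projection \<omega> h z"
  proof -
    have i: "integrable W (\<lambda>\<zeta>. cnj (Bergman_kernel \<omega> z \<zeta> * cnj (h \<zeta>)))"
      using integrable_series_times[OF c ch sK] by (intro integrable_cnj) auto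
    have "cnj (\<integral>\<zeta>. Bergman_kernel \<omega> z \<zeta> * cnj (h \<zeta>) \<partial>W) = (\<integral>\<zeta>. cnj (Bergman_kernel \<omega> z \<zeta> * cnj (h \<zeta>)) \<partial>W)"
      by (rule Bochner_Integration.integral_cnj[symmetric])
    also have "\<dots> = (\<integral>\<zeta>. cnj (Bergman_kernel \<omega> z \<zeta> * cnj (h \<zeta>)) * complex_of_real (\<omega> (norm \<zeta>)) \<partial>dA)"
      using borel_measurable_integrable[OF i] by (intro integral_W) (simp only: measurable_W)
    finally show ?thesis by (simp add: Bergman_projection_def mult.commute)
  qed
  ultimately show ?thesis by simp
qed

lemma
  assumes f: "f \<in> Bergman_space 1 \<omega>"
  shows Bergman_space_integrable: "integrable W f"
    and Bergman_space_norm: "weighted_Lp_norm 1 \<omega> f = (\<integral>z. norm (f z) \<partial>W)"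
    and Bergman_space_sums: "norm z < 1 \<Longrightarrow> (\<lambda>n. taylor_coeff f n * z ^ n) sums f z"
proof -
  have m: "f \<in> borel_measurable dA" and i: "integrable dA (\<lambda>z. norm (f z) * \<omega> (norm z))"
    and h: "f holomorphic_on unit_disc"
    using f by (auto simp: Bergman_space_def weighted_Lp_def)
  have m': "(\<lambda>z. norm (f z)) \<in> borel_measurable dA" using m by (rule measurable_compose) simp
  have "integrable W (\<lambda>z. norm (f z))" using i integrable_W_real[OF m'] by simp
  then show "integrable W f" using m by (subst (asm) integrable_norm_iff) auto
  have "0 \<le> (\<integral>z. norm (f z) \<partial>W)" by simp
  then show "weighted_Lp_norm 1 \<omega> f = (\<integral>z. norm (f z) \<partial>W)"
    unfolding weighted_Lp_norm_def by (simp add: integral_W_real[OF m'])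
  show "norm z < 1 \<Longrightarrow> (\<lambda>n. taylor_coeff f n * z ^ n) sums f z"
    by (rule taylor_coeff_sums[OF h])
qed

lemma
  assumes "integrable W (\<lambda>z. f (complex_of_real r * z) * cnj (g z))"
  shows integrable_pairing_integrand: "integrable dA (pairing_integrand \<omega> f g r)"
    and integral_pairing_integrand:
      "(\<integral>z. pairing_integrand \<omega> f g r z \<partial>dA) = (\<integral>z. f (complex_of_real r * z) * cnj (g z) \<partial>W)"
proof -
  have m: "(\<lambda>z. f (complex_of_real r * z) * cnj (g z)) \<in> borel_measurable dA"
    using borel_measurable_integrable[OF assms] by (simp only: measurable_W)
  show "integrable dA (pairing_integrand \<omega> f g r)"
    unfolding pairing_integrand_def[abs_def] using assms integrable_W[OF m] by simp
  show "(\<integral>z. pairing_integrand \<omega> f g r z \<partial>dA) = (\<integral>z. f (complex_of_real r * z) * cnj (g z) \<partial>W)"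
    unfolding pairing_integrand_def integral_W[OF m] ..
qed

lemma A2_pairing_limit:
  assumes int: "\<And>r. 0 < r \<Longrightarrow> r < 1 \<Longrightarrow> integrable W (\<lambda>z. f (complex_of_real r * z) * cnj (g z))"
    and lim: "((\<lambda>r. \<integral>z. f (complex_of_real r * z) * cnj (g z) \<partial>W) \<longlongrightarrow> L) (at_left 1)"
  shows "A2_pairing_exists \<omega> f g" "A2_pairing \<omega> f g = L"
proof -
  have ev: "eventually (\<lambda>r::real. 0 < r \<and> r < 1) (at_left 1)"
    using eventually_at_left_real[of 0 1] by (auto elim: eventually_mono)
  have "\<forall>\<^sub>F r in at_left 1. (\<integral>z. pairing_integrand \<omega> f g r z \<partial>dA) = (\<integral>z. f (complex_of_real r * z) * cnj (g z) \<partial>W)"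
    using ev by eventually_elim (auto intro!: integral_pairing_integrand int)
  then have lim': "((\<lambda>r. \<integral>z. pairing_integrand \<omega> f g r z \<partial>dA) \<longlongrightarrow> L) (at_left 1)"
    by (rule tendsto_cong[THEN iffD2, OF _ lim])
  then show "A2_pairing_exists \<omega> f g"
    unfolding A2_pairing_exists_def by (auto intro!: integrable_pairing_integrand int)
  show "A2_pairing \<omega> f g = L"
    unfolding A2_pairing_def using lim' by (intro tendsto_Lim) auto
qed

end

section \<open>From the weight class to the three estimates\<close>

text \<open>The condition 0 \<le> c takes care of negative infinity, which
  \<open>real_of_ereal\<close> sends to 0.\<close>

lemma real_of_ereal_le: "x \<le> ereal c \<Longrightarrow> 0 \<le> c \<Longrightarrow> real_of_ereal x \<le> c"
  by (cases x) auto

context split_weight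
begin

lemma Bloch_projection:
  assumes f: "f \<in> Bloch_space"
  shows "\<exists>g\<in>Linfty. (\<forall>z\<in>unit_disc. Bergman_projection \<omega> g z = f z)
    \<and> Linfty_norm g \<le> (2 + 866 / (1 - exp (- d))) * Bloch_norm f"
proof -
  note b = Bloch_space_coeffs[OF f]
  define g where "g = bounded_symbol (taylor_coeff f)"
  have h: "f holomorphic_on unit_disc" using f by (simp add: Bloch_space_def)
  have m: "g \<in> borel_measurable dA" unfolding g_def by (rule bounded_symbol_measurable)
  have d1: "0 < 1 - exp (- d)" using d_pos by simp
  have n0: "0 \<le> Bloch_norm f" by (rule Bloch_coeffs_nonneg[OF b])
  \<comment> \<open>The 2 comes from the Taylor coefficients 0 and 1, each at most the Bloch
    norm.\<close>
  have bd: "norm (g z) \<le> (2 + 866 / (1 - exp (- d))) * Bloch_norm f" if "norm z < 1" for z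
    using bounded_symbol_bound[OF b that] Bloch_taylor_0[OF f] Bloch_taylor_1[OF f]
    by (simp add: g_def distrib_right)
  have es: "esssup dA (\<lambda>z. ereal (norm (g z))) \<le> ereal ((2 + 866 / (1 - exp (- d))) * Bloch_norm f)"
  proof (rule esssup_I)
    show "(\<lambda>z. ereal (norm (g z))) \<in> borel_measurable dA" using m by measurable
    show "AE z in dA. ereal (norm (g z)) \<le> ereal ((2 + 866 / (1 - exp (- d))) * Bloch_norm f)"
      by (rule AE_I2) (use bd in simp)
  qed
  have "g \<in> Linfty" using m es by (auto simp: Linfty_def)
  moreover have "Bergman_projection \<omega> g z = f z" if "z \<in> unit_disc" for z
  proof -
    have z: "norm z < 1" using that by simp
    have "(\<lambda>n. (\<integral>\<zeta>. g \<zeta> * cnj \<zeta> ^ n \<partial>W) / complex_of_real (mass n) * z ^ n) sums Bergman_projection \<omega> g z"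
      unfolding g_def by (rule Bergman_projection_sums[OF integrable_bounded_symbol[OF b] z])
    moreover have "(\<integral>\<zeta>. g \<zeta> * cnj \<zeta> ^ n \<partial>W) / complex_of_real (mass n) = taylor_coeff f n" for n
      unfolding g_def bounded_symbol_moments[OF b] using mass_pos[of n] by simp
    ultimately have "(\<lambda>n. taylor_coeff f n * z ^ n) sums Bergman_projection \<omega> g z" by simp
    then show ?thesis using taylor_coeff_sums[OF h z] by (rule sums_unique2)
  qed
  moreover have "Linfty_norm g \<le> (2 + 866 / (1 - exp (- d))) * Bloch_norm f"
    unfolding Linfty_norm_def using n0 d1 by (intro real_of_ereal_le es mult_nonneg_nonneg) auto
  ultimately show ?thesis by blast
qed

text \<open>At each r the two orders of the pairing are conjugate to each other, both being the same
  diagonal series up to conjugation. Hence one limit and one bound serve both.\<close>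

lemma Bloch_pairing:
  assumes f: "f \<in> Bergman_space 1 \<omega>" and g: "g \<in> Bloch_space"
  defines "C \<equiv> 2 + 866 / (1 - exp (- d))"
  shows "A2_pairing_exists \<omega> f g"
    and "norm (A2_pairing \<omega> f g) \<le> C * Bloch_norm g * weighted_Lp_norm 1 \<omega> f"
    and "A2_pairing_exists \<omega> g f"
    and "norm (A2_pairing \<omega> g f) \<le> C * Bloch_norm g * weighted_Lp_norm 1 \<omega> f"
proof -
  note b = Bloch_space_coeffs[OF g]
  have "g holomorphic_on unit_disc" using g by (simp add: Bloch_space_def)
  note gs = taylor_coeff_sums[OF this]
  note fs = Bergman_space_sums[OF f] and fi = Bergman_space_integrable[OF f]
  have gi: "integrable W g" by (rule integrable_Bloch[OF b gs])
  have fm: "(\<integral>z. f z * cnj z ^ n \<partial>W) = taylor_coeff f n * complex_of_real (mass n)" for n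
    by (rule integral_series_cnj_power[OF fs fi])
  have gm: "(\<integral>z. g z * cnj z ^ n \<partial>W) = taylor_coeff g n * complex_of_real (mass n)" for n
    by (rule integral_series_cnj_power[OF gs gi])
  have i1: "integrable W (\<lambda>z. f (complex_of_real r * z) * cnj (g z))"
    and i2: "integrable W (\<lambda>z. g (complex_of_real r * z) * cnj (f z))"
    and eq: "(\<integral>z. g (complex_of_real r * z) * cnj (f z) \<partial>W) = cnj (\<integral>z. f (complex_of_real r * z) * cnj (g z) \<partial>W)"
    if r: "0 < r" "r < 1" for r
  proof -
    have r0: "0 \<le> r" using r by simp
    show "integrable W (\<lambda>z. f (complex_of_real r * z) * cnj (g z))"
      by (rule integrable_dilated_pairing[OF fs gi gm r0 r(2)])
    show "integrable W (\<lambda>z. g (complex_of_real r * z) * cnj (f z))"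
      by (rule integrable_dilated_pairing[OF gs fi fm r0 r(2)])
    have "(\<lambda>n. taylor_coeff f n * complex_of_real (r ^ n) * cnj (taylor_coeff g n) * complex_of_real (mass n))
      sums (\<integral>z. f (complex_of_real r * z) * cnj (g z) \<partial>W)"
      by (rule sums_dilated_pairing[OF fs gi gm r0 r(2)])
    then have "(\<lambda>n. cnj (taylor_coeff f n * complex_of_real (r ^ n) * cnj (taylor_coeff g n) * complex_of_real (mass n)))
      sums cnj (\<integral>z. f (complex_of_real r * z) * cnj (g z) \<partial>W)"
      by (simp only: sums_cnj)
    moreover have "(\<lambda>n. taylor_coeff g n * complex_of_real (r ^ n) * cnj (taylor_coeff f n) * complex_of_real (mass n))
      sums (\<integral>z. g (complex_of_real r * z) * cnj (f z) \<partial>W)"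
      by (rule sums_dilated_pairing[OF gs fi fm r0 r(2)])
    moreover have "cnj (taylor_coeff f n * complex_of_real (r ^ n) * cnj (taylor_coeff g n) * complex_of_real (mass n))
      = taylor_coeff g n * complex_of_real (r ^ n) * cnj (taylor_coeff f n) * complex_of_real (mass n)" for n
      by simp
    ultimately show "(\<integral>z. g (complex_of_real r * z) * cnj (f z) \<partial>W) = cnj (\<integral>z. f (complex_of_real r * z) * cnj (g z) \<partial>W)"
      by (simp only: sums_iff)
  qed
  obtain L where L: "((\<lambda>r. \<integral>z. f (complex_of_real r * z) * cnj (g z) \<partial>W) \<longlongrightarrow> L) (at_left 1)"
    "norm L \<le> (norm (taylor_coeff g 0) + norm (taylor_coeff g 1) + 866 * Bloch_norm g / (1 - exp (- d))) * (\<integral>z. norm (f z) \<partial>W)"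
    by (rule pairing_limit[OF fs fi b gs])
  have "norm (taylor_coeff g 0) + norm (taylor_coeff g 1) + 866 * Bloch_norm g / (1 - exp (- d)) \<le> C * Bloch_norm g"
    using Bloch_taylor_0[OF g] Bloch_taylor_1[OF g] by (simp add: C_def distrib_right)
  then have "norm L \<le> C * Bloch_norm g * (\<integral>z. norm (f z) \<partial>W)"
    by (intro order_trans[OF L(2)] mult_right_mono) auto
  then have bound: "norm L \<le> C * Bloch_norm g * weighted_Lp_norm 1 \<omega> f"
    by (simp only: Bergman_space_norm[OF f])
  note p1 = A2_pairing_limit[OF i1 L(1)]
  show "A2_pairing_exists \<omega> f g" by (rule p1(1))
  show "norm (A2_pairing \<omega> f g) \<le> C * Bloch_norm g * weighted_Lp_norm 1 \<omega> f"
    using bound p1(2) by simp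
  have ev: "eventually (\<lambda>r::real. 0 < r \<and> r < 1) (at_left 1)"
    using eventually_at_left_real[of 0 1] by (auto elim: eventually_mono)
  have "\<forall>\<^sub>F r in at_left 1. (\<integral>z. g (complex_of_real r * z) * cnj (f z) \<partial>W) = cnj (\<integral>z. f (complex_of_real r * z) * cnj (g z) \<partial>W)"
    using ev by eventually_elim (auto intro!: eq)
  then have "((\<lambda>r. \<integral>z. g (complex_of_real r * z) * cnj (f z) \<partial>W) \<longlongrightarrow> cnj L) (at_left 1)"
    by (rule tendsto_cong[THEN iffD2, OF _ tendsto_cnj[OF L(1)]])
  note p2 = A2_pairing_limit[OF i2 this]
  show "A2_pairing_exists \<omega> g f" by (rule p2(1))
  show "norm (A2_pairing \<omega> g f) \<le> C * Bloch_norm g * weighted_Lp_norm 1 \<omega> f"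
    using bound p2(2) by simp
qed

end

section \<open>Lacunary test polynomials\<close>

definition lacunary :: "nat \<Rightarrow> nat \<Rightarrow> complex \<Rightarrow> complex" where
  "lacunary N J z = (\<Sum>j<J. z ^ (2 ^ j * N))"

definition lacunary_exponents :: "nat \<Rightarrow> nat \<Rightarrow> nat set" where
  "lacunary_exponents N J = (\<lambda>j. 2 ^ j * N) ` {..<J}"

lemma finite_lacunary_exponents [simp]: "finite (lacunary_exponents N J)"
  by (simp add: lacunary_exponents_def)

lemma inj_lacunary: "0 < N \<Longrightarrow> inj_on (\<lambda>j. 2 ^ j * N :: nat) A"
  by (auto simp: inj_on_def)

lemma card_lacunary_exponents: "0 < N \<Longrightarrow> card (lacunary_exponents N J) = J"
  by (simp add: lacunary_exponents_def card_image inj_lacunary)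

lemma lacunary_eq: "0 < N \<Longrightarrow> lacunary N J z = (\<Sum>n\<in>lacunary_exponents N J. z ^ n)"
  by (simp add: lacunary_def lacunary_exponents_def sum.reindex inj_lacunary)

lemma lacunary_sums:
  assumes "0 < N"
  shows "(\<lambda>n. (if n \<in> lacunary_exponents N J then 1 else 0) * z ^ n) sums lacunary N J z"
proof -
  have "(\<lambda>n. if n \<in> lacunary_exponents N J then z ^ n else 0) sums lacunary N J z"
    unfolding lacunary_eq[OF assms] by (rule sums_If_finite_set) simp
  moreover have "(if n \<in> lacunary_exponents N J then z ^ n else 0) = (if n \<in> lacunary_exponents N J then 1 else 0) * z ^ n" for n
    by simp
  ultimately show ?thesis by (simp only:)
qed

text \<open>Powers of r decrease, so for j \<ge> 1 the j-th term is at most twice the sum of r^i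
  over the dyadic range from 2^(j-1) N up to 2^j N. These ranges are disjoint, whence a bound free
  of J after summing the geometric series.\<close>

lemma lacunary_derivative_sum:
  fixes r :: real
  assumes r: "0 \<le> r" "r < 1"
  shows "(\<Sum>j<Suc J. real (2 ^ j * N) * r ^ (2 ^ j * N - 1)) \<le> 2 * (\<Sum>i<2 ^ J * N. r ^ i)"
proof -
  have last: "real b * r ^ (a + b - 1) \<le> (\<Sum>i<b. r ^ (a + i))" for a b :: nat
  proof -
    have "(\<Sum>i<b. r ^ (a + b - 1)) \<le> (\<Sum>i<b. r ^ (a + i))"
      using r by (intro sum_mono power_decreasing) auto
    then show ?thesis by simp
  qed
  show ?thesis
  proof (induction J)
    case 0
    have "real N * r ^ (N - 1) \<le> (\<Sum>i<N. r ^ i)" using last[of N 0] by simp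
    moreover have "0 \<le> (\<Sum>i<N. r ^ i)" using r by (intro sum_nonneg) auto
    ultimately show ?case by simp
  next
    case (Suc J)
    define a where "a = 2 ^ J * N"
    have a2: "2 ^ Suc J * N = a + a" by (simp add: a_def)
    have "(\<Sum>j<Suc (Suc J). real (2 ^ j * N) * r ^ (2 ^ j * N - 1)) =
      (\<Sum>j<Suc J. real (2 ^ j * N) * r ^ (2 ^ j * N - 1)) + real (a + a) * r ^ (a + a - 1)"
      by (simp only: sum.lessThan_Suc[of _ "Suc J"] a2)
    also have "\<dots> \<le> 2 * (\<Sum>i<a. r ^ i) + 2 * (\<Sum>i<a. r ^ (a + i))"
    proof (rule add_mono)
      show "(\<Sum>j<Suc J. real (2 ^ j * N) * r ^ (2 ^ j * N - 1)) \<le> 2 * (\<Sum>i<a. r ^ i)"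
        unfolding a_def by (rule Suc)
      have "real (a + a) * r ^ (a + a - 1) = 2 * (real a * r ^ (a + a - 1))" by simp
      then show "real (a + a) * r ^ (a + a - 1) \<le> 2 * (\<Sum>i<a. r ^ (a + i))"
        using last[of a a] by linarith
    qed
    also have "\<dots> = 2 * (\<Sum>i<a + a. r ^ i)" by (simp only: sum_lessThan_add distrib_left)
    finally show ?case by (simp only: a2)
  qed
qed

lemma lacunary_deriv:
  "deriv (lacunary N J) z = (\<Sum>j<J. of_nat (2 ^ j * N) * z ^ (2 ^ j * N - 1))"
  unfolding lacunary_def
  by (rule DERIV_imp_deriv) (auto intro!: derivative_eq_intros sum.cong)

lemma lacunary_holomorphic: "lacunary N J holomorphic_on A"
  unfolding lacunary_def by (intro holomorphic_intros)

lemma lacunary_deriv_bound: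
  assumes z: "norm z < 1"
  shows "norm (deriv (lacunary N J) z) * (1 - (norm z)\<^sup>2) \<le> 4"
proof -
  define r where "r = norm z"
  have r: "0 \<le> r" "r < 1" using z by (auto simp: r_def)
  have "norm (deriv (lacunary N J) z) \<le> (\<Sum>j<J. real (2 ^ j * N) * r ^ (2 ^ j * N - 1))"
    unfolding lacunary_deriv by (rule sum_norm_le) (simp add: norm_mult norm_power r_def)
  also have "\<dots> \<le> (\<Sum>j<Suc J. real (2 ^ j * N) * r ^ (2 ^ j * N - 1))"
    using r by simp
  also have "\<dots> \<le> 2 * (\<Sum>i<2 ^ J * N. r ^ i)" by (rule lacunary_derivative_sum[OF r])
  also have "\<dots> \<le> 2 * (1 / (1 - r))"
  proof -
    have "(\<Sum>i<2 ^ J * N. r ^ i) \<le> (\<Sum>i. r ^ i)"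
      using r by (intro sum_le_suminf summable_geometric) auto
    then show ?thesis using r suminf_geometric[of r] by simp
  qed
  finally have "norm (deriv (lacunary N J) z) * (1 - r\<^sup>2) \<le> 2 * (1 / (1 - r)) * (1 - r\<^sup>2)"
    using r by (intro mult_right_mono) (auto simp: power_le_one)
  also have "1 - r\<^sup>2 = (1 - r) * (1 + r)" by (simp add: power2_eq_square algebra_simps)
  also have "2 * (1 / (1 - r)) * ((1 - r) * (1 + r)) = 2 * (1 + r)" using r by simp
  also have "\<dots> \<le> 4" using r by simp
  finally show ?thesis by (simp add: r_def power2_eq_square algebra_simps)
qed

lemma lacunary_Bloch:
  assumes "0 < N"
  shows "lacunary N J \<in> Bloch_space" "Bloch_norm (lacunary N J) \<le> 4"
proof -
  show "lacunary N J \<in> Bloch_space"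
    unfolding Bloch_space_def using lacunary_deriv_bound
    by (auto intro!: lacunary_holomorphic bdd_aboveI[of _ 4])
  have "lacunary N J 0 = 0"
    unfolding lacunary_def using assms by (intro sum.neutral) (auto simp: power_0_left)
  then show "Bloch_norm (lacunary N J) \<le> 4"
    using Bloch_norm_le[of "lacunary N J" 4] lacunary_deriv_bound by simp
qed

text \<open>The derivative of a polynomial is bounded on the closed disc, so the same test functions
  also serve the statement about the little Bloch space.\<close>

lemma lacunary_little_Bloch: "lacunary N J \<in> little_Bloch_space"
proof -
  define B where "B = (\<Sum>j<J. real (2 ^ j * N))"
  have bd: "norm (deriv (lacunary N J) z) \<le> B" if "norm z \<le> 1" for z
    unfolding lacunary_deriv B_def
    using that by (intro sum_norm_le) (auto simp: norm_mult norm_power intro!: mult_left_le power_le_one)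
  have "((\<lambda>r. B * \<bar>1 - r\<^sup>2\<bar>) \<longlongrightarrow> B * \<bar>1 - 1\<^sup>2\<bar>) (at_left (1::real))"
    by (intro tendsto_intros)
  then have "((\<lambda>r. B * \<bar>1 - r\<^sup>2\<bar>) \<longlongrightarrow> 0) (at_left (1::real))" by simp
  then have lim: "((\<lambda>z::complex. B * \<bar>1 - (norm z)\<^sup>2\<bar>) \<longlongrightarrow> 0) (filtercomap norm (at_left 1))"
    by (rule filterlim_compose) (rule filterlim_filtercomap)
  have "eventually (\<lambda>r::real. r < 1) (at_left 1)"
    using eventually_at_left_real[of 0 1] by (auto elim: eventually_mono)
  then have "eventually (\<lambda>z::complex. norm z < 1) (filtercomap norm (at_left 1))"
    by (rule eventually_filtercomapI)
  then have "eventually (\<lambda>z. norm (deriv (lacunary N J) z * complex_of_real (1 - (norm z)\<^sup>2)) \<le> B * \<bar>1 - (norm z)\<^sup>2\<bar>)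
    (filtercomap norm (at_left 1))"
    by eventually_elim (simp only: norm_mult norm_of_real, intro mult_right_mono bd, auto)
  from Lim_null_comparison[OF this lim]
  show ?thesis by (simp add: little_Bloch_space_def lacunary_holomorphic)
qed

section \<open>Testing: energy against mean value of the lacunary polynomial\<close>

context weighted_disc
begin

lemma mass_antimono: "m \<le> n \<Longrightarrow> mass n \<le> mass m"
  unfolding mass_eq_moment by (intro mult_left_mono moment_mono) auto

lemma lacunary_bounded: "norm z < 1 \<Longrightarrow> norm (lacunary N J z) \<le> real J"
proof -
  assume z: "norm z < 1"
  have "norm (lacunary N J z) \<le> (\<Sum>j<J. 1)"
    unfolding lacunary_def using z by (intro sum_norm_le) (auto simp: norm_power power_le_one)
  then show ?thesis by simp
qed

lemma lacunary_measurable: "lacunary N J \<in> borel_measurable dA"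
  unfolding lacunary_def by (intro borel_measurable_dA) measurable

lemma integrable_lacunary: "integrable W (lacunary N J)"
  by (rule integrable_W_bounded[OF lacunary_measurable lacunary_bounded])

lemma lacunary_Bergman: "lacunary N J \<in> Bergman_space 1 \<omega>"
proof -
  have "integrable W (\<lambda>z. norm (lacunary N J z))" by (intro integrable_norm integrable_lacunary)
  moreover have "(\<lambda>z. norm (lacunary N J z)) \<in> borel_measurable dA"
    using lacunary_measurable by (rule measurable_compose) simp
  ultimately have "integrable dA (\<lambda>z. norm (lacunary N J z) * \<omega> (norm z))"
    using integrable_W_real by blast
  then show ?thesis
    by (simp add: Bergman_space_def weighted_Lp_def lacunary_measurable lacunary_holomorphic)
qed

text \<open>Factoring out z^N leaves a polynomial q with J unit coefficients, and by Parseval the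
  integral of |q|^2 |z|^N is at most J times that of |z|^N. Cauchy-Schwarz for the weight |z|^N, in
  its AM-GM form, then costs only sqrt J.\<close>

lemma lacunary_norm:
  assumes N: "0 < N" and J: "0 < J"
  shows "(\<integral>z. norm (lacunary N J z) \<partial>W) \<le> sqrt (real J) * (2 * moment \<omega> (real N + 1))"
proof -
  \<comment> \<open>The exponents that remain after z^N has been factored out.\<close>
  define e where "e j = (2 ^ j - 1) * N" for j :: nat
  define S where "S = e ` {..<J}"
  define c where "c n = (if n \<in> S then 1 else 0 :: complex)" for n
  define \<mu> where "\<mu> = (\<integral>z. norm z ^ N \<partial>W)"
  have e: "2 ^ j * N = N + e j" for j
  proof -
    have "(2::nat) ^ j = 1 + (2 ^ j - 1)" by simp
    then have "2 ^ j * N = (1 + (2 ^ j - 1)) * N" by (simp only:)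
    then show ?thesis by (simp only: e_def distrib_right mult_1)
  qed
  have inj: "inj_on e {..<J}"
    using inj_lacunary[OF N, of "{..<J}"] unfolding inj_on_def e by auto
  have finS: "finite S" "card S = J" by (auto simp: S_def card_image[OF inj])
  have c: "summable (\<lambda>n. norm (c n))"
    by (rule summable_finite[of S]) (auto simp: c_def finS)
  have pm: "(\<lambda>r::real. r ^ N) \<in> borel_measurable borel" by measurable
  have pb: "\<bar>r ^ N\<bar> \<le> 1" if "0 \<le> r" "r < 1" for r :: real
    using that by (simp add: power_le_one)
  define q where "q z = (\<Sum>n. c n * z ^ n)" for z
  have q: "q z = (\<Sum>j<J. z ^ e j)" for z
  proof -
    have "q z = (\<Sum>n\<in>S. c n * z ^ n)"
      unfolding q_def by (rule suminf_finite) (auto simp: c_def finS)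
    also have "\<dots> = (\<Sum>n\<in>S. z ^ n)" by (rule sum.cong) (auto simp: c_def)
    finally show ?thesis by (simp add: S_def sum.reindex[OF inj])
  qed
  have p: "lacunary N J z = z ^ N * q z" for z
    unfolding lacunary_def q e power_add sum_distrib_left ..
  have P1: "integrable W (\<lambda>z. (norm (q z))\<^sup>2 * norm z ^ N)"
    unfolding q_def by (rule Parseval(1)[OF c pm pb])
  have P2: "(\<lambda>n. (norm (c n))\<^sup>2 * (\<integral>z. norm z ^ (2 * n) * norm z ^ N \<partial>W))
      sums (\<integral>z. (norm (q z))\<^sup>2 * norm z ^ N \<partial>W)"
    unfolding q_def by (rule Parseval(2)[OF c pm pb])
  have ip: "integrable W (\<lambda>z. norm z ^ n)" for n
    by (rule integrable_radial[where B=1]) (auto simp: power_le_one)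
  have "(\<integral>z. (norm (q z))\<^sup>2 * norm z ^ N \<partial>W) = (\<Sum>n\<in>S. (norm (c n))\<^sup>2 * (\<integral>z. norm z ^ (2 * n) * norm z ^ N \<partial>W))"
    using P2 by (rule sums_unique2) (rule sums_finite, auto simp: c_def finS)
  also have "\<dots> \<le> (\<Sum>n\<in>S. \<mu>)"
  proof (rule sum_mono)
    fix n assume "n \<in> S"
    have "(\<integral>z. norm z ^ (2 * n) * norm z ^ N \<partial>W) \<le> \<mu>"
      unfolding \<mu>_def power_add[symmetric]
      by (rule integral_mono[OF ip ip]) (auto intro!: power_decreasing)
    then show "(norm (c n))\<^sup>2 * (\<integral>z. norm z ^ (2 * n) * norm z ^ N \<partial>W) \<le> \<mu>"
      using \<open>n \<in> S\<close> by (simp add: c_def)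
  qed
  also have "\<dots> = real J * \<mu>" using finS by simp
  finally have q2: "(\<integral>z. (norm (q z))\<^sup>2 * norm z ^ N \<partial>W) \<le> real J * \<mu>" .
  \<comment> \<open>This parameter balances the two terms of the AM-GM inequality.\<close>
  define t where "t = sqrt (real J)"
  have t: "0 < t" "real J = t * t" using J by (auto simp: t_def)
  have "(\<integral>z. norm (lacunary N J z) \<partial>W) \<le> (\<integral>z. (norm (q z))\<^sup>2 * norm z ^ N * (1 / (2 * t)) + norm z ^ N * (t / 2) \<partial>W)"
  proof (rule integral_mono)
    show "integrable W (\<lambda>z. norm (lacunary N J z))" by (intro integrable_norm integrable_lacunary)
    show "integrable W (\<lambda>z. (norm (q z))\<^sup>2 * norm z ^ N * (1 / (2 * t)) + norm z ^ N * (t / 2))"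
      by (intro Bochner_Integration.integrable_add Bochner_Integration.integrable_mult_left P1 ip)
    fix z :: complex
    have "norm (q z) \<le> (norm (q z))\<^sup>2 * (1 / (2 * t)) + t / 2"
    proof -
      have "0 \<le> (norm (q z) - t)\<^sup>2 / (2 * t)" using t by (intro divide_nonneg_nonneg) auto
      also have "\<dots> = (norm (q z))\<^sup>2 * (1 / (2 * t)) + t / 2 - norm (q z)"
        using t by (simp add: power2_eq_square field_simps)
      finally show ?thesis by simp
    qed
    then have "norm z ^ N * norm (q z) \<le> norm z ^ N * ((norm (q z))\<^sup>2 * (1 / (2 * t)) + t / 2)"
      by (rule mult_left_mono) simp
    then show "norm (lacunary N J z) \<le> (norm (q z))\<^sup>2 * norm z ^ N * (1 / (2 * t)) + norm z ^ N * (t / 2)"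
      by (simp add: p norm_mult norm_power distrib_left mult_ac)
  qed
  also have "\<dots> = (\<integral>z. (norm (q z))\<^sup>2 * norm z ^ N \<partial>W) * (1 / (2 * t)) + \<mu> * (t / 2)"
    unfolding \<mu>_def
    by (subst Bochner_Integration.integral_add[OF Bochner_Integration.integrable_mult_left[OF P1]
          Bochner_Integration.integrable_mult_left[OF ip]])
      (simp only: Bochner_Integration.integral_mult_left_zero)
  also have "\<dots> \<le> real J * \<mu> * (1 / (2 * t)) + \<mu> * (t / 2)"
    using q2 t by (intro add_mono mult_right_mono) auto
  also have "\<dots> = t * \<mu>" using t by (simp add: field_simps)
  finally show ?thesis by (simp add: t_def \<mu>_def integral_norm_power)
qed

text \<open>The squared \<open>A\<^sup>2\<close> norm of the polynomial, which is also its pairing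
  with itself.\<close>

definition lacunary_energy :: "nat \<Rightarrow> nat \<Rightarrow> real" where
  "lacunary_energy N J = (\<Sum>n\<in>lacunary_exponents N J. mass n)"

lemma lacunary_energy_ge:
  assumes "0 < N"
  shows "real J * mass (2 ^ J * N) \<le> lacunary_energy N J"
proof -
  have "real J * mass (2 ^ J * N) = (\<Sum>n\<in>lacunary_exponents N J. mass (2 ^ J * N))"
    using card_lacunary_exponents[OF assms] by simp
  also have "\<dots> \<le> lacunary_energy N J"
    unfolding lacunary_energy_def
    by (intro sum_mono mass_antimono) (auto simp: lacunary_exponents_def intro!: mult_right_mono power_increasing)
  finally show ?thesis .
qed

lemma lacunary_energy_nonneg: "0 \<le> lacunary_energy N J"
  unfolding lacunary_energy_def by (intro sum_nonneg less_imp_le mass_pos)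

lemma lacunary_pairing:
  assumes N: "0 < N"
  shows "A2_pairing \<omega> (lacunary N J) (lacunary N J) = complex_of_real (lacunary_energy N J)"
proof -
  define a where "a n = (if n \<in> lacunary_exponents N J then 1 else 0 :: complex)" for n
  have s: "(\<lambda>n. a n * z ^ n) sums lacunary N J z" for z
    unfolding a_def by (rule lacunary_sums[OF N])
  have m: "(\<integral>z. lacunary N J z * cnj z ^ n \<partial>W) = a n * complex_of_real (mass n)" for n
    by (rule integral_series_cnj_power[OF s integrable_lacunary])
  have int: "integrable W (\<lambda>z. lacunary N J (complex_of_real r * z) * cnj (lacunary N J z))"
    and val: "(\<integral>z. lacunary N J (complex_of_real r * z) * cnj (lacunary N J z) \<partial>W)
      = (\<Sum>n\<in>lacunary_exponents N J. complex_of_real (r ^ n * mass n))" if "0 < r" "r < 1" for r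
  proof -
    have r0: "0 \<le> r" using that by simp
    show "integrable W (\<lambda>z. lacunary N J (complex_of_real r * z) * cnj (lacunary N J z))"
      by (rule integrable_dilated_pairing[OF s integrable_lacunary m r0 that(2)])
    have "(\<lambda>n. if n \<in> lacunary_exponents N J then complex_of_real (r ^ n * mass n) else 0)
      = (\<lambda>n. a n * complex_of_real (r ^ n) * cnj (a n) * complex_of_real (mass n))"
      by (auto simp: a_def)
    moreover have "(\<lambda>n. if n \<in> lacunary_exponents N J then complex_of_real (r ^ n * mass n) else 0)
      sums (\<Sum>n\<in>lacunary_exponents N J. complex_of_real (r ^ n * mass n))"
      by (rule sums_If_finite_set) simp
    ultimately show "(\<integral>z. lacunary N J (complex_of_real r * z) * cnj (lacunary N J z) \<partial>W)
      = (\<Sum>n\<in>lacunary_exponents N J. complex_of_real (r ^ n * mass n))"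
      using sums_dilated_pairing[OF s integrable_lacunary m r0 that(2)] by (simp only: sums_iff)
  qed
  have ev: "eventually (\<lambda>r::real. 0 < r \<and> r < 1) (at_left 1)"
    using eventually_at_left_real[of 0 1] by (auto elim: eventually_mono)
  have "\<forall>\<^sub>F r in at_left 1. (\<integral>z. lacunary N J (complex_of_real r * z) * cnj (lacunary N J z) \<partial>W)
      = (\<Sum>n\<in>lacunary_exponents N J. complex_of_real (r ^ n * mass n))"
    using ev by (rule eventually_mono) (rule val; simp)
  moreover have "((\<lambda>r. \<Sum>n\<in>lacunary_exponents N J. complex_of_real (r ^ n * mass n))
      \<longlongrightarrow> (\<Sum>n\<in>lacunary_exponents N J. complex_of_real (1 ^ n * mass n))) (at_left 1)"
    by (intro tendsto_intros)
  ultimately have "((\<lambda>r. \<integral>z. lacunary N J (complex_of_real r * z) * cnj (lacunary N J z) \<partial>W)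
      \<longlongrightarrow> (\<Sum>n\<in>lacunary_exponents N J. complex_of_real (1 ^ n * mass n))) (at_left 1)"
    by (rule tendsto_cong[THEN iffD2])
  from A2_pairing_limit(2)[OF int this] show ?thesis
    by (simp add: lacunary_energy_def)
qed

text \<open>Self-adjointness of the projection tested on a polynomial: g has the same moments as its
  projection, so integrating g against the conjugate of the polynomial returns the energy, and the
  sup norm of g comes out of the integral.\<close>

lemma lacunary_energy_projection:
  assumes N: "0 < N" and g: "g \<in> Linfty"
    and P: "\<And>z. norm z < 1 \<Longrightarrow> Bergman_projection \<omega> g z = lacunary N J z"
  shows "lacunary_energy N J \<le> Linfty_norm g * (\<integral>z. norm (lacunary N J z) \<partial>W)"
proof -
  define a where "a n = (if n \<in> lacunary_exponents N J then 1 else 0 :: complex)" for n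
  have s: "(\<lambda>n. a n * z ^ n) sums lacunary N J z" for z
    unfolding a_def by (rule lacunary_sums[OF N])
  have gm: "g \<in> borel_measurable dA" and fin: "esssup dA (\<lambda>z. ereal (norm (g z))) < \<infinity>"
    using g by (auto simp: Linfty_def)
  have "AE z in dA. ereal (norm (g z)) \<le> esssup dA (\<lambda>z. ereal (norm (g z)))"
    by (rule esssup_AE)
  then have "AE z in dA. norm (g z) \<le> Linfty_norm g"
  proof eventually_elim
    case (elim z)
    then show ?case using fin unfolding Linfty_norm_def
      by (cases "esssup dA (\<lambda>z. ereal (norm (g z)))") auto
  qed
  then have ae: "AE z in W. norm (g z) \<le> Linfty_norm g"
    unfolding weighted_dA_def using weight_measurable by (subst AE_density) auto
  have gi: "integrable W g"
    by (rule finite_measure.integrable_const_bound[OF finite_measure_W ae]) (simp only: measurable_W gm)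
  have mom: "(\<integral>\<zeta>. g \<zeta> * cnj \<zeta> ^ n \<partial>W) = a n * complex_of_real (mass n)" for n
  proof -
    have "(\<integral>z. lacunary N J z * cnj z ^ n \<partial>W) = (\<integral>\<zeta>. g \<zeta> * cnj \<zeta> ^ n \<partial>W) / complex_of_real (mass n) * complex_of_real (mass n)"
      by (rule integral_series_cnj_power[OF _ integrable_lacunary])
        (simp only: P[symmetric] Bergman_projection_sums[OF gi])
    moreover have "(\<integral>z. lacunary N J z * cnj z ^ n \<partial>W) = a n * complex_of_real (mass n)"
      by (rule integral_series_cnj_power[OF s integrable_lacunary])
    ultimately show ?thesis using mass_pos[of n] by simp
  qed
  have gz: "integrable W (\<lambda>z. g z * cnj z ^ n)" for n
  proof (rule integrable_W_mult_bounded[OF gi, where B=1])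
    show "(\<lambda>z::complex. cnj z ^ n) \<in> borel_measurable dA" by (intro borel_measurable_dA) measurable
  qed (simp add: norm_power power_le_one)
  have eq: "g z * cnj (lacunary N J z) = (\<Sum>n\<in>lacunary_exponents N J. g z * cnj z ^ n)" for z
    by (simp add: lacunary_eq[OF N] sum_distrib_left)
  have "(\<integral>z. g z * cnj (lacunary N J z) \<partial>W) = (\<Sum>n\<in>lacunary_exponents N J. a n * complex_of_real (mass n))"
    unfolding eq by (subst Bochner_Integration.integral_sum[OF gz]) (simp only: mom)
  also have "\<dots> = complex_of_real (lacunary_energy N J)"
    by (simp add: lacunary_energy_def a_def)
  finally have E: "(\<integral>z. g z * cnj (lacunary N J z) \<partial>W) = complex_of_real (lacunary_energy N J)" .
  have i1: "integrable W (\<lambda>z. g z * cnj (lacunary N J z))"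
    unfolding eq by (intro Bochner_Integration.integrable_sum gz)
  have "norm (\<integral>z. g z * cnj (lacunary N J z) \<partial>W) \<le> (\<integral>z. norm (g z * cnj (lacunary N J z)) \<partial>W)"
    by (rule integral_norm_bound)
  also have "\<dots> \<le> (\<integral>z. Linfty_norm g * norm (lacunary N J z) \<partial>W)"
  proof (rule integral_mono_AE)
    show "integrable W (\<lambda>z. norm (g z * cnj (lacunary N J z)))" using i1 by (rule integrable_norm)
    show "integrable W (\<lambda>z. Linfty_norm g * norm (lacunary N J z))"
      by (intro Bochner_Integration.integrable_mult_right integrable_norm integrable_lacunary)
    show "AE z in W. norm (g z * cnj (lacunary N J z)) \<le> Linfty_norm g * norm (lacunary N J z)"
      using ae by eventually_elim (auto simp: norm_mult intro!: mult_right_mono)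
  qed
  finally show ?thesis using lacunary_energy_nonneg[of N J] by (simp add: E)
qed

lemma weight_class_M_I:
  assumes C: "0 < C"
    and energy: "\<And>N J. 0 < N \<Longrightarrow> 0 < J \<Longrightarrow> lacunary_energy N J \<le> C * (\<integral>z. norm (lacunary N J z) \<partial>W)"
  shows "\<omega> \<in> weight_class_M"
proof -
  \<comment> \<open>Energy over mean value gains sqrt J, so sqrt J \<ge> 2 C turns the constant C
    into the factor 2 required between moments.\<close>
  obtain J where J: "(2 * C)\<^sup>2 < real J" using reals_Archimedean2 by blast
  have J0: "0 < J"
    using J zero_le_power2[of "2 * C"] by (intro gr0I) auto
  have sJ: "2 * C \<le> sqrt (real J)" using J by (intro real_le_rsqrt) simp
  have half: "2 * moment \<omega> (2 * (2 ^ J * real N) + 1) \<le> moment \<omega> (real N + 1)" if N: "0 < N" for N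
  proof -
    let ?a = "moment \<omega> (2 * (2 ^ J * real N) + 1)" and ?b = "moment \<omega> (real N + 1)"
    have a: "0 \<le> ?a" by (rule less_imp_le[OF moment_pos]) simp
    have "real J * (2 * ?a) \<le> lacunary_energy N J"
      using lacunary_energy_ge[OF N, of J] by (simp add: mass_eq_moment)
    also have "\<dots> \<le> C * (sqrt (real J) * (2 * ?b))"
      using C by (intro order_trans[OF energy[OF N J0]] mult_left_mono lacunary_norm N J0) auto
    finally have "real J * ?a \<le> C * (sqrt (real J) * ?b)" by simp
    moreover have "real J * ?a = sqrt (real J) * (sqrt (real J) * ?a)"
      by (simp only: mult.assoc[symmetric] real_sqrt_mult_self abs_of_nat)
    ultimately have "sqrt (real J) * (sqrt (real J) * ?a) \<le> sqrt (real J) * (C * ?b)"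
      by (simp only: mult.left_commute[of C])
    then have "sqrt (real J) * ?a \<le> C * ?b" using J0 by simp
    moreover have "2 * C * ?a \<le> sqrt (real J) * ?a" using sJ a by (rule mult_right_mono)
    ultimately have "C * (2 * ?a) \<le> C * ?b" by simp
    then show ?thesis using C by simp
  qed
  \<comment> \<open>The passage from the integer N to a real x \<ge> 1 costs N \<le> 2x, hence 4 *
    2^J; the remaining 1 absorbs the shift in the moment index, as 1 \<le> x.\<close>
  define K :: real where "K = 4 * 2 ^ J + 1"
  have "moment \<omega> x \<ge> 2 * moment \<omega> (K * x)" if x: "1 \<le> x" for x
  proof -
    define N where "N = nat \<lceil>x\<rceil>"
    have N: "x \<le> real N" "real N \<le> 2 * x" using x unfolding N_def by linarith+
    have "0 < N" using N(1) x by (intro gr0I) auto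
    have "2 * (2 ^ J * real N) \<le> 2 * (2 ^ J * (2 * x))" using N by (intro mult_left_mono) auto
    then have "2 * (2 ^ J * real N) + 1 \<le> 2 * (2 ^ J * (2 * x)) + x" using x by (rule add_mono)
    also have "\<dots> = K * x" by (simp add: K_def algebra_simps)
    finally have "2 * (2 ^ J * real N) + 1 \<le> K * x" .
    then have "2 * moment \<omega> (K * x) \<le> 2 * moment \<omega> (2 * (2 ^ J * real N) + 1)"
      by (intro mult_left_mono moment_mono) auto
    also have "\<dots> \<le> moment \<omega> (real N + 1)" by (rule half[OF \<open>0 < N\<close>])
    also have "\<dots> \<le> moment \<omega> x" using N x by (intro moment_mono) auto
    finally show ?thesis .
  qed
  moreover have "1 < K" by (simp add: K_def)
  ultimately show ?thesis
    unfolding weight_class_M_def by (intro CollectI exI[of _ "2::real"] exI[of _ K] conjI) auto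
qed

end

section \<open>The equivalence of the four statements\<close>

theorem theorem2:
  fixes \<omega> :: "real \<Rightarrow> real"
  assumes "radial_weight \<omega>"
    and "\<forall>z\<in>unit_disc. weight_tail \<omega> z > 0"
  shows
    "((\<exists>C>0. \<forall>f\<in>Bloch_space. \<exists>g\<in>Linfty.
         (\<forall>z\<in>unit_disc. Bergman_projection \<omega> g z = f z) \<and> Linfty_norm g \<le> C * Bloch_norm f)
       \<longleftrightarrow> \<omega> \<in> weight_class_M) \<and>
     ((\<exists>C>0. \<forall>f\<in>Bergman_space 1 \<omega>. \<forall>g\<in>Bloch_space.
         A2_pairing_exists \<omega> f g \<and>
         norm (A2_pairing \<omega> f g) \<le> C * Bloch_norm g * weighted_Lp_norm 1 \<omega> f)
       \<longleftrightarrow> \<omega> \<in> weight_class_M) \<and>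
     ((\<exists>C>0. \<forall>f\<in>Bergman_space 1 \<omega>. \<forall>g\<in>little_Bloch_space.
         A2_pairing_exists \<omega> g f \<and>
         norm (A2_pairing \<omega> g f) \<le> C * Bloch_norm g * weighted_Lp_norm 1 \<omega> f)
       \<longleftrightarrow> \<omega> \<in> weight_class_M)"
proof -
  interpret weighted_disc \<omega> using assms by unfold_locales
  let ?i = "\<exists>C>0. \<forall>f\<in>Bloch_space. \<exists>g\<in>Linfty.
         (\<forall>z\<in>unit_disc. Bergman_projection \<omega> g z = f z) \<and> Linfty_norm g \<le> C * Bloch_norm f"
  let ?ii = "\<exists>C>0. \<forall>f\<in>Bergman_space 1 \<omega>. \<forall>g\<in>Bloch_space.
         A2_pairing_exists \<omega> f g \<and>
         norm (A2_pairing \<omega> f g) \<le> C * Bloch_norm g * weighted_Lp_norm 1 \<omega> f"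
  let ?iii = "\<exists>C>0. \<forall>f\<in>Bergman_space 1 \<omega>. \<forall>g\<in>little_Bloch_space.
         A2_pairing_exists \<omega> g f \<and>
         norm (A2_pairing \<omega> g f) \<le> C * Bloch_norm g * weighted_Lp_norm 1 \<omega> f"
  have M: "?i \<and> ?ii \<and> ?iii" if w: "\<omega> \<in> weight_class_M"
  proof -
    obtain d where "split_weight \<omega> d" using weight_class_M_split[OF w] by blast
    then interpret split_weight \<omega> d .
    define C where "C = 2 + 866 / (1 - exp (- d))"
    have C: "0 < C" using d_pos by (simp add: C_def add_pos_pos)
    note pair = Bloch_pairing[folded C_def]
    have ?i using C Bloch_projection[folded C_def] by blast
    moreover have ?ii using C pair(1,2) by blast
    moreover have ?iii using C pair(3,4) little_Bloch_subset by blast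
    ultimately show ?thesis by blast
  qed
  \<comment> \<open>The 4 bounds the Bloch norm of the test polynomial independently of N and J.
    Pairing that polynomial with itself lets one inequality handle both duality statements.\<close>
  have energy: "lacunary_energy N J \<le> 4 * C * (\<integral>z. norm (lacunary N J z) \<partial>W)"
    if "C > 0" "0 < N" "norm (A2_pairing \<omega> (lacunary N J) (lacunary N J))
      \<le> C * Bloch_norm (lacunary N J) * weighted_Lp_norm 1 \<omega> (lacunary N J)" for C N J
  proof -
    have "lacunary_energy N J \<le> C * Bloch_norm (lacunary N J) * (\<integral>z. norm (lacunary N J z) \<partial>W)"
      using that(3) lacunary_energy_nonneg[of N J]
      by (simp add: lacunary_pairing[OF that(2)] Bergman_space_norm[OF lacunary_Bergman])
    also have "\<dots> \<le> C * 4 * (\<integral>z. norm (lacunary N J z) \<partial>W)"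
      using that(1) lacunary_Bloch(2)[OF that(2)] by (intro mult_right_mono mult_left_mono) auto
    finally show ?thesis by (simp add: mult.commute)
  qed
  have "\<omega> \<in> weight_class_M" if ?i
  proof -
    obtain C where C: "C > 0" and ex: "\<forall>f\<in>Bloch_space. \<exists>g\<in>Linfty.
         (\<forall>z\<in>unit_disc. Bergman_projection \<omega> g z = f z) \<and> Linfty_norm g \<le> C * Bloch_norm f"
      using \<open>?i\<close> by blast
    show ?thesis
    proof (rule weight_class_M_I[of "4 * C"])
      fix N J :: nat assume N: "0 < N"
      obtain g where g: "g \<in> Linfty" "\<forall>z\<in>unit_disc. Bergman_projection \<omega> g z = lacunary N J z"
        "Linfty_norm g \<le> C * Bloch_norm (lacunary N J)"
        using ex lacunary_Bloch(1)[OF N] by blast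
      have "C * Bloch_norm (lacunary N J) \<le> C * 4"
        using C lacunary_Bloch(2)[OF N] by (intro mult_left_mono) auto
      then have "Linfty_norm g * (\<integral>z. norm (lacunary N J z) \<partial>W) \<le> 4 * C * (\<integral>z. norm (lacunary N J z) \<partial>W)"
        using g(3) by (intro mult_right_mono) auto
      then show "lacunary_energy N J \<le> 4 * C * (\<integral>z. norm (lacunary N J z) \<partial>W)"
        using g(2) by (intro order_trans[OF lacunary_energy_projection[OF N g(1)]]) auto
    qed (use C in simp)
  qed
  moreover have "\<omega> \<in> weight_class_M" if ?ii
  proof -
    obtain C where C: "C > 0" and bound: "\<forall>f\<in>Bergman_space 1 \<omega>. \<forall>g\<in>Bloch_space.
         A2_pairing_exists \<omega> f g \<and>
         norm (A2_pairing \<omega> f g) \<le> C * Bloch_norm g * weighted_Lp_norm 1 \<omega> f"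
      using \<open>?ii\<close> by blast
    show ?thesis
      using C bound lacunary_Bergman lacunary_Bloch(1)
      by (intro weight_class_M_I[of "4 * C"] energy) auto
  qed
  moreover have "\<omega> \<in> weight_class_M" if ?iii
  proof -
    obtain C where C: "C > 0" and bound: "\<forall>f\<in>Bergman_space 1 \<omega>. \<forall>g\<in>little_Bloch_space.
         A2_pairing_exists \<omega> g f \<and>
         norm (A2_pairing \<omega> g f) \<le> C * Bloch_norm g * weighted_Lp_norm 1 \<omega> f"
      using \<open>?iii\<close> by blast
    show ?thesis
      using C bound lacunary_Bergman lacunary_little_Bloch
      by (intro weight_class_M_I[of "4 * C"] energy) auto
  qed
  ultimately show ?thesis using M by blast
qed

end
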